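(* Let $(u,p)$ be pressure-admissible local Navier–Stokes data on $Q_1$, and let $D=D_\Lambda(u,p)$ be given by the canonical package coordinates together with any choice of finite gate/slack and observable rules (all defined in the context). Then $D_\Lambda(u,p)$ is a well-defined sharp localized finite-window package in the coordinate sense, i.e. all its coordinates are well-defined and finite in their declared spaces. In particular $$F_D^{\mathrm{act}}\in X_{\mathrm{src}},\qquad p_D^{\mathrm{act}}\in Y_{\mathrm{prs}},\qquad p_{\mathrm{harm},D}\in Y^{(3/2)}_{\mathrm{harm}},$$ $$\mathsf{Leak}_{\nabla u}(D),\ \mathsf{Leak}_u(D),\ \mathsf{Leak}_p(D)<\infty,$$ and all finite-window gate/slack and ledger coordinates are well-defined. For finite chains $(u_k,p_k)_{k=0}^K$ of such data with packages $D_k=D_\Lambda(u_k,p_k)$, if reproduction maps $\mathcal R^u,\mathcal R^{\mathrm{src}},\mathcal R^{\mathrm{prs}},\mathcal R^{\mathrm{harm}},\mathcal R^U,\mathcal R^R,\mathcal R^E$ map each coordinate space into the corresponding next-window coordinate space, then the reproduction drifts $$u_{k+1}-\mathcal R^uu_k,\quad F^{\mathrm{act}}_{k+1}-\mathcal R^{\mathrm{src}}F^{\mathrm{act}}_k,\quad p^{\mathrm{act}}_{k+1}-\mathcal R^{\mathrm{prs}}p^{\mathrm{act}}_k,\quad p_{\mathrm{harm},k+1}-\mathcal R^{\mathrm{harm}}p_{\mathrm{harm},k}$$ are well-defined elements of their assigned coordinate spaces. If, in addition, the selected model coordinates satisfy the bounded-amplitude or quadratic-geometry hypotheses defining a package class,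 then $D_\Lambda(u,p)$ belongs to that package class.
   Context: $I=(-1,0)$, $Q_1=B_1\times I\subset\mathbb R^3\times\mathbb R$. Cutoffs: $\eta\in C_c^\infty(B_1)$, $\eta\equiv1$ on $B_{3/4}$; $\chi\in C_c^\infty(B_{3/4})$, $\chi\equiv1$ on $B_{1/2}$; $A_\chi=\operatorname{supp}\nabla\chi\cup\operatorname{supp}\Delta\chi$. $X_{\mathrm{src}}=L^{3/2}(I;L^{3/2}(B_1))^{3\times3}$, $Y_{\mathrm{prs}}=L^{3/2}(I;L^{3/2}(B_{1/2}))$, $Y^{(3/2)}_{\mathrm{harm}}=L^{3/2}(I;L^{3/2}(B_{3/4}))$. Pressure-admissible local Navier–Stokes data: $u\in L^3(Q_1)^3$, $\nabla u\in L^2(I;L^2(B_1))^{3\times3}$, $p\in L^{3/2}(Q_1)$, $\nabla\cdot u=0$, $\partial_tu-\Delta u+\nabla p+\nabla\cdot(u\otimes u)=0$ in distributions on $Q_1$, and $-\Delta p=\partial_i\partial_j(u_iu_j)$ in distributions on the window, modulo time-dependent constants. When the local energy coordinate $\Phi_D$ (or a trace) is included, also $u\in L^\infty(I;L^2(B_1))^3$. Canonical package coordinates: $u_D=u$, $p_D=p$, $F^{\mathrm{act}}_{D,ij}=\eta u_iu_j$, $p_D^{\mathrm{act}}=R_iR_j(F^{\mathrm{act}}_{D,ij})$ (Riesz transforms in $x$ of the zero extension), $p_{\mathrm{harm},D}=p_D-p^{\mathrm{act}}_D$ on $B_{3/4}$; $U_D=u$, $R_D=0$, $E_{F,D}=0$,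 $F^{\mathrm{mod}}_D=F^{\mathrm{act}}_D$. Leakage and observables: $\mathsf{Leak}_{\nabla u}(D)=\|\nabla u\|_{L^2(I;L^2(A_\chi))}$, $\mathsf{Leak}_u(D)=\|u\|_{L^3(I;L^3(A_\chi))}$, $\mathsf{Leak}_p(D)=\|p\|_{L^{3/2}(I;L^{3/2}(A_\chi))}$; flux coordinate $\Pi_D$: any finite list of quantities controlled by the displayed $L^3,L^{3/2},L^2$ norms, e.g. $(\int_{Q_1}\chi^2|u|^3,\int_{Q_1}\chi|p|^{3/2})$; energy coordinate $\Phi_D=(\operatorname{ess\,sup}_{t\in I}\int_{B_1}|u(x,t)|^2dx,\int_{Q_1}|\nabla u|^2)$; trace $T_D$: omitted, $0$, or $u(t_D)\in L^2(B_1)^3$ at a time of finite local energy. Gate/slack rule: for a finite channel set $\mathfrak A$, with $B_a(D)\ge0$ finite functionals of the finite coordinates above and thresholds $\tau_a(D)<\infty$: $s_a=(\tau_a-B_a)_+$, $\mathsf{Gate}_a=(B_a-\tau_a)_+$, $\mathsf{Slack}_a=|B_a+s_a-\tau_a|$. The bounded-amplitude package class requires $\|u_D\|_{L^3(Q_1)}+\|U_D\|_{L^3(Q_1)}\le M_U$ on the selected representative; the quadratic-geometry class instead measures packages with a functional containing the quadratic products of these amplitudes. *)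

theory Defs
  imports "HOL-Probability.Essential_Supremum"
begin

section \<open>Lebesgue and Bochner spaces\<close>

text \<open>
  Elements of Lebesgue spaces are represented by Borel functions, of which every class modulo
  null sets contains one.  Functions are total; only their values on the set named in a norm
  or a space matter.  Space-time points are pairs of a position and a time.
\<close>

definition epowr :: "ennreal \<Rightarrow> real \<Rightarrow> ennreal" where
  "epowr a r = (if a = \<infinity> then \<infinity> else ennreal (enn2real a powr r))"

definition eLnorm :: "real \<Rightarrow> 'a::euclidean_space set \<Rightarrow> ('a \<Rightarrow> 'b::real_normed_vector) \<Rightarrow> ennreal" where
  "eLnorm r S f = epowr (\<integral>\<^sup>+ x\<in>S. ennreal (norm (f x) powr r) \<partial>lborel) (1 / r)"

definition Lspace :: "real \<Rightarrow> 'a::euclidean_space set \<Rightarrow> ('a \<Rightarrow> 'b::real_normed_vector) set" where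
  "Lspace r S = {f. set_borel_measurable lborel S f \<and> eLnorm r S f < \<infinity>}"

type_synonym point = "real^3"
type_synonym spacetime = "point \<times> real"

definition window :: "real set" where "window = {-1<..<0}"

abbreviation ball0 :: "real \<Rightarrow> point set" where "ball0 r \<equiv> ball 0 r"

definition Q1 :: "spacetime set" where "Q1 = ball0 1 \<times> window"

text \<open>The norm and the space $L^q(I;L^r(S))$.\<close>

definition eLLnorm :: "real \<Rightarrow> real \<Rightarrow> point set \<Rightarrow> (spacetime \<Rightarrow> 'b::real_normed_vector) \<Rightarrow> ennreal" where
  "eLLnorm q r S f = epowr (\<integral>\<^sup>+ t\<in>window. epowr (eLnorm r S (\<lambda>x. f (x, t))) q \<partial>lborel) (1 / q)"

definition LLspace :: "real \<Rightarrow> real \<Rightarrow> point set \<Rightarrow> (spacetime \<Rightarrow> 'b::real_normed_vector) set" where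
  "LLspace q r S = {f. set_borel_measurable lborel (S \<times> window) f \<and> eLLnorm q r S f < \<infinity>}"

text \<open>The space $L^\infty(I;L^2(B_1))$.\<close>

definition Linf_L2 :: "(spacetime \<Rightarrow> 'b::real_normed_vector) set" where
  "Linf_L2 = {f. set_borel_measurable lborel Q1 f \<and>
     (\<exists>C::real. AE t in lborel. t \<in> window \<longrightarrow> eLnorm 2 (ball0 1) (\<lambda>x. f (x, t)) \<le> ennreal C)}"


section \<open>Smooth functions and cutoffs\<close>

definition dd :: "'a::euclidean_space \<Rightarrow> ('a \<Rightarrow> real) \<Rightarrow> 'a \<Rightarrow> real" where
  "dd b f x = frechet_derivative f (at x) b"

primrec Ck :: "nat \<Rightarrow> ('a::euclidean_space \<Rightarrow> real) \<Rightarrow> bool" where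
  "Ck 0 f \<longleftrightarrow> continuous_on UNIV f"
| "Ck (Suc k) f \<longleftrightarrow> (\<forall>x. f differentiable at x) \<and> (\<forall>b\<in>Basis. Ck k (dd b f))"

definition supp :: "('a::topological_space \<Rightarrow> 'b::zero) \<Rightarrow> 'a set" where
  "supp f = closure {x. f x \<noteq> 0}"

definition Cc_inf :: "'a::euclidean_space set \<Rightarrow> ('a \<Rightarrow> real) set" where
  "Cc_inf S = {f. (\<forall>k. Ck k f) \<and> compact (supp f) \<and> supp f \<subseteq> S}"

definition grad :: "('a::euclidean_space \<Rightarrow> real) \<Rightarrow> 'a \<Rightarrow> 'a" where
  "grad f x = (\<Sum>b\<in>Basis. dd b f x *\<^sub>R b)"

definition laplacian :: "('a::euclidean_space \<Rightarrow> real) \<Rightarrow> 'a \<Rightarrow> real" where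
  "laplacian f x = (\<Sum>b\<in>Basis. dd b (dd b f) x)"

definition cutoffs :: "(point \<Rightarrow> real) \<Rightarrow> (point \<Rightarrow> real) \<Rightarrow> bool" where
  "cutoffs \<eta> chi \<longleftrightarrow>
     \<eta> \<in> Cc_inf (ball0 1) \<and> (\<forall>x\<in>ball0 (3/4). \<eta> x = 1) \<and>
     chi \<in> Cc_inf (ball0 (3/4)) \<and> (\<forall>x\<in>ball0 (1/2). chi x = 1)"

definition A_set :: "(point \<Rightarrow> real) \<Rightarrow> point set" where
  "A_set chi = supp (grad chi) \<union> supp (laplacian chi)"


section \<open>Pressure-admissible local Navier--Stokes data\<close>

type_synonym velocity = "spacetime \<Rightarrow> point"
type_synonym pressure = "spacetime \<Rightarrow> real"
type_synonym matrix_field = "spacetime \<Rightarrow> real^3^3"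

definition dx :: "3 \<Rightarrow> (spacetime \<Rightarrow> real) \<Rightarrow> spacetime \<Rightarrow> real" where
  "dx j \<phi> = dd (axis j 1, 0) \<phi>"

definition dt :: "(spacetime \<Rightarrow> real) \<Rightarrow> spacetime \<Rightarrow> real" where
  "dt \<phi> = dd (0, 1) \<phi>"

definition lap_x :: "(spacetime \<Rightarrow> real) \<Rightarrow> spacetime \<Rightarrow> real" where
  "lap_x \<phi> z = (\<Sum>j\<in>UNIV. dx j (dx j \<phi>) z)"

text \<open>The matrix field \<open>G\<close> is the distributional spatial gradient of \<open>u\<close> on $Q_1$
  (\<open>G z $ i $ j\<close> being the \<open>j\<close>-th derivative of the \<open>i\<close>-th component) and lies in
  $L^2(I;L^2(B_1))$.\<close>

definition is_wgrad :: "velocity \<Rightarrow> matrix_field \<Rightarrow> bool" where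
  "is_wgrad u G \<longleftrightarrow> G \<in> LLspace 2 2 (ball0 1) \<and>
     (\<forall>\<phi>\<in>Cc_inf Q1. \<forall>i j.
        (LINT z:Q1|lborel. u z $ i * dx j \<phi> z) = - (LINT z:Q1|lborel. G z $ i $ j * \<phi> z))"

definition wgrad :: "velocity \<Rightarrow> matrix_field" where
  "wgrad u = (SOME G. is_wgrad u G)"

definition divergence_free :: "velocity \<Rightarrow> bool" where
  "divergence_free u \<longleftrightarrow>
     (\<forall>\<phi>\<in>Cc_inf Q1. (LINT z:Q1|lborel. (\<Sum>i\<in>UNIV. u z $ i * dx i \<phi> z)) = 0)"

definition momentum_equation :: "velocity \<Rightarrow> pressure \<Rightarrow> bool" where
  "momentum_equation u p \<longleftrightarrow>
     (\<forall>\<phi>\<in>Cc_inf Q1. \<forall>i.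
        (LINT z:Q1|lborel. - (u z $ i * dt \<phi> z) - u z $ i * lap_x \<phi> z - p z * dx i \<phi> z
            - (\<Sum>j\<in>UNIV. u z $ j * u z $ i * dx j \<phi> z)) = 0)"

text \<open>The following condition does not see constants depending on time: it holds for \<open>p\<close> iff it
  holds for $p + c(t)$.\<close>

definition pressure_equation :: "velocity \<Rightarrow> pressure \<Rightarrow> bool" where
  "pressure_equation u p \<longleftrightarrow>
     (\<forall>\<phi>\<in>Cc_inf Q1.
        (LINT z:Q1|lborel. - (p z * lap_x \<phi> z)) =
        (LINT z:Q1|lborel. (\<Sum>i\<in>UNIV. \<Sum>j\<in>UNIV. u z $ i * u z $ j * dx i (dx j \<phi>) z)))"

definition ns_data :: "velocity \<Rightarrow> pressure \<Rightarrow> bool" where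
  "ns_data u p \<longleftrightarrow>
     u \<in> Lspace 3 Q1 \<and> (\<exists>G. is_wgrad u G) \<and> p \<in> Lspace (3/2) Q1 \<and>
     divergence_free u \<and> momentum_equation u p \<and> pressure_equation u p"


section \<open>Riesz transforms in the space variable\<close>

text \<open>Truncation of the singular integral with kernel $c_n\, y_j / |y|^{n+1}$, where
  $c_n = \Gamma((n+1)/2) / \pi^{(n+1)/2}$; for $n = 3$ this constant is $1/\pi^2$.\<close>

definition riesz_trunc :: "3 \<Rightarrow> real \<Rightarrow> (point \<Rightarrow> real) \<Rightarrow> point \<Rightarrow> real" where
  "riesz_trunc j \<epsilon> g x =
     1 / pi\<^sup>2 * (LINT y:{y. norm y > \<epsilon>}|lborel. y $ j / norm y ^ 4 * g (x - y))"

text \<open>For almost every time the slice of \<open>H\<close> is the limit in $L^{3/2}(\mathbb{R}^3)$ of the truncated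
  singular integrals of the slice of \<open>G\<close>.  Stating this for space-time functions makes the
  result jointly measurable, as an element of $L^{3/2}(I;L^{3/2}(\mathbb{R}^3))$ has to be.\<close>

definition is_riesz :: "3 \<Rightarrow> (spacetime \<Rightarrow> real) \<Rightarrow> (spacetime \<Rightarrow> real) \<Rightarrow> bool" where
  "is_riesz j G H \<longleftrightarrow>
     G \<in> LLspace (3/2) (3/2) UNIV \<and> H \<in> LLspace (3/2) (3/2) UNIV \<and>
     (AE t in lborel. t \<in> window \<longrightarrow>
        ((\<lambda>\<epsilon>. eLnorm (3/2) UNIV (\<lambda>x. riesz_trunc j \<epsilon> (\<lambda>y. G (y, t)) x - H (x, t)))
           \<longlongrightarrow> 0) (at_right 0))"

definition riesz :: "3 \<Rightarrow> (spacetime \<Rightarrow> real) \<Rightarrow> spacetime \<Rightarrow> real" where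
  "riesz j G = (SOME H. is_riesz j G H)"

text \<open>The two choices above are well-defined: an admissible object exists and any two agree
  almost everywhere.\<close>

definition wgrad_defined :: "velocity \<Rightarrow> bool" where
  "wgrad_defined u \<longleftrightarrow> is_wgrad u (wgrad u) \<and>
     (\<forall>G. is_wgrad u G \<longrightarrow> (AE z in lborel. z \<in> Q1 \<longrightarrow> G z = wgrad u z))"

definition riesz_defined :: "3 \<Rightarrow> (spacetime \<Rightarrow> real) \<Rightarrow> bool" where
  "riesz_defined j G \<longleftrightarrow> is_riesz j G (riesz j G) \<and>
     (\<forall>H. is_riesz j G H \<longrightarrow> (AE z in lborel. snd z \<in> window \<longrightarrow> H z = riesz j G z))"


section \<open>Packages\<close>

definition zero_ext :: "(spacetime \<Rightarrow> 'b::zero) \<Rightarrow> spacetime \<Rightarrow> 'b" where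
  "zero_ext f z = (if fst z \<in> ball0 1 then f z else 0)"

definition F_act :: "(point \<Rightarrow> real) \<Rightarrow> velocity \<Rightarrow> matrix_field" where
  "F_act \<eta> u z = (\<chi> i j. \<eta> (fst z) * u z $ i * u z $ j)"

definition F_ext :: "(point \<Rightarrow> real) \<Rightarrow> velocity \<Rightarrow> 3 \<Rightarrow> 3 \<Rightarrow> spacetime \<Rightarrow> real" where
  "F_ext \<eta> u i j z = zero_ext (F_act \<eta> u) z $ i $ j"

definition p_act :: "(point \<Rightarrow> real) \<Rightarrow> velocity \<Rightarrow> pressure" where
  "p_act \<eta> u z = (\<Sum>i\<in>UNIV. \<Sum>j\<in>UNIV. riesz i (riesz j (F_ext \<eta> u i j)) z)"

text \<open>The residual \<open>resid\<close> takes values in an unspecified vector space \<open>'r\<close>.  The flux list holds the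
  components of the flux coordinate; an omitted energy or trace coordinate is \<open>None\<close>.\<close>

record 'r core =
  vel :: velocity
  prs :: pressure
  src_act :: matrix_field
  prs_act :: pressure
  prs_harm :: pressure
  model :: velocity
  resid :: 'r
  src_err :: matrix_field
  src_mod :: matrix_field
  leak_grad :: ennreal
  leak_vel :: ennreal
  leak_prs :: ennreal
  flux :: "ereal list"
  energy :: "(ennreal \<times> ennreal) option"
  trace_coord :: "(point \<Rightarrow> point) option"

record ('r, 'c) package =
  core :: "'r core"
  slack_var :: "'c \<Rightarrow> ereal"
  gate :: "'c \<Rightarrow> ereal"
  slack :: "'c \<Rightarrow> ereal"

datatype trace_rule = No_Trace | Zero_Trace | Trace_At "velocity \<Rightarrow> pressure \<Rightarrow> real"

text \<open>The free choices entering the canonical package: the finite channel set with its functionals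
  $B_a$ and thresholds $\tau_a$, the list of flux functionals, whether the energy coordinate is
  included, the trace rule, and the residual coordinate space.\<close>

record ('r, 'c) rules =
  channels :: "'c set"
  meas :: "'c \<Rightarrow> 'r core \<Rightarrow> ereal"
  thr :: "'c \<Rightarrow> 'r core \<Rightarrow> ereal"
  flux_rules :: "(velocity \<Rightarrow> pressure \<Rightarrow> ereal) list"
  with_energy :: bool
  trace_choice :: trace_rule
  res_space :: "'r set"

definition energy_pair :: "velocity \<Rightarrow> ennreal \<times> ennreal" where
  "energy_pair u =
     (esssup (restrict_space lborel window) (\<lambda>t. \<integral>\<^sup>+ x\<in>ball0 1. ennreal (norm (u (x, t)) ^ 2) \<partial>lborel),
      \<integral>\<^sup>+ z\<in>Q1. ennreal (norm (wgrad u z) ^ 2) \<partial>lborel)"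

definition canonical_core ::
  "(point \<Rightarrow> real) \<Rightarrow> (point \<Rightarrow> real) \<Rightarrow> ('r::real_vector, 'c) rules \<Rightarrow> velocity \<Rightarrow> pressure \<Rightarrow> 'r core"
where
  "canonical_core \<eta> chi \<Lambda> u p =
     \<lparr> vel = u, prs = p, src_act = F_act \<eta> u, prs_act = p_act \<eta> u,
       prs_harm = (\<lambda>z. p z - p_act \<eta> u z),
       model = u, resid = 0, src_err = (\<lambda>z. 0), src_mod = F_act \<eta> u,
       leak_grad = eLLnorm 2 2 (A_set chi) (wgrad u),
       leak_vel = eLLnorm 3 3 (A_set chi) u,
       leak_prs = eLLnorm (3/2) (3/2) (A_set chi) p,
       flux = map (\<lambda>\<pi>. \<pi> u p) (flux_rules \<Lambda>),
       energy = (if with_energy \<Lambda> then Some (energy_pair u) else None),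
       trace_coord = (case trace_choice \<Lambda> of
                        No_Trace \<Rightarrow> None
                      | Zero_Trace \<Rightarrow> Some (\<lambda>x. 0)
                      | Trace_At tm \<Rightarrow> Some (\<lambda>x. u (x, tm u p))) \<rparr>"

definition pos_part :: "ereal \<Rightarrow> ereal" where "pos_part a = max a 0"

definition canonical_package ::
  "(point \<Rightarrow> real) \<Rightarrow> (point \<Rightarrow> real) \<Rightarrow> ('r::real_vector, 'c) rules \<Rightarrow> velocity \<Rightarrow> pressure \<Rightarrow> ('r, 'c) package"
where
  "canonical_package \<eta> chi \<Lambda> u p =
     (let D = canonical_core \<eta> chi \<Lambda> u p; s = (\<lambda>a. pos_part (thr \<Lambda> a D - meas \<Lambda> a D)) in
      \<lparr> core = D, slack_var = s,
        gate = (\<lambda>a. pos_part (meas \<Lambda> a D - thr \<Lambda> a D)),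
        slack = (\<lambda>a. \<bar>meas \<Lambda> a D + s a - thr \<Lambda> a D\<bar>) \<rparr>)"

definition X_vel :: "velocity set" where "X_vel = Lspace 3 Q1"
definition X_src :: "matrix_field set" where "X_src = LLspace (3/2) (3/2) (ball0 1)"
definition Y_prs :: "pressure set" where "Y_prs = LLspace (3/2) (3/2) (ball0 (1/2))"
definition Y_harm :: "pressure set" where "Y_harm = LLspace (3/2) (3/2) (ball0 (3/4))"

definition finite_core :: "'r set \<Rightarrow> 'r core \<Rightarrow> bool" where
  "finite_core X_res D \<longleftrightarrow>
     vel D \<in> X_vel \<and> prs D \<in> Lspace (3/2) Q1 \<and>
     src_act D \<in> X_src \<and> prs_act D \<in> Y_prs \<and> prs_harm D \<in> Y_harm \<and>
     model D \<in> X_vel \<and> resid D \<in> X_res \<and> src_err D \<in> X_src \<and> src_mod D \<in> X_src \<and>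
     leak_grad D < \<infinity> \<and> leak_vel D < \<infinity> \<and> leak_prs D < \<infinity> \<and>
     (\<forall>a\<in>set (flux D). \<bar>a\<bar> \<noteq> \<infinity>) \<and>
     (case energy D of None \<Rightarrow> True | Some (a, b) \<Rightarrow> a < \<infinity> \<and> b < \<infinity>) \<and>
     (case trace_coord D of None \<Rightarrow> True | Some v \<Rightarrow> v \<in> Lspace 2 (ball0 1))"

definition sharp_package :: "('r, 'c) rules \<Rightarrow> ('r, 'c) package \<Rightarrow> bool" where
  "sharp_package \<Lambda> D \<longleftrightarrow>
     finite_core (res_space \<Lambda>) (core D) \<and>
     (\<forall>a\<in>channels \<Lambda>.
        0 \<le> meas \<Lambda> a (core D) \<and> meas \<Lambda> a (core D) < \<infinity> \<and> \<bar>thr \<Lambda> a (core D)\<bar> \<noteq> \<infinity> \<and>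
        0 \<le> slack_var D a \<and> slack_var D a < \<infinity> \<and>
        0 \<le> gate D a \<and> gate D a < \<infinity> \<and>
        0 \<le> slack D a \<and> slack D a < \<infinity>)"

text \<open>Admissible rules: the residual space is a linear space; the $B_a$ are nonnegative and the
  $B_a, \tau_a$ are finite on finite coordinates; each flux functional is controlled by the norms of
  the data; a trace time is a time in $I$ of finite local energy of the selected representative.\<close>

definition valid_rules :: "('r::real_vector, 'c) rules \<Rightarrow> bool" where
  "valid_rules \<Lambda> \<longleftrightarrow>
     subspace (res_space \<Lambda>) \<and>
     finite (channels \<Lambda>) \<and>
     (\<forall>a\<in>channels \<Lambda>. \<forall>D. finite_core (res_space \<Lambda>) D \<longrightarrow>
        0 \<le> meas \<Lambda> a D \<and> meas \<Lambda> a D < \<infinity> \<and> \<bar>thr \<Lambda> a D\<bar> \<noteq> \<infinity>) \<and>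
     (\<forall>\<pi>\<in>set (flux_rules \<Lambda>). \<exists>\<Psi> :: real \<Rightarrow> real \<Rightarrow> real \<Rightarrow> real. \<forall>u p. ns_data u p \<longrightarrow>
        \<bar>\<pi> u p\<bar> \<le> ereal (\<Psi> (enn2real (eLnorm 3 Q1 u)) (enn2real (eLnorm (3/2) Q1 p))
                            (enn2real (eLLnorm 2 2 (ball0 1) (wgrad u))))) \<and>
     (\<forall>tm. trace_choice \<Lambda> = Trace_At tm \<longrightarrow>
        (\<forall>u p. ns_data u p \<and> u \<in> Linf_L2 \<longrightarrow>
           tm u p \<in> window \<and> eLnorm 2 (ball0 1) (\<lambda>x. u (x, tm u p)) < \<infinity>))"

definition admissible_data :: "('r, 'c) rules \<Rightarrow> velocity \<Rightarrow> pressure \<Rightarrow> bool" where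
  "admissible_data \<Lambda> u p \<longleftrightarrow> ns_data u p \<and>
     (with_energy \<Lambda> \<or> (\<exists>tm. trace_choice \<Lambda> = Trace_At tm) \<longrightarrow> u \<in> Linf_L2)"


section \<open>Package classes\<close>

definition amp :: "velocity \<Rightarrow> real" where "amp v = enn2real (eLnorm 3 Q1 v)"

definition amplitude :: "('r, 'c) package \<Rightarrow> real" where
  "amplitude D = amp (vel (core D)) + amp (model (core D))"

definition bounded_amplitude_class :: "('r, 'c) rules \<Rightarrow> real \<Rightarrow> ('r, 'c) package set" where
  "bounded_amplitude_class \<Lambda> M = {D. sharp_package \<Lambda> D \<and> amplitude D \<le> M}"

text \<open>A functional containing the quadratic products of the two amplitudes; \<open>rest\<close> collects its
  further terms.\<close>

definition quad_measure :: "(('r, 'c) package \<Rightarrow> real) \<Rightarrow> ('r, 'c) package \<Rightarrow> real" where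
  "quad_measure rest D =
     amp (vel (core D)) ^ 2 + amp (vel (core D)) * amp (model (core D)) + amp (model (core D)) ^ 2
     + rest D"

definition quadratic_geometry_class ::
  "('r, 'c) rules \<Rightarrow> (('r, 'c) package \<Rightarrow> real) \<Rightarrow> real \<Rightarrow> ('r, 'c) package set" where
  "quadratic_geometry_class \<Lambda> rest M = {D. sharp_package \<Lambda> D \<and> quad_measure rest D \<le> M}"

end

theory Submission
  imports Defs "HOL-Complex_Analysis.Cauchy_Integral_Theorem"
begin

text \<open>
  The substance of the theorem is that the Riesz transforms exist on $L^{3/2}(\mathbb{R}^3)$ as limits of
  truncated singular integrals.  The one-dimensional truncated Hilbert transforms of $f \ge 0$ are
  dominated by $F = (P_y + i Q_y) * f$, which is holomorphic with positive real part in the upper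
  half-plane.  There $|F|^{3/2} \le 40 (\mathrm{Re} F)^{3/2} - 2 \mathrm{Re} F^{3/2}$, and $F^{3/2}$ integrates to zero
  along horizontal lines by Cauchy's theorem, which leaves the elementary estimate for $P_y * f$.
  Transference and the method of rotations carry the bound to the truncations in $\mathbb{R}^3$, uniformly in
  the radii; oddness of the kernel gives convergence on Lipschitz functions of compact support, and
  density gives it on $L^{3/2}$.  A subsequence argument in space-time produces a jointly measurable
  representative.  The weak gradient is unique by the fundamental lemma of the calculus of
  variations, and the remaining coordinates are controlled by Tonelli's theorem.
\<close>

section \<open>The exponent $3/2$\<close>

text \<open>The one-dimensional estimate is M. Riesz's. The argument of F lies strictly between
  -pi/2 and pi/2, and the only danger is near the ends, where Re F is small against |F|; there the
  argument of F^(3/2) is near 3 pi/4 in absolute value, so -Re F^(3/2) is positive and comparable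
  with |F|^(3/2). For this exponent F^(3/2) is F * csqrt F, so the inequality becomes one between
  polynomials in the real and imaginary parts of csqrt F. Positivity of f is what keeps F in the
  right half-plane, hence the later splitting into positive and negative parts.

  Sizes are measured by the integral of |f|^(3/2), not by the norm. A triangle inequality with
  constant 3 is then enough: no constant matters, only its independence of the truncation radii,
  since that is what lets convergence pass from a dense class to all of L^(3/2).

  The active pressure is a double Riesz transform. The first transform must therefore return an
  object to which existence applies again, which is why global L^(3/2) bounds and joint
  measurability are carried along.\<close>

lemma powr_three_halves: "x \<ge> 0 \<Longrightarrow> x powr (3/2) = x * sqrt (x::real)"
  by (cases "x = 0") (simp_all add: powr_half_sqrt[symmetric] powr_mult_base)

lemma two_powr_three_halves_le: "2 powr (3/2) \<le> (3::real)"
proof -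
  have "sqrt 2 \<le> 3/2" by (rule real_le_lsqrt) (auto simp: power2_eq_square)
  then show ?thesis by (simp add: powr_three_halves)
qed

lemma powr_three_halves_add_le:
  fixes a b :: real
  assumes "0 \<le> a" "0 \<le> b"
  shows "(a + b) powr (3/2) \<le> 3 * (a powr (3/2) + b powr (3/2))"
proof -
  have "(a + b) powr (3/2) \<le> (2 * max a b) powr (3/2)" using assms by (intro powr_mono2) auto
  also have "\<dots> = 2 powr (3/2) * max a b powr (3/2)" using assms by (simp add: powr_mult)
  also have "\<dots> \<le> 3 * max a b powr (3/2)" using two_powr_three_halves_le by (intro mult_right_mono) auto
  also have "\<dots> \<le> 3 * (a powr (3/2) + b powr (3/2))" by (auto simp: max_def)
  finally show ?thesis .
qed

text \<open>The elementary bound $h \le c + h^{3/2} / \sqrt{c}$, optimised in $c$, replaces Jensen's inequality.\<close>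

lemma powr_three_halves_weighted_integral_le:
  fixes \<phi> h :: "'a \<Rightarrow> real"
  assumes [measurable]: "\<phi> \<in> borel_measurable M" "h \<in> borel_measurable M"
    and nn: "\<And>x. 0 \<le> \<phi> x" and mass: "(\<integral>\<^sup>+x. ennreal (\<phi> x) \<partial>M) \<le> ennreal m" and m: "0 < m"
  shows "ennreal (\<bar>LINT x|M. \<phi> x * h x\<bar> powr (3/2))
    \<le> ennreal (3 * sqrt m) * (\<integral>\<^sup>+x. ennreal (\<phi> x) * ennreal (\<bar>h x\<bar> powr (3/2)) \<partial>M)"
\<comment> \<open>Two cases are free: a product that is not integrable has Bochner integral 0 by
  convention, and if the right-hand integral is infinite there is nothing to bound.\<close>
proof (cases "integrable M (\<lambda>x. \<phi> x * h x) \<and> (\<integral>\<^sup>+x. ennreal (\<phi> x) * ennreal (\<bar>h x\<bar> powr (3/2)) \<partial>M) < \<infinity>")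
  case False
  then consider "\<not> integrable M (\<lambda>x. \<phi> x * h x)"
    | "(\<integral>\<^sup>+x. ennreal (\<phi> x) * ennreal (\<bar>h x\<bar> powr (3/2)) \<partial>M) = \<infinity>"
    by (metis infinity_ennreal_def top.not_eq_extremum)
  then show ?thesis
  proof cases
    case 1
    then show ?thesis by (simp add: not_integrable_integral_eq)
  next
    case 2
    then show ?thesis using m by (simp add: ennreal_mult_eq_top_iff ennreal_mult_top)
  qed
next
  case True
  then have int: "integrable M (\<lambda>x. \<phi> x * h x)" by simp
  define X where "X = \<bar>LINT x|M. \<phi> x * h x\<bar>"
  obtain B where B: "(\<integral>\<^sup>+x. ennreal (\<phi> x) * ennreal (\<bar>h x\<bar> powr (3/2)) \<partial>M) = ennreal B" "0 \<le> B"
    using True by (cases "\<integral>\<^sup>+x. ennreal (\<phi> x) * ennreal (\<bar>h x\<bar> powr (3/2)) \<partial>M") auto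
  have X0: "0 \<le> X" by (simp add: X_def)
  have bd: "X \<le> c * m + B / sqrt c" if c: "0 < c" for c
  proof -
    have pt: "\<bar>h x\<bar> \<le> c + 1 / sqrt c * \<bar>h x\<bar> powr (3/2)" for x
    proof (cases "\<bar>h x\<bar> \<le> c")
      case False
      then have "sqrt c \<le> sqrt \<bar>h x\<bar>" by simp
      then have "\<bar>h x\<bar> * sqrt c \<le> \<bar>h x\<bar> * sqrt \<bar>h x\<bar>" by (intro mult_left_mono) auto
      then have "\<bar>h x\<bar> \<le> 1 / sqrt c * \<bar>h x\<bar> powr (3/2)"
        using c by (simp add: powr_three_halves field_simps)
      with c show ?thesis by simp
    qed (simp add: add_increasing2 c less_imp_le)
    have "ennreal X \<le> (\<integral>\<^sup>+x. ennreal (norm (\<phi> x * h x)) \<partial>M)"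
      unfolding X_def using integral_norm_bound_ennreal[OF int] by simp
    also have "\<dots> \<le> (\<integral>\<^sup>+x. ennreal c * ennreal (\<phi> x) + ennreal (1 / sqrt c) * (ennreal (\<phi> x) * ennreal (\<bar>h x\<bar> powr (3/2))) \<partial>M)"
    proof (rule nn_integral_mono)
      fix x
      have "norm (\<phi> x * h x) = \<phi> x * \<bar>h x\<bar>" using nn[of x] by (simp add: abs_mult)
      also have "\<dots> \<le> \<phi> x * (c + 1 / sqrt c * \<bar>h x\<bar> powr (3/2))" by (intro mult_left_mono pt nn)
      also have "\<dots> = c * \<phi> x + 1 / sqrt c * (\<phi> x * \<bar>h x\<bar> powr (3/2))" by (simp add: algebra_simps)
      finally show "ennreal (norm (\<phi> x * h x)) \<le> ennreal c * ennreal (\<phi> x) + ennreal (1 / sqrt c) * (ennreal (\<phi> x) * ennreal (\<bar>h x\<bar> powr (3/2)))"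
        using c nn[of x] by (simp add: ennreal_mult[symmetric] ennreal_plus[symmetric] del: ennreal_plus)
    qed
    also have "\<dots> = ennreal c * (\<integral>\<^sup>+x. ennreal (\<phi> x) \<partial>M) + ennreal (1 / sqrt c) * ennreal B"
      by (simp add: nn_integral_add nn_integral_cmult B)
    also have "\<dots> \<le> ennreal c * ennreal m + ennreal (1 / sqrt c) * ennreal B"
      by (intro add_mono mult_left_mono mass) auto
    also have "\<dots> = ennreal (c * m + B / sqrt c)"
      using c m B(2) by (simp add: ennreal_mult[symmetric] ennreal_plus[symmetric] del: ennreal_plus)
    finally show ?thesis using c m B(2) by (subst (asm) ennreal_le_iff) auto
  qed
  have "X powr (3/2) \<le> 3 * sqrt m * B"
  proof (cases "B = 0")
    case True
    \<comment> \<open>The bound now reads \<open>X \<le> c * m\<close> for every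
      \<open>c > 0\<close>; the choice \<open>c = e / m\<close> makes its right side equal to
      \<open>e\<close>.\<close>
    have "X \<le> 0"
    proof (rule field_le_epsilon)
      fix e :: real assume "0 < e"
      with bd[of "e / m"] m True show "X \<le> 0 + e" by simp
    qed
    with X0 True show ?thesis by simp
  next
    case False
    with B have B0: "B > 0" by simp
    \<comment> \<open>This choice balances the two terms: \<open>c powr (3/2) = B / m\<close> says
      the same as \<open>c * m = B / sqrt c\<close>, so the bound becomes
      \<open>2 * m * c\<close>.\<close>
    define c where "c = (B / m) powr (2/3)"
    have c: "c > 0" unfolding c_def using B0 m by simp
    have c32: "c powr (3/2) = B / m" unfolding c_def using B0 m by (simp add: powr_powr)
    have "B = c * sqrt c * m" using c32 c m by (simp add: powr_three_halves field_simps)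
    then have "B / sqrt c = c * m" using c by simp
    with bd[OF c] have "X \<le> 2 * m * c" by (simp add: mult_ac)
    then have "X powr (3/2) \<le> (2 * m * c) powr (3/2)" using X0 by (intro powr_mono2) auto
    also have "\<dots> = 2 powr (3/2) * m powr (3/2) * (B / m)"
      using m c c32 by (simp add: powr_mult)
    also have "\<dots> = 2 powr (3/2) * sqrt m * B"
      using m by (simp add: powr_three_halves)
    also have "\<dots> \<le> 3 * sqrt m * B"
      using two_powr_three_halves_le B0 m by (intro mult_right_mono) auto
    finally show ?thesis .
  qed
  then have "ennreal (X powr (3/2)) \<le> ennreal (3 * sqrt m) * ennreal B"
    using m B(2) by (simp add: ennreal_mult[symmetric])
  then show ?thesis by (simp add: X_def B)
qed

text \<open>The L^(3/2) norm raised to the power 3/2. Without the outer root it is an ordinary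
  integral, to which Tonelli, Fatou and dominated convergence apply directly.\<close>

definition modular :: "('a::euclidean_space \<Rightarrow> 'b::real_normed_vector) \<Rightarrow> ennreal" where
  "modular f = (\<integral>\<^sup>+x. ennreal (norm (f x) powr (3/2)) \<partial>lborel)"

text \<open>Stands in for Minkowski's inequality; the constant is \<open>2 powr (3/2)\<close>
  rounded up.\<close>

lemma modular_add_le:
  fixes f g :: "'a::euclidean_space \<Rightarrow> 'b::{real_normed_vector, second_countable_topology}"
  assumes [measurable]: "f \<in> borel_measurable borel" "g \<in> borel_measurable borel"
  shows "modular (\<lambda>x. f x + g x) \<le> 3 * (modular f + modular g)"
proof -
  have "modular (\<lambda>x. f x + g x)
      \<le> (\<integral>\<^sup>+x. 3 * (ennreal (norm (f x) powr (3/2)) + ennreal (norm (g x) powr (3/2))) \<partial>lborel)"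
    unfolding modular_def
  proof (rule nn_integral_mono)
    fix x
    have "norm (f x + g x) powr (3/2) \<le> (norm (f x) + norm (g x)) powr (3/2)"
      by (intro powr_mono2 norm_triangle_ineq) auto
    also have "\<dots> \<le> 3 * (norm (f x) powr (3/2) + norm (g x) powr (3/2))"
      by (rule powr_three_halves_add_le) auto
    finally have "ennreal (norm (f x + g x) powr (3/2)) \<le> ennreal (3 * (norm (f x) powr (3/2) + norm (g x) powr (3/2)))"
      by (rule ennreal_leI)
    then show "ennreal (norm (f x + g x) powr (3/2)) \<le> 3 * (ennreal (norm (f x) powr (3/2)) + ennreal (norm (g x) powr (3/2)))"
      by (simp add: ennreal_mult)
  qed
  also have "\<dots> = 3 * (modular f + modular g)"
    unfolding modular_def by (simp add: nn_integral_cmult nn_integral_add)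
  finally show ?thesis .
qed

lemma modular_uminus [simp]: "modular (\<lambda>x. - f x) = modular f"
  by (simp add: modular_def)

lemma modular_diff_le:
  fixes f g :: "'a::euclidean_space \<Rightarrow> 'b::{real_normed_vector, second_countable_topology}"
  assumes [measurable]: "f \<in> borel_measurable borel" "g \<in> borel_measurable borel"
  shows "modular (\<lambda>x. f x - g x) \<le> 3 * (modular f + modular g)"
  using modular_add_le[of f "\<lambda>x. - g x"] by simp

lemma modular_mono: "(\<And>x. norm (f x) \<le> norm (g x)) \<Longrightarrow> modular f \<le> modular g"
  unfolding modular_def by (intro nn_integral_mono ennreal_leI powr_mono2) auto

lemma modular_cmult:
  fixes f :: "'a::euclidean_space \<Rightarrow> real"
  assumes [measurable]: "f \<in> borel_measurable borel"
  shows "modular (\<lambda>x. c * f x) = ennreal (\<bar>c\<bar> powr (3/2)) * modular f"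
  unfolding modular_def by (simp add: abs_mult powr_mult ennreal_mult nn_integral_cmult)

section \<open>The truncated Hilbert transform\<close>

text \<open>For z = x + i y the kernel is (y + i (x - t)) / ((x - t)^2 + y^2), that is, pi times the
  Poisson kernel plus i pi times its conjugate. The normalisation by pi is left out, hence the
  powers of pi in the constants below.\<close>

definition poisson_cauchy :: "(real \<Rightarrow> real) \<Rightarrow> complex \<Rightarrow> complex" where
  "poisson_cauchy f z = (LINT t|lborel. f t *\<^sub>R (\<i> / (z - of_real t)))"

lemma norm_upper_minus_real_ge: "\<bar>Im z\<bar> \<le> norm (z - complex_of_real t)"
  using abs_Im_le_cmod[of "z - of_real t"] by simp

lemma poisson_cauchy_integrable:
  assumes "integrable lborel f" "0 < Im z"
  shows "integrable lborel (\<lambda>t. f t *\<^sub>R (\<i> / (z - of_real t)))"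
proof (rule Bochner_Integration.integrable_bound)
  show "integrable lborel (\<lambda>t. f t * (1 / Im z))" using assms(1) by (rule integrable_mult_left)
  show "(\<lambda>t. f t *\<^sub>R (\<i> / (z - complex_of_real t))) \<in> borel_measurable lborel"
    using assms(1) by (auto dest!: borel_measurable_integrable)
  have "\<bar>f t\<bar> / cmod (z - of_real t) \<le> \<bar>f t\<bar> / \<bar>Im z\<bar>" for t
    by (rule divide_left_mono) (use norm_upper_minus_real_ge[of z t] assms(2) in \<open>auto intro!: mult_pos_pos\<close>)
  then show "AE t in lborel. norm (f t *\<^sub>R (\<i> / (z - complex_of_real t))) \<le> norm (f t * (1 / Im z))"
    by (simp add: norm_divide abs_mult)
qed

lemma norm_poisson_cauchy_le:
  assumes "integrable lborel f" "0 < Im z" "\<And>t. f t \<noteq> 0 \<Longrightarrow> d \<le> norm (z - of_real t)" "0 < d"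
  shows "norm (poisson_cauchy f z) \<le> (LINT t|lborel. \<bar>f t\<bar>) / d"
proof -
  have "norm (poisson_cauchy f z) \<le> (LINT t|lborel. norm (f t *\<^sub>R (\<i> / (z - of_real t))))"
    unfolding poisson_cauchy_def by (rule integral_norm_bound)
  also have "\<dots> \<le> (LINT t|lborel. \<bar>f t\<bar> / d)"
  proof (rule integral_mono)
    show "integrable lborel (\<lambda>t. norm (f t *\<^sub>R (\<i> / (z - of_real t))))"
      using poisson_cauchy_integrable[OF assms(1,2)] by (rule integrable_norm)
    show "integrable lborel (\<lambda>t. \<bar>f t\<bar> / d)" using assms(1) by auto
    show "norm (f t *\<^sub>R (\<i> / (z - of_real t))) \<le> \<bar>f t\<bar> / d" for t
    proof (cases "f t = 0")
      case False
      have "\<bar>f t\<bar> / cmod (z - of_real t) \<le> \<bar>f t\<bar> / d"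
        using assms(3)[OF False] assms(4) by (intro divide_left_mono mult_pos_pos) auto
      then show ?thesis by (simp add: norm_divide)
    qed simp
  qed
  also have "\<dots> = (LINT t|lborel. \<bar>f t\<bar>) / d" by simp
  finally show ?thesis .
qed

text \<open>Subtracting the candidate derivative from the difference quotient leaves the kernel i h
  / ((z - t)^2 (z + h - t)), which is O(h) uniformly in \<open>t\<close> because z and z + h stay
  away from the real axis.\<close>

lemma poisson_cauchy_has_derivative:
  assumes f: "integrable lborel f" and z: "0 < Im z"
  shows "(poisson_cauchy f has_field_derivative
           (LINT t|lborel. f t *\<^sub>R (- \<i> / (z - of_real t)^2))) (at z)"
proof -
  let ?D = "LINT t|lborel. f t *\<^sub>R (- \<i> / (z - of_real t)^2)"
  define M where "M = (LINT t|lborel. \<bar>f t\<bar>)"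
  define y where "y = Im z"
  have y: "y > 0" using z by (simp add: y_def)
  have [measurable]: "f \<in> borel_measurable borel" using f by (auto dest!: borel_measurable_integrable)
  have D_int: "integrable lborel (\<lambda>t. f t *\<^sub>R (- \<i> / (z - of_real t)^2))"
  proof (rule Bochner_Integration.integrable_bound)
    show "integrable lborel (\<lambda>t. f t * (1 / y^2))" using f by (rule integrable_mult_left)
    have "\<bar>f t\<bar> / cmod (z - of_real t)^2 \<le> \<bar>f t\<bar> / y^2" for t
      using norm_upper_minus_real_ge[of z t] z y
      by (intro divide_left_mono power_mono) (auto simp: y_def intro!: mult_pos_pos)
    then show "AE t in lborel. norm (f t *\<^sub>R (- \<i> / (z - of_real t)^2)) \<le> norm (f t * (1 / y^2))"
      by (simp add: norm_divide abs_mult norm_power)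
  qed measurable
  \<comment> \<open>For |h| < y/2 the point z + h keeps height at least y/2, so the denominator is
    at least y^2 * (y/2); this is the origin of \<open>2 * M / y^3\<close>.\<close>
  have key: "norm ((poisson_cauchy f (z + h) - poisson_cauchy f z) / h - ?D) \<le> norm h * (2 * M / y^3)"
    if h: "h \<noteq> 0" "norm h < y/2" for h
  proof -
    have Imh: "Im (z + h) \<ge> y/2"
      using h abs_Im_le_cmod[of h] by (simp add: y_def)
    have ne: "z + h - of_real t \<noteq> 0" "z - of_real t \<noteq> 0" for t
      using Imh y z norm_upper_minus_real_ge[of "z+h" t] norm_upper_minus_real_ge[of z t] by auto
    have I1: "integrable lborel (\<lambda>t. f t *\<^sub>R (\<i> / (z + h - of_real t)))"
      by (rule poisson_cauchy_integrable) (use f Imh y in auto)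
    have I2: "integrable lborel (\<lambda>t. f t *\<^sub>R (\<i> / (z - of_real t)))"
      by (rule poisson_cauchy_integrable) (use f z in auto)
    have "(poisson_cauchy f (z + h) - poisson_cauchy f z) / h - ?D
        = (LINT t|lborel. (f t *\<^sub>R (\<i> / (z + h - of_real t)) - f t *\<^sub>R (\<i> / (z - of_real t))) / h
              - f t *\<^sub>R (- \<i> / (z - of_real t)^2))"
      using I1 I2 D_int unfolding poisson_cauchy_def by (simp add: divide_inverse)
    also have "\<dots> = (LINT t|lborel. f t *\<^sub>R (\<i> * h / ((z - of_real t)^2 * (z + h - of_real t))))"
    proof (rule Bochner_Integration.integral_cong[OF refl])
      fix t
      have id: "(i / (a + h) - i / a) / h + i / a^2 = i * h / (a^2 * (a + h))"
        if "a \<noteq> 0" "a + h \<noteq> 0" for i a :: complex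
        proof -
        have uv: "inverse a - inverse (a + h) = h * inverse a * inverse (a + h)"
          using that by (simp add: field_simps)
        have "(i / (a + h) - i / a) / h = - (i * (inverse a - inverse (a + h))) / h"
          by (simp add: divide_inverse algebra_simps)
        also have "\<dots> = - (i * inverse a * inverse (a + h))"
          unfolding uv using h(1) by simp
        finally have "(i / (a + h) - i / a) / h + i / a^2 = i * inverse a * (inverse a - inverse (a + h))"
          by (simp add: divide_inverse power2_eq_square algebra_simps)
        also have "\<dots> = i * h / (a^2 * (a + h))"
          unfolding uv by (simp add: divide_inverse power2_eq_square mult_ac)
        finally show ?thesis .
      qed
      have "(\<i> / (z + h - of_real t) - \<i> / (z - of_real t)) / h + \<i> / (z - of_real t)^2
          = \<i> * h / ((z - of_real t)^2 * (z + h - of_real t))"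
        using id[of "z - of_real t" \<i>] ne[of t] by (simp add: algebra_simps)
      moreover have "(c *\<^sub>R A - c *\<^sub>R B) / h - c *\<^sub>R (- \<i> / q) = c *\<^sub>R ((A - B) / h + \<i> / q)"
        for c :: real and A B q :: complex
        by (simp add: scaleR_conv_of_real divide_inverse algebra_simps)
      ultimately show "(f t *\<^sub>R (\<i> / (z + h - of_real t)) - f t *\<^sub>R (\<i> / (z - of_real t))) / h
              - f t *\<^sub>R (- \<i> / (z - of_real t)^2)
              = f t *\<^sub>R (\<i> * h / ((z - of_real t)^2 * (z + h - of_real t)))"
        by simp
    qed
    also have "norm \<dots> \<le> (LINT t|lborel. \<bar>f t\<bar> * (norm h * (2 / y^3)))"
    proof (rule Bochner_Integration.integral_norm_bound_integral)
      have bd: "norm (f t *\<^sub>R (\<i> * h / ((z - of_real t)^2 * (z + h - of_real t)))) \<le> \<bar>f t\<bar> * (norm h * (2 / y^3))" for t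
      proof -
        have a: "cmod (z - of_real t) \<ge> y" using norm_upper_minus_real_ge[of z t] y by (simp add: y_def)
        have b: "cmod (z + h - of_real t) \<ge> y/2" using norm_upper_minus_real_ge[of "z+h" t] Imh y by linarith
        have "y^3/2 = y^2 * (y/2)" by (simp add: power2_eq_square power3_eq_cube)
        also have "\<dots> \<le> cmod (z - of_real t)^2 * cmod (z + h - of_real t)"
          by (intro mult_mono power_mono) (use a b y in auto)
        finally have c: "y^3/2 \<le> cmod (z - of_real t)^2 * cmod (z + h - of_real t)" .
        have "norm (f t *\<^sub>R (\<i> * h / ((z - of_real t)^2 * (z + h - of_real t))))
            = \<bar>f t\<bar> * (norm h / (cmod (z - of_real t)^2 * cmod (z + h - of_real t)))"
          by (simp add: norm_mult norm_divide norm_power)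
        also have "\<dots> \<le> \<bar>f t\<bar> * (norm h / (y^3/2))"
          by (intro mult_left_mono divide_left_mono c) (use y ne[of t] in \<open>auto intro!: mult_pos_pos\<close>)
        finally show ?thesis by simp
      qed
      show int: "integrable lborel (\<lambda>t. \<bar>f t\<bar> * (norm h * (2 / y^3)))" using f by auto
      show "integrable lborel (\<lambda>t. f t *\<^sub>R (\<i> * h / ((z - of_real t)^2 * (z + h - of_real t))))"
        by (rule Bochner_Integration.integrable_bound[OF int])
           (measurable, intro AE_I2, rule order_trans[OF bd], use y in \<open>simp add: abs_mult\<close>)
      show "norm (f t *\<^sub>R (\<i> * h / ((z - of_real t)^2 * (z + h - of_real t)))) \<le> \<bar>f t\<bar> * (norm h * (2 / y^3))" for t
        by (rule bd)
    qed
    also have "\<dots> = norm h * (2 * M / y^3)" by (simp add: M_def)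
    finally show ?thesis .
  qed
  have lim0: "((\<lambda>h::complex. norm h * (2 * M / y^3)) \<longlongrightarrow> 0) (at 0)"
    by (intro tendsto_mult_left_zero tendsto_norm_zero tendsto_ident_at)
  have ev: "\<forall>\<^sub>F h in at 0. norm ((poisson_cauchy f (z + h) - poisson_cauchy f z) / h - ?D) \<le> norm h * (2 * M / y^3)"
    unfolding eventually_at using key y by (intro exI[of _ "y/2"]) auto
  have "((\<lambda>h. (poisson_cauchy f (z + h) - poisson_cauchy f z) / h - ?D) \<longlongrightarrow> 0) (at 0)"
    by (rule Lim_null_comparison[OF ev lim0])
  then show ?thesis unfolding DERIV_def by (rule LIM_zero_cancel)
qed

lemma poisson_cauchy_holomorphic:
  "integrable lborel f \<Longrightarrow> poisson_cauchy f holomorphic_on {z. 0 < Im z}"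
  unfolding holomorphic_on_def field_differentiable_def
  using has_field_derivative_at_within[OF poisson_cauchy_has_derivative] by blast

lemma Re_poisson_cauchy:
  assumes "integrable lborel f" "0 < y"
  shows "Re (poisson_cauchy f (Complex x y)) = (LINT t|lborel. f t * (y / ((x - t)^2 + y^2)))"
    and "Im (poisson_cauchy f (Complex x y)) = (LINT t|lborel. f t * ((x - t) / ((x - t)^2 + y^2)))"
    and "integrable lborel (\<lambda>t. f t * (y / ((x - t)^2 + y^2)))"
    and "integrable lborel (\<lambda>t. f t * ((x - t) / ((x - t)^2 + y^2)))"
proof -
  have I: "integrable lborel (\<lambda>t. f t *\<^sub>R (\<i> / (Complex x y - of_real t)))"
    by (rule poisson_cauchy_integrable) (use assms in auto)
  have re: "Re (f t *\<^sub>R (\<i> / (Complex x y - of_real t))) = f t * (y / ((x - t)^2 + y^2))"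
    and im: "Im (f t *\<^sub>R (\<i> / (Complex x y - of_real t))) = f t * ((x - t) / ((x - t)^2 + y^2))" for t
    by (simp_all add: Re_divide Im_divide)
  show "Re (poisson_cauchy f (Complex x y)) = (LINT t|lborel. f t * (y / ((x - t)^2 + y^2)))"
    unfolding poisson_cauchy_def using integral_Re[OF I, symmetric] unfolding re by simp
  show "Im (poisson_cauchy f (Complex x y)) = (LINT t|lborel. f t * ((x - t) / ((x - t)^2 + y^2)))"
    unfolding poisson_cauchy_def using integral_Im[OF I, symmetric] unfolding im by simp
  show "integrable lborel (\<lambda>t. f t * (y / ((x - t)^2 + y^2)))"
    using integrable_Re[OF I] unfolding re .
  show "integrable lborel (\<lambda>t. f t * ((x - t) / ((x - t)^2 + y^2)))"
    using integrable_Im[OF I] unfolding im .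
qed

text \<open>A strictly positive real part keeps F off the branch cut of \<open>csqrt\<close>, so
  that F * csqrt F is holomorphic on the half-plane.\<close>

lemma Re_poisson_cauchy_pos:
  assumes f: "integrable lborel f" and nn: "\<And>t. 0 \<le> f t" and ne: "\<not> (AE t in lborel. f t = 0)" and z: "0 < Im z"
  shows "0 < Re (poisson_cauchy f z)"
proof -
  obtain x y where z_eq: "z = Complex x y" and y: "0 < y" using z by (cases z) auto
  have k: "0 < y / ((x - t)^2 + y^2)" for t using y by (intro divide_pos_pos add_nonneg_pos) auto
  have nonneg: "0 \<le> f t * (y / ((x - t)^2 + y^2))" for t
    by (intro mult_nonneg_nonneg nn less_imp_le[OF k])
  note R = Re_poisson_cauchy[OF f y, of x]
  have "(LINT t|lborel. f t * (y / ((x - t)^2 + y^2))) \<noteq> 0"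
  proof
    assume "(LINT t|lborel. f t * (y / ((x - t)^2 + y^2))) = 0"
    then have "AE t in lborel. f t * (y / ((x - t)^2 + y^2)) = 0"
      using integral_nonneg_eq_0_iff_AE[OF R(3)] nonneg by auto
    then have "AE t in lborel. f t = 0" 
      by (rule AE_mp) (use k in \<open>auto simp: less_le\<close>)
    with ne show False by simp
  qed
  moreover have "0 \<le> (LINT t|lborel. f t * (y / ((x - t)^2 + y^2)))"
    by (intro integral_nonneg_AE) (use nonneg in auto)
  ultimately show ?thesis unfolding z_eq R(1) by simp
qed

section \<open>M. Riesz's pointwise inequality for the power 3/2\<close>

lemma power_three_halves_real_part:
  fixes a b :: real assumes ab: "\<bar>b\<bar> \<le> a"
  shows "(a^2 + b^2) powr (3/2) \<le> 40 * (a^2 - b^2) powr (3/2) - 2 * (a^3 - 3*a*b^2)"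
proof -
  have a0: "0 \<le> a" using ab by linarith
  have b2: "b^2 \<le> a^2" using ab by (metis abs_le_square_iff abs_of_nonneg a0)
  \<comment> \<open>Here a + i b is the square root of F, so a^2 + b^2, a^2 - b^2 and a^3 - 3 a b^2
    are |F|, Re F and Re F^(3/2). As sqrt 2 is at most 3/2, the claim reduces to \<open>a * (7/2 *
    a^2 - 9/2 * b^2) \<le> 40 * (a^2 - b^2) powr (3/2)\<close>.\<close>
  have P: "sqrt (a^2 + b^2) \<le> 3/2 * a"
  proof (rule real_le_lsqrt)
    show "a^2 + b^2 \<le> (3/2 * a)^2" by (simp add: power_mult_distrib power_divide) (use b2 zero_le_power2[of a] in linarith)
  qed (use a0 in auto)
  have "(a^2 + b^2) powr (3/2) = (a^2 + b^2) * sqrt (a^2 + b^2)" by (simp add: powr_three_halves)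
  also have "\<dots> \<le> (a^2 + b^2) * (3/2 * a)" by (intro mult_left_mono P) auto
  finally have 1: "(a^2 + b^2) powr (3/2) + 2 * (a^3 - 3*a*b^2) \<le> a * (7/2 * a^2 - 9/2 * b^2)"
    by (simp add: algebra_simps power2_eq_square power3_eq_cube)
  also have "\<dots> \<le> 40 * (a^2 - b^2) powr (3/2)"
  \<comment> \<open>Near the edge of the sector the cubic term alone wins and the left side is not
    positive. Elsewhere a^2 - b^2 exceeds 2/9 a^2, so its power 3/2 is at least 2/9 * 2/5 * a^3 =
    4/45 a^3; the constant 40 is chosen so that 40 * 4/45 exceeds 7/2.\<close>
  proof (cases "7/2 * a^2 \<le> 9/2 * b^2")
    case True
    then have "a * (7/2 * a^2 - 9/2 * b^2) \<le> 0" using a0 by (intro mult_nonneg_nonpos) auto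
    also have "0 \<le> 40 * (a^2 - b^2) powr (3/2)" by simp
    finally show ?thesis .
  next
    case False
    then have Q: "2/9 * a^2 \<le> a^2 - b^2" by simp
    have "2/5 * a \<le> sqrt (a^2 - b^2)"
      by (rule real_le_rsqrt) (use Q a0 zero_le_power2[of a] in \<open>simp add: power_mult_distrib power_divide, linarith\<close>)
    moreover have "0 \<le> a^2 - b^2" using Q zero_le_power2[of a] by linarith
    ultimately have "(2/9 * a^2) * (2/5 * a) \<le> (a^2 - b^2) * sqrt (a^2 - b^2)"
      using Q a0 by (intro mult_mono) auto
    also have "\<dots> = (a^2 - b^2) powr (3/2)" using b2 by (simp add: powr_three_halves)
    finally have q: "4/45 * a^3 \<le> (a^2 - b^2) powr (3/2)" by (simp add: power2_eq_square power3_eq_cube)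
    have "a * (7/2 * a^2 - 9/2 * b^2) \<le> a * (7/2 * a^2)" using a0 by (intro mult_left_mono) auto
    also have "\<dots> = 7/2 * a^3" by (simp add: power2_eq_square power3_eq_cube)
    also have "\<dots> \<le> 40 * (4/45 * a^3)" using a0 by simp
    also have "\<dots> \<le> 40 * (a^2 - b^2) powr (3/2)" using q by simp
    finally show ?thesis .
  qed
  finally show ?thesis by simp
qed

text \<open>Re w > 0 places the principal root in the sector |b| <= a, where the real inequality
  applies.\<close>

lemma norm_powr_three_halves_le:
  fixes w :: complex
  assumes "0 < Re w"
  shows "norm w powr (3/2) \<le> 40 * Re w powr (3/2) - 2 * Re (w * csqrt w)"
proof -
  define a b where "a = Re (csqrt w)" and "b = Im (csqrt w)"
  have sq: "(csqrt w)^2 = w" by simp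
  have csw: "csqrt w = Complex a b" by (simp only: a_def b_def complex_surj)
  have re: "Re w = a^2 - b^2" using sq unfolding csw by (auto simp: complex_eq_iff power2_eq_square)
  have w3: "w * csqrt w = (Complex a b)^3" using sq unfolding csw by (simp add: power3_eq_cube power2_eq_square)
  have re3: "Re (w * csqrt w) = a^3 - 3*a*b^2"
    unfolding w3 by (simp add: power3_eq_cube power2_eq_square algebra_simps)
  have nrm: "norm w = a^2 + b^2"
    using sq by (metis cmod_power2 csw complex.sel norm_power)
  have a: "0 \<le> a" using csqrt_principal[of w] unfolding a_def by auto
  have "b^2 \<le> a^2" using assms re by simp
  then have "\<bar>b\<bar> \<le> a" using a by (metis abs_le_square_iff abs_of_nonneg)
  from power_three_halves_real_part[OF this] show ?thesis unfolding re re3 nrm .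
qed

section \<open>The bound for the Poisson part\<close>

lemma nn_integral_inverse_one_plus_square:
  "(\<integral>\<^sup>+s. ennreal (1 / (1 + s^2)) \<partial>lborel) \<le> ennreal pi"
proof -
  let ?k = "\<lambda>s::real. ennreal (1 / (1 + s^2))"
  have half: "(\<integral>\<^sup>+s. ?k s * indicator {0..} s \<partial>lborel) = ennreal (pi/2)"
  proof -
    have "(\<integral>\<^sup>+s. ?k s * indicator {0..} s \<partial>lborel) = ennreal (pi/2 - arctan 0)"
    proof (rule nn_integral_FTC_atLeast)
      show "(arctan has_real_derivative 1 / (1 + x\<^sup>2)) (at x)" for x
        using DERIV_arctan[of x] by (simp add: inverse_eq_divide)
      show "(arctan \<longlongrightarrow> pi / 2) at_top" by (rule tendsto_arctan_at_top)
    qed auto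
    then show ?thesis by simp
  qed
  have "(\<integral>\<^sup>+s. ?k s \<partial>lborel) \<le> (\<integral>\<^sup>+s. ?k s * indicator {0..} s + ?k (0 + (-1) * s) * indicator {0..} (0 + (-1) * s) \<partial>lborel)"
    by (intro nn_integral_mono) (auto simp: indicator_def)
  also have "\<dots> = (\<integral>\<^sup>+s. ?k s * indicator {0..} s \<partial>lborel) + (\<integral>\<^sup>+s. ?k (0 + (-1) * s) * indicator {0..} (0 + (-1) * s) \<partial>lborel)"
    by (rule nn_integral_add) auto
  also have "(\<integral>\<^sup>+s. ?k (0 + (-1) * s) * indicator {0..} (0 + (-1) * s) \<partial>lborel) = (\<integral>\<^sup>+s. ?k s * indicator {0..} s \<partial>lborel)"
    using nn_integral_real_affine[of "\<lambda>s. ?k s * indicator {0..} s" "-1" 0] by simp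
  finally show ?thesis unfolding half by (simp add: ennreal_plus[symmetric] del: ennreal_plus)
qed

lemma nn_integral_poisson_kernel:
  fixes x y :: real
  assumes y: "0 < y"
  shows "(\<integral>\<^sup>+t. ennreal (y / ((x - t)^2 + y^2)) \<partial>lborel) \<le> ennreal pi"
proof -
  have "(\<integral>\<^sup>+t. ennreal (y / ((x - t)^2 + y^2)) \<partial>lborel)
      = ennreal \<bar>y\<bar> * (\<integral>\<^sup>+s. ennreal (y / ((x - (x + y * s))^2 + y^2)) \<partial>lborel)"
    by (rule nn_integral_real_affine) (use y in auto)
  also have "\<dots> = (\<integral>\<^sup>+s. ennreal \<bar>y\<bar> * ennreal (y / ((x - (x + y * s))^2 + y^2)) \<partial>lborel)"
    by (rule nn_integral_cmult[symmetric]) auto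
  also have "\<dots> = (\<integral>\<^sup>+s. ennreal (1 / (1 + s^2)) \<partial>lborel)"
  proof (rule nn_integral_cong)
    fix s
    have "\<bar>y\<bar> * (y / ((x - (x + y * s))^2 + y^2)) = y^2 / (y^2 * (1 + s^2))"
      using y by (simp add: power2_eq_square algebra_simps)
    also have "\<dots> = 1 / (1 + s^2)" using y by simp
    finally show "ennreal \<bar>y\<bar> * ennreal (y / ((x - (x + y * s))^2 + y^2)) = ennreal (1 / (1 + s^2))"
      using y by (simp add: ennreal_mult[symmetric])
  qed
  also have "\<dots> \<le> ennreal pi" by (rule nn_integral_inverse_one_plus_square)
  finally show ?thesis .
qed

text \<open>Young's inequality for convolution with a kernel of mass at most pi: the weighted
  inequality with m = pi contributes 3 sqrt pi, and Tonelli, which integrates the kernel in the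
  other variable, contributes the remaining pi.\<close>

lemma nn_integral_Re_poisson_cauchy_le:
  fixes f :: "real \<Rightarrow> real"
  assumes f: "integrable lborel f" and y: "0 < y"
  shows "(\<integral>\<^sup>+x. ennreal (\<bar>Re (poisson_cauchy f (Complex x y))\<bar> powr (3/2)) \<partial>lborel)
     \<le> ennreal (3 * sqrt pi * pi) * modular f"
proof -
  have [measurable]: "f \<in> borel_measurable borel" using f by (auto dest!: borel_measurable_integrable)
  have "(\<integral>\<^sup>+x. ennreal (\<bar>Re (poisson_cauchy f (Complex x y))\<bar> powr (3/2)) \<partial>lborel)
      \<le> (\<integral>\<^sup>+x. ennreal (3 * sqrt pi) * (\<integral>\<^sup>+t. ennreal (y / ((x - t)^2 + y^2)) * ennreal (\<bar>f t\<bar> powr (3/2)) \<partial>lborel) \<partial>lborel)"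
  proof (rule nn_integral_mono)
    fix x
    have "ennreal (\<bar>LINT t|lborel. y / ((x - t)^2 + y^2) * f t\<bar> powr (3/2))
        \<le> ennreal (3 * sqrt pi) * (\<integral>\<^sup>+t. ennreal (y / ((x - t)^2 + y^2)) * ennreal (\<bar>f t\<bar> powr (3/2)) \<partial>lborel)"
      by (rule powr_three_halves_weighted_integral_le)
         (use y nn_integral_poisson_kernel[OF y] in auto)
    then show "ennreal (\<bar>Re (poisson_cauchy f (Complex x y))\<bar> powr (3/2))
        \<le> ennreal (3 * sqrt pi) * (\<integral>\<^sup>+t. ennreal (y / ((x - t)^2 + y^2)) * ennreal (\<bar>f t\<bar> powr (3/2)) \<partial>lborel)"
      unfolding Re_poisson_cauchy(1)[OF f y] by (simp only: mult.commute)
  qed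
  also have "\<dots> = ennreal (3 * sqrt pi) * (\<integral>\<^sup>+x. (\<integral>\<^sup>+t. ennreal (y / ((x - t)^2 + y^2)) * ennreal (\<bar>f t\<bar> powr (3/2)) \<partial>lborel) \<partial>lborel)"
    by (rule nn_integral_cmult) measurable
  also have "(\<integral>\<^sup>+x. (\<integral>\<^sup>+t. ennreal (y / ((x - t)^2 + y^2)) * ennreal (\<bar>f t\<bar> powr (3/2)) \<partial>lborel) \<partial>lborel)
     = (\<integral>\<^sup>+t. (\<integral>\<^sup>+x. ennreal (y / ((x - t)^2 + y^2)) * ennreal (\<bar>f t\<bar> powr (3/2)) \<partial>lborel) \<partial>lborel)"
    by (rule lborel_pair.Fubini') measurable
  also have "\<dots> \<le> (\<integral>\<^sup>+t. ennreal pi * ennreal (\<bar>f t\<bar> powr (3/2)) \<partial>lborel)"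
  proof (rule nn_integral_mono)
    fix t
    have "(\<integral>\<^sup>+x. ennreal (y / ((x - t)^2 + y^2)) * ennreal (\<bar>f t\<bar> powr (3/2)) \<partial>lborel)
       = (\<integral>\<^sup>+x. ennreal (y / ((t - x)^2 + y^2)) \<partial>lborel) * ennreal (\<bar>f t\<bar> powr (3/2))"
      by (subst nn_integral_multc) (auto simp: power2_commute)
    also have "\<dots> \<le> ennreal pi * ennreal (\<bar>f t\<bar> powr (3/2))"
      by (intro mult_right_mono nn_integral_poisson_kernel y) auto
    finally show "(\<integral>\<^sup>+x. ennreal (y / ((x - t)^2 + y^2)) * ennreal (\<bar>f t\<bar> powr (3/2)) \<partial>lborel)
        \<le> ennreal pi * ennreal (\<bar>f t\<bar> powr (3/2))" .
  qed
  also have "\<dots> = ennreal pi * modular f"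
    unfolding modular_def by (simp add: nn_integral_cmult)
  finally show ?thesis by (simp add: ennreal_mult mult.assoc mult_left_mono)
qed

text \<open>The contour part of Cauchy's theorem. The values of the primitive at the two ends of the
  line are compared through the apex i (R + y). On the two slanted segments |F| is at most 4 M / R,
  so F^(3/2) is O(R^(-3/2)) on paths of length at most 2 R, and the difference decays like
  R^(-1/2).\<close>

lemma poisson_cauchy_primitive_edge_bound:
  assumes f: "integrable lborel f" and supp: "\<And>t. f t \<noteq> 0 \<Longrightarrow> \<bar>t\<bar> \<le> A" and A: "0 < A" and y: "0 < y"
    and g: "\<And>z. 0 < Im z \<Longrightarrow> (g has_field_derivative (poisson_cauchy f z * csqrt (poisson_cauchy f z))) (at z)"
    and R: "4 * A \<le> R"
  shows "norm (g (Complex R y) - g (Complex (-R) y)) \<le> 32 * (LINT t|lborel. \<bar>f t\<bar>) powr (3/2) / sqrt R"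
proof -
  define M where "M = (LINT t|lborel. \<bar>f t\<bar>)"
  define B where "B = (4 * M / R) powr (3/2)"
  have R0: "R > 0" using A R by linarith
  have M0: "0 \<le> M" unfolding M_def by (rule integral_nonneg_AE) auto
  have bd: "norm (poisson_cauchy f z * csqrt (poisson_cauchy f z)) \<le> B"
    if z: "0 < Im z" "R \<le> \<bar>Re z\<bar> + \<bar>Im z\<bar>" for z
  proof -
    \<comment> \<open>|z| is at least R/2 and the support lies within R/4 of the origin, so the two
      are at least R/4 apart.\<close>
    have zR: "R / 2 \<le> norm z" using abs_Re_le_cmod[of z] abs_Im_le_cmod[of z] z(2) by linarith
    have "norm (poisson_cauchy f z) \<le> M / (R/4)"
      unfolding M_def
    proof (rule norm_poisson_cauchy_le[OF f z(1)])
      fix t assume "f t \<noteq> 0"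
      then have "\<bar>t\<bar> \<le> R / 4" using supp[of t] R by linarith
      then show "R / 4 \<le> cmod (z - complex_of_real t)"
        using norm_triangle_ineq2[of z "of_real t"] zR by simp
    qed (use R0 in simp)
    then have n: "norm (poisson_cauchy f z) \<le> 4 * M / R" by (simp add: mult.commute)
    have "norm (poisson_cauchy f z * csqrt (poisson_cauchy f z)) = norm (poisson_cauchy f z) powr (3/2)"
      by (simp add: norm_mult powr_three_halves)
    also have "\<dots> \<le> B" unfolding B_def by (rule powr_mono2) (use n in auto)
    finally show ?thesis .
  qed
  have edge: "norm (g (Complex (s * R) y) - g (Complex 0 (R + y))) \<le> B * (2 * R)" if s: "s = 1 \<or> s = -1" for s
  proof -
    \<comment> \<open>A convex set that contains both endpoints and on which the estimate above
      holds, so the mean value bound applies along the segment. The sign \<open>s\<close> selects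
      the right or the left side.\<close>
    define S where "S = {z. y \<le> Im z \<and> R \<le> s * Re z + Im z}"
    have "convex {z. y \<le> Im z}" by (rule convex_halfspace_Im_ge)
    moreover have "convex {z. R \<le> Complex s 1 \<bullet> z}"
      using convex_halfspace_ge[of R "Complex s 1"] .
    ultimately have "convex ({z. y \<le> Im z} \<inter> {z. R \<le> Complex s 1 \<bullet> z})" by (rule convex_Int)
    moreover have "{z. y \<le> Im z} \<inter> {z. R \<le> Complex s 1 \<bullet> z} = S"
      by (auto simp: S_def inner_complex_def)
    ultimately have conv: "convex S" by simp
    have "norm (g (Complex (s * R) y) - g (Complex 0 (R + y))) \<le> B * norm (Complex (s * R) y - Complex 0 (R + y))"
    proof (rule field_differentiable_bound[OF conv])
      fix z assume "z \<in> S"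
      then have z: "0 < Im z" "R \<le> \<bar>Re z\<bar> + \<bar>Im z\<bar>" using y s by (auto simp: S_def)
      show "(g has_field_derivative (poisson_cauchy f z * csqrt (poisson_cauchy f z))) (at z within S)"
        by (rule has_field_derivative_at_within[OF g[OF z(1)]])
      show "norm (poisson_cauchy f z * csqrt (poisson_cauchy f z)) \<le> B" by (rule bd[OF z])
    qed (use s y R0 in \<open>auto simp: S_def\<close>)
    also have "\<dots> \<le> B * (2 * R)"
    proof (rule mult_left_mono)
      have "norm (Complex (s * R) y - Complex 0 (R + y)) \<le> \<bar>s * R\<bar> + \<bar>- R\<bar>"
        using cmod_le[of "Complex (s * R) y - Complex 0 (R + y)"] by simp
      also have "\<dots> = 2 * R" using s R0 by auto
      finally show "norm (Complex (s * R) y - Complex 0 (R + y)) \<le> 2 * R" .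
    qed (simp add: B_def)
    finally show ?thesis .
  qed
  have "norm (g (Complex R y) - g (Complex (-R) y)) \<le> B * (2 * R) + B * (2 * R)"
    using norm_triangle_ineq4[of "g (Complex R y) - g (Complex 0 (R + y))" "g (Complex (-R) y) - g (Complex 0 (R + y))"]
      edge[of 1] edge[of "-1"] by simp
  also have "\<dots> = 4 * R * B" by simp
  also have "B = 8 * M powr (3/2) / (R * sqrt R)"
  proof -
    have "B = (4 * M) powr (3/2) / R powr (3/2)" unfolding B_def using M0 R0 by (subst powr_divide) auto
    also have "(4 * M) powr (3/2) = 4 powr (3/2) * M powr (3/2)" using M0 by (subst powr_mult) auto
    also have "4 powr (3/2) = (8::real)" by (simp add: powr_three_halves)
    also have "R powr (3/2) = R * sqrt R" using R0 by (simp add: powr_three_halves)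
    finally show ?thesis .
  qed
  also have "4 * R * (8 * M powr (3/2) / (R * sqrt R)) = 32 * M powr (3/2) / sqrt R"
    using R0 by simp
  finally show ?thesis by (simp add: M_def)
qed

text \<open>The pointwise inequality is integrated along the line. The (Re F)^(3/2) term is the
  Poisson estimate, and the Re F^(3/2) term is a difference of boundary values that vanishes in the
  limit; 120 is 40 * 3.\<close>

lemma nn_integral_poisson_cauchy_le:
  assumes f: "integrable lborel f" and nn: "\<And>t. 0 \<le> f t"
    and supp: "\<And>t. f t \<noteq> 0 \<Longrightarrow> \<bar>t\<bar> \<le> A" and A: "0 < A" and y: "0 < y"
  shows "(\<integral>\<^sup>+x. ennreal (norm (poisson_cauchy f (Complex x y)) powr (3/2)) \<partial>lborel)
    \<le> ennreal (120 * sqrt pi * pi) * modular f"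
proof (cases "AE t in lborel. f t = 0")
  case True
  have "poisson_cauchy f z = 0" for z
    unfolding poisson_cauchy_def by (rule integral_eq_zero_AE) (use True in \<open>auto elim!: AE_mp\<close>)
  then show ?thesis by simp
next
  case False
  let ?F = "poisson_cauchy f" 
  let ?G = "\<lambda>z. ?F z * csqrt (?F z)"
  let ?H = "{z. 0 < Im z}"
  define M where "M = (LINT t|lborel. \<bar>f t\<bar>)"
  have pos: "0 < Re (?F z)" if "0 < Im z" for z by (rule Re_poisson_cauchy_pos[OF f nn False that])
  have holF: "?F holomorphic_on ?H" by (rule poisson_cauchy_holomorphic[OF f])
  have holG: "?G holomorphic_on ?H"
    by (intro holomorphic_intros holF holomorphic_on_csqrt') (use pos in \<open>auto simp: complex_nonpos_Reals_iff dest: pos\<close>)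
  have convH: "convex ?H" and openH: "open ?H"
    by (simp_all add: convex_halfspace_Im_gt open_halfspace_Im_gt)
  obtain g where g0: "\<And>z. z \<in> ?H \<Longrightarrow> (g has_field_derivative ?G z) (at z within ?H)"
    using holomorphic_convex_primitive'[OF convH openH holG] by blast
  have g: "(g has_field_derivative ?G z) (at z)" if "0 < Im z" for z
    using g0[of z] that openH by (simp add: at_within_open[of z ?H])
  have contH: "continuous_on S (\<lambda>x. h (Complex x y))" if "h holomorphic_on ?H" for S and h :: "complex \<Rightarrow> complex"
  proof -
    have "continuous_on S (h \<circ> (\<lambda>x. Complex x y))"
      by (rule continuous_on_compose)
         (auto simp: Complex_eq y intro!: continuous_intros continuous_on_subset[OF holomorphic_on_imp_continuous_on[OF that]])
    then show ?thesis by (simp add: o_def)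
  qed
  note contF = contH[OF holF] and contG = contH[OF holG]
  define n where "n = (\<lambda>x. norm (?F (Complex x y)) powr (3/2))"
  define r where "r = (\<lambda>x. Re (?F (Complex x y)) powr (3/2))"
  define c where "c = (\<lambda>x. Re (?G (Complex x y)))"
  have contn: "continuous_on S n" for S
    unfolding n_def by (intro continuous_intros contF continuous_on_powr') auto
  have contr: "continuous_on S r" for S
    unfolding r_def by (intro continuous_intros contF continuous_on_powr') (use pos y in \<open>auto intro: less_imp_le\<close>)
  have contc: "continuous_on S c" for S unfolding c_def by (intro continuous_on_Re contG)
  have pt: "n x \<le> 40 * r x - 2 * c x" for x
    unfolding n_def r_def c_def by (rule norm_powr_three_halves_le) (simp add: pos y)
  have [measurable]: "n \<in> borel_measurable borel" "r \<in> borel_measurable borel"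
    using contn[of UNIV] contr[of UNIV] by (auto intro: borel_measurable_continuous_onI)
  define I where "I = (\<integral>\<^sup>+x. ennreal (r x) \<partial>lborel)"
  \<comment> \<open>Finiteness over the whole line is not known in advance, so the inequality is
    first integrated over a bounded interval, where all terms are integrable separately.\<close>
  have fin: "(\<integral>\<^sup>+x. ennreal (n x) * indicator {-R..R} x \<partial>lborel)
      \<le> 40 * I + ennreal (64 * M powr (3/2) / sqrt R)" if R: "4 * A \<le> R" for R
  proof -
    have R0: "R > 0" using A R by linarith
    have i: "integrable lborel (\<lambda>x. indicator {-R..R} x *\<^sub>R h x)" if "continuous_on {-R..R} h" for h :: "real \<Rightarrow> real"
      using borel_integrable_atLeastAtMost'[OF that] by (simp add: set_integrable_def)
    have FTC: "(LINT x|lborel. indicator {-R..R} x *\<^sub>R ?G (Complex x y)) = g (Complex R y) - g (Complex (-R) y)"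
    proof (rule integral_FTC_Icc)
      show "-R \<le> R" using R0 by simp
      show "continuous_on {-R..R} (\<lambda>x. ?G (Complex x y))" by (rule contG)
      fix x
      have "((\<lambda>x. complex_of_real x + \<i> * complex_of_real y) has_vector_derivative 1 + 0) (at x)"
        by (intro has_vector_derivative_add has_vector_derivative_const)
           (auto intro!: derivative_eq_intros has_vector_derivative_of_real)
      then have d: "((\<lambda>x. Complex x y) has_vector_derivative 1) (at x)" by (simp add: Complex_eq[abs_def] Complex_eq)
      have "(g \<circ> (\<lambda>x. Complex x y) has_vector_derivative 1 * ?G (Complex x y)) (at x)"
        by (rule field_vector_diff_chain_at[OF d g]) (simp add: y)
      then show "((\<lambda>x. g (Complex x y)) has_vector_derivative ?G (Complex x y)) (at x within {-R..R})"
        by (auto simp: o_def intro: has_vector_derivative_at_within)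
    qed
    have "integrable lborel (\<lambda>x. indicator {-R..R} x *\<^sub>R ?G (Complex x y))"
      using borel_integrable_atLeastAtMost'[OF contG] by (simp add: set_integrable_def)
    from integral_Re[OF this] have "(LINT x|lborel. indicator {-R..R} x *\<^sub>R c x) = Re (g (Complex R y) - g (Complex (-R) y))"
      unfolding FTC c_def by (simp only: scaleR_complex.sel real_scaleR_def)
    moreover have "norm (g (Complex R y) - g (Complex (-R) y)) \<le> 32 * M powr (3/2) / sqrt R"
      unfolding M_def by (rule poisson_cauchy_primitive_edge_bound[OF f supp A y g R]) auto
    ultimately have edge: "- (LINT x|lborel. indicator {-R..R} x *\<^sub>R c x) \<le> 32 * M powr (3/2) / sqrt R"
      using abs_Re_le_cmod[of "g (Complex R y) - g (Complex (-R) y)"] by linarith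
    have ind: "indicator {-R..R} x *\<^sub>R a \<le> 40 * (indicator {-R..R} x *\<^sub>R b) - 2 * (indicator {-R..R} x *\<^sub>R d)"
      if "a \<le> 40 * b - 2 * d" for a b d x :: real
      using that by (simp add: indicator_def)
    have "(LINT x|lborel. indicator {-R..R} x *\<^sub>R n x) \<le> (LINT x|lborel. 40 * (indicator {-R..R} x *\<^sub>R r x) - 2 * (indicator {-R..R} x *\<^sub>R c x))"
      by (intro integral_mono Bochner_Integration.integrable_diff integrable_mult_right i contn contr contc ind pt)
    also have "\<dots> = 40 * (LINT x|lborel. indicator {-R..R} x *\<^sub>R r x) - 2 * (LINT x|lborel. indicator {-R..R} x *\<^sub>R c x)"
      using i[OF contr] i[OF contc] by simp
    also have "\<dots> \<le> 40 * (LINT x|lborel. indicator {-R..R} x *\<^sub>R r x) + 64 * M powr (3/2) / sqrt R"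
      using edge by simp
    finally have le: "(LINT x|lborel. indicator {-R..R} x *\<^sub>R n x) \<le> 40 * (LINT x|lborel. indicator {-R..R} x *\<^sub>R r x) + 64 * M powr (3/2) / sqrt R" .
    have "(\<integral>\<^sup>+x. ennreal (n x) * indicator {-R..R} x \<partial>lborel) = (\<integral>\<^sup>+x. ennreal (indicator {-R..R} x *\<^sub>R n x) \<partial>lborel)"
      by (intro nn_integral_cong) (auto simp: indicator_def)
    also have "\<dots> = ennreal (LINT x|lborel. indicator {-R..R} x *\<^sub>R n x)"
      by (rule nn_integral_eq_integral[OF i[OF contn]]) (auto simp: n_def)
    also have "\<dots> \<le> ennreal (40 * (LINT x|lborel. indicator {-R..R} x *\<^sub>R r x) + 64 * M powr (3/2) / sqrt R)"
      by (rule ennreal_leI[OF le])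
    also have "\<dots> = 40 * ennreal (LINT x|lborel. indicator {-R..R} x *\<^sub>R r x) + ennreal (64 * M powr (3/2) / sqrt R)"
      by (subst ennreal_plus) (use R0 in \<open>auto intro!: integral_nonneg_AE mult_nonneg_nonneg divide_nonneg_nonneg simp: ennreal_mult r_def\<close>)
    also have "ennreal (LINT x|lborel. indicator {-R..R} x *\<^sub>R r x) = (\<integral>\<^sup>+x. ennreal (indicator {-R..R} x *\<^sub>R r x) \<partial>lborel)"
      by (rule nn_integral_eq_integral[OF i[OF contr], symmetric]) (auto simp: r_def)
    also have "\<dots> \<le> I" unfolding I_def by (intro nn_integral_mono) (auto simp: indicator_def)
    finally show ?thesis by (simp add: add_mono mult_left_mono)
  qed
  \<comment> \<open>Monotone convergence along R = k on the left, while the edge term on the right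
    tends to 0.\<close>
  have "(\<lambda>k::nat. \<integral>\<^sup>+x. ennreal (n x) * indicator {-real k..real k} x \<partial>lborel) \<longlonglongrightarrow> (\<integral>\<^sup>+x. ennreal (n x) \<partial>lborel)"
  proof (rule nn_integral_LIMSEQ)
    show "incseq (\<lambda>(k::nat) x. ennreal (n x) * indicator {-real k..real k} x)"
      by (auto simp: incseq_def le_fun_def indicator_def)
    fix x
    obtain k0 :: nat where k0: "\<bar>x\<bar> \<le> real k0" using real_arch_simple by blast
    show "(\<lambda>k::nat. ennreal (n x) * indicator {-real k..real k} x) \<longlonglongrightarrow> ennreal (n x)"
      by (rule tendsto_eventually) (use k0 in \<open>auto simp: eventually_sequentially indicator_def intro!: exI[of _ k0]\<close>)
  qed measurable
  moreover have "(\<lambda>k::nat. 40 * I + ennreal (64 * M powr (3/2) / sqrt (real k))) \<longlonglongrightarrow> 40 * I + 0"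
  proof (intro tendsto_add tendsto_const)
    have "(\<lambda>k::nat. 64 * M powr (3/2) / sqrt (real k)) \<longlonglongrightarrow> 0"
      by (intro tendsto_divide_0[OF tendsto_const] filterlim_at_top_imp_at_infinity
            filterlim_compose[OF sqrt_at_top filterlim_real_sequentially])
    from tendsto_ennrealI[OF this] show "(\<lambda>k::nat. ennreal (64 * M powr (3/2) / sqrt (real k))) \<longlonglongrightarrow> 0"
      by simp
  qed
  moreover obtain k0 :: nat where "4 * A \<le> real k0" using real_arch_simple by blast
  ultimately have "(\<integral>\<^sup>+x. ennreal (n x) \<partial>lborel) \<le> 40 * I + 0"
    by (elim LIMSEQ_le) (use fin in \<open>auto intro!: exI[of _ k0]\<close>)
  also have "\<dots> \<le> 40 * (ennreal (3 * sqrt pi * pi) * modular f)"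
    using nn_integral_Re_poisson_cauchy_le[OF f y] pos[of "Complex _ y"] y by (simp add: I_def r_def mult_left_mono less_imp_le)
  also have "\<dots> = ennreal (120 * sqrt pi * pi) * modular f"
    by (simp add: mult.assoc[symmetric] ennreal_mult)
  finally show ?thesis unfolding n_def .
qed

section \<open>The truncated kernel 1/r on the line\<close>

definition trunc_kernel :: "real \<Rightarrow> real \<Rightarrow> real \<Rightarrow> real" where
  "trunc_kernel a b r = (if a < \<bar>r\<bar> \<and> \<bar>r\<bar> \<le> b then 1 / r else 0)"

lemma trunc_kernel_measurable [measurable]: "trunc_kernel a b \<in> borel_measurable borel"
  unfolding trunc_kernel_def[abs_def] by measurable

lemma abs_trunc_kernel_le: "0 < a \<Longrightarrow> \<bar>trunc_kernel a b r\<bar> \<le> 1 / a"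
  by (auto simp: trunc_kernel_def abs_if field_simps)

text \<open>3 times the constant for |F|; the 3 bounds \<open>2 powr (3/2)\<close> in the passage
  from 2 |F| to |F|.\<close>

definition hilbert_const :: real where "hilbert_const = 360 * sqrt pi * pi"

text \<open>At height y = a the truncated kernel differs from the conjugate Poisson kernel u / (u^2
  + a^2) by at most the Poisson kernel a / (u^2 + a^2). For f >= 0 the truncated transform is
  therefore at most |Im F| + Re F, hence at most 2 |F|, and the bound does not depend on
  \<open>a\<close>.\<close>

lemma truncated_hilbert_nonneg:
  assumes f: "integrable lborel f" and nn: "\<And>t. 0 \<le> f t"
    and supp: "\<And>t. f t \<noteq> 0 \<Longrightarrow> \<bar>t\<bar> \<le> A" and A: "0 < A" and a: "0 < a"
  defines "k \<equiv> \<lambda>r::real. if a < \<bar>r\<bar> then 1 / r else 0"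
  shows "(\<integral>\<^sup>+x. ennreal (\<bar>LINT t|lborel. f t * k (x - t)\<bar> powr (3/2)) \<partial>lborel)
    \<le> ennreal hilbert_const * modular f"
    and "integrable lborel (\<lambda>t. f t * k (x - t))"
    and "(\<lambda>x. LINT t|lborel. f t * k (x - t)) \<in> borel_measurable borel"
proof -
  have [measurable]: "f \<in> borel_measurable borel" using f by (auto dest!: borel_measurable_integrable)
  have [measurable]: "k \<in> borel_measurable borel" unfolding k_def by measurable
  have kle: "\<bar>k r\<bar> \<le> 1 / a" for r using a by (auto simp: k_def abs_if field_simps)
  have int: "integrable lborel (\<lambda>t. f t * k (x - t))" for x
  proof (rule Bochner_Integration.integrable_bound)
    show "integrable lborel (\<lambda>t. f t * (1 / a))" using f by (rule integrable_mult_left)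
    have "\<bar>f t\<bar> * \<bar>k (x - t)\<bar> \<le> \<bar>f t\<bar> * (1 / a)" for t by (intro mult_left_mono kle) auto
    then show "AE t in lborel. norm (f t * k (x - t)) \<le> norm (f t * (1 / a))"
      using a by (auto simp: abs_mult)
  qed measurable
  then show "integrable lborel (\<lambda>t. f t * k (x - t))" .
  show "(\<lambda>x. LINT t|lborel. f t * k (x - t)) \<in> borel_measurable borel" by measurable
  \<comment> \<open>Outside the cut 1/u - u / (u^2 + a^2) = a^2 / (u (u^2 + a^2)); inside it only
    the conjugate kernel is left, and |u| <= a.\<close>
  have diff: "\<bar>k u - u / (u^2 + a^2)\<bar> \<le> a / (u^2 + a^2)" for u
  proof -
    have D: "0 < u^2 + a^2" using a by (intro add_nonneg_pos) auto
    show ?thesis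
    proof (cases "a < \<bar>u\<bar>")
      case True
      then have u: "u \<noteq> 0" using a by auto
      have "k u - u / (u^2 + a^2) = (a / u) * (a / (u^2 + a^2))"
        using D u True unfolding k_def by (simp add: field_simps power2_eq_square)
      then have "\<bar>k u - u / (u^2 + a^2)\<bar> = \<bar>a / u\<bar> * (a / (u^2 + a^2))"
        using D a by (simp add: abs_mult)
      also have "\<dots> \<le> 1 * (a / (u^2 + a^2))"
        by (intro mult_right_mono) (use True a D in \<open>auto simp: abs_divide divide_le_eq\<close>)
      finally show ?thesis by simp
    next
      case False
      then have "\<bar>k u - u / (u^2 + a^2)\<bar> = \<bar>u\<bar> / (u^2 + a^2)" using D by (simp add: k_def abs_divide)
      also have "\<dots> \<le> a / (u^2 + a^2)" by (rule divide_right_mono) (use False D in auto)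
      finally show ?thesis .
    qed
  qed
  have pt: "\<bar>LINT t|lborel. f t * k (x - t)\<bar> \<le> 2 * norm (poisson_cauchy f (Complex x a))" for x
  proof -
    note P = Re_poisson_cauchy[OF f a, of x]
    have "\<bar>(LINT t|lborel. f t * k (x - t)) - Im (poisson_cauchy f (Complex x a))\<bar>
       = \<bar>LINT t|lborel. f t * k (x - t) - f t * ((x - t) / ((x - t)^2 + a^2))\<bar>"
      unfolding P(2) by (subst Bochner_Integration.integral_diff[OF int P(4)]) simp
    also have "\<dots> \<le> (LINT t|lborel. f t * (a / ((x - t)^2 + a^2)))"
    proof (unfold real_norm_def[symmetric], rule Bochner_Integration.integral_norm_bound_integral)
      show "integrable lborel (\<lambda>t. f t * k (x - t) - f t * ((x - t) / ((x - t)^2 + a^2)))"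
        by (rule Bochner_Integration.integrable_diff[OF int P(4)])
      show "integrable lborel (\<lambda>t. f t * (a / ((x - t)^2 + a^2)))" by (rule P(3))
      fix t
      have "\<bar>f t * k (x - t) - f t * ((x - t) / ((x - t)^2 + a^2))\<bar> = f t * \<bar>k (x - t) - (x - t) / ((x - t)^2 + a^2)\<bar>"
        using nn[of t] by (simp add: abs_mult right_diff_distrib[symmetric] del: times_divide_eq_right)
      also have "\<dots> \<le> f t * (a / ((x - t)^2 + a^2))" by (intro mult_left_mono diff nn)
      finally show "norm (f t * k (x - t) - f t * ((x - t) / ((x - t)^2 + a^2))) \<le> f t * (a / ((x - t)^2 + a^2))"
        by (simp only: real_norm_def)
    qed
    also have "\<dots> = Re (poisson_cauchy f (Complex x a))" by (rule P(1)[symmetric])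
    finally show ?thesis
      using abs_Re_le_cmod[of "poisson_cauchy f (Complex x a)"] abs_Im_le_cmod[of "poisson_cauchy f (Complex x a)"]
      by linarith
  qed
  have "(\<integral>\<^sup>+x. ennreal (\<bar>LINT t|lborel. f t * k (x - t)\<bar> powr (3/2)) \<partial>lborel)
      \<le> (\<integral>\<^sup>+x. 3 * ennreal (norm (poisson_cauchy f (Complex x a)) powr (3/2)) \<partial>lborel)"
  proof (rule nn_integral_mono)
    fix x
    have "\<bar>LINT t|lborel. f t * k (x - t)\<bar> powr (3/2) \<le> (2 * norm (poisson_cauchy f (Complex x a))) powr (3/2)"
      by (rule powr_mono2) (use pt in auto)
    also have "\<dots> = 2 powr (3/2) * norm (poisson_cauchy f (Complex x a)) powr (3/2)" by (subst powr_mult) auto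
    also have "\<dots> \<le> 3 * norm (poisson_cauchy f (Complex x a)) powr (3/2)"
      by (intro mult_right_mono two_powr_three_halves_le) auto
    finally show "ennreal (\<bar>LINT t|lborel. f t * k (x - t)\<bar> powr (3/2)) \<le> 3 * ennreal (norm (poisson_cauchy f (Complex x a)) powr (3/2))"
      by (metis ennreal_leI ennreal_mult' ennreal_numeral zero_le_numeral)
  qed
  also have "\<dots> = 3 * (\<integral>\<^sup>+x. ennreal (norm (poisson_cauchy f (Complex x a)) powr (3/2)) \<partial>lborel)"
    unfolding poisson_cauchy_def Complex_eq by (rule nn_integral_cmult) measurable
  also have "\<dots> \<le> 3 * (ennreal (120 * sqrt pi * pi) * modular f)"
    by (intro mult_left_mono nn_integral_poisson_cauchy_le[OF f nn supp A a]) auto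
  also have "\<dots> = ennreal hilbert_const * modular f"
    by (simp add: hilbert_const_def mult.assoc[symmetric] ennreal_mult)
  finally show "(\<integral>\<^sup>+x. ennreal (\<bar>LINT t|lborel. f t * k (x - t)\<bar> powr (3/2)) \<partial>lborel)
    \<le> ennreal hilbert_const * modular f" .
qed

lemma six_times_ennreal:
  assumes "0 \<le> c"
  shows "3 * (ennreal c * X + ennreal c * X) = ennreal (6 * c) * X"
proof -
  have "3 * (ennreal c * X + ennreal c * X) = (3 * 2) * (ennreal c * X)"
    by (simp only: mult_2[symmetric] mult.assoc)
  also have "(3 * 2 :: ennreal) = 6" by simp
  also have "6 * (ennreal c * X) = ennreal (6 * c) * X"
    using assms by (simp add: ennreal_mult mult.assoc)
  finally show ?thesis .
qed

lemma hilbert_const_nonneg: "0 \<le> hilbert_const" by (simp add: hilbert_const_def)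

text \<open>The kernel cut at both ends is a difference of two one-sided truncations, whence 6 = 3 *
  2. The outer cut gives the operator finite range, on which transference relies.\<close>

lemma truncated_hilbert_pos_part:
  assumes f: "integrable lborel f" and nn: "\<And>t. 0 \<le> f t"
    and supp: "\<And>t. f t \<noteq> 0 \<Longrightarrow> \<bar>t\<bar> \<le> A" and A: "0 < A" and ab: "0 < a" "a < b"
  shows "modular (\<lambda>x. LINT t|lborel. f t * trunc_kernel a b (x - t)) \<le> ennreal (6 * hilbert_const) * modular f"
    and "integrable lborel (\<lambda>t. f t * trunc_kernel a b (x - t))"
proof -
  let ?k = "\<lambda>a r::real. if a < \<bar>r\<bar> then 1 / r else 0"
  have b: "0 < b" using ab by simp
  note Ta = truncated_hilbert_nonneg[OF f nn supp A ab(1)]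
  note Tb = truncated_hilbert_nonneg[OF f nn supp A b]
  have k: "f t * trunc_kernel a b (x - t) = f t * ?k a (x - t) - f t * ?k b (x - t)" for x t
    using ab by (auto simp: trunc_kernel_def)
  show "integrable lborel (\<lambda>t. f t * trunc_kernel a b (x - t))"
    unfolding k by (intro Bochner_Integration.integrable_diff Ta(2) Tb(2))
  have eq: "(LINT t|lborel. f t * trunc_kernel a b (x - t)) = (LINT t|lborel. f t * ?k a (x - t)) - (LINT t|lborel. f t * ?k b (x - t))" for x
    unfolding k by (rule Bochner_Integration.integral_diff[OF Ta(2) Tb(2)])
  have "modular (\<lambda>x. LINT t|lborel. f t * trunc_kernel a b (x - t))
     \<le> 3 * (modular (\<lambda>x. LINT t|lborel. f t * ?k a (x - t)) + modular (\<lambda>x. LINT t|lborel. f t * ?k b (x - t)))"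
    unfolding eq by (rule modular_diff_le[OF Ta(3) Tb(3)])
  also have "\<dots> \<le> 3 * (ennreal hilbert_const * modular f + ennreal hilbert_const * modular f)"
    using Ta(1) Tb(1) by (intro mult_left_mono add_mono) (auto simp: modular_def)
  also have "\<dots> = ennreal (6 * hilbert_const) * modular f"
    by (rule six_times_ennreal[OF hilbert_const_nonneg])
  finally show "modular (\<lambda>x. LINT t|lborel. f t * trunc_kernel a b (x - t)) \<le> ennreal (6 * hilbert_const) * modular f" .
qed

text \<open>From |f| <= 1 + |f|^(3/2) on a set of finite measure.\<close>

lemma modular_finite_imp_integrable:
  fixes f :: "'a::euclidean_space \<Rightarrow> real"
  assumes [measurable]: "f \<in> borel_measurable borel" and fin: "modular f < \<infinity>"
    and S [measurable]: "S \<in> sets borel" "emeasure lborel S < \<infinity>" and supp: "\<And>t. f t \<noteq> 0 \<Longrightarrow> t \<in> S"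
  shows "integrable lborel f"
proof -
  have "(\<integral>\<^sup>+t. ennreal (norm (f t)) \<partial>lborel) \<le> (\<integral>\<^sup>+t. indicator S t + ennreal (norm (f t) powr (3/2)) \<partial>lborel)"
  proof (rule nn_integral_mono)
    fix t
    show "ennreal (norm (f t)) \<le> indicator S t + ennreal (norm (f t) powr (3/2))"
    proof (cases "1 \<le> norm (f t)")
      case True
      then have "norm (f t) powr 1 \<le> norm (f t) powr (3/2)" by (intro powr_mono) auto
      with True have "norm (f t) \<le> norm (f t) powr (3/2)" by simp
      then have "ennreal (norm (f t)) \<le> ennreal (norm (f t) powr (3/2))" by (rule ennreal_leI)
      then show ?thesis by (rule add_increasing[OF zero_le])
    next
      case False
      then have "ennreal (norm (f t)) \<le> indicator S t"
        using supp[of t] by (cases "f t = 0") (auto simp: ennreal_le_1)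
      then show ?thesis by (rule add_increasing2[OF zero_le])
    qed
  qed
  also have "\<dots> = emeasure lborel S + modular f"
    unfolding modular_def by (subst nn_integral_add) auto
  also have "\<dots> < \<infinity>" using fin S(2) by simp
  finally show ?thesis unfolding integrable_iff_bounded by simp
qed

text \<open>The substitution t = s - r restores the convolution form, and splitting f into positive
  and negative parts costs another factor 6.\<close>

lemma truncated_hilbert_bound:
  fixes f :: "real \<Rightarrow> real"
  assumes [measurable]: "f \<in> borel_measurable borel"
    and supp: "\<And>t. f t \<noteq> 0 \<Longrightarrow> \<bar>t\<bar> \<le> A" and ab: "0 < a" "a < b"
  shows "modular (\<lambda>s. LINT r|lborel. f (s - r) * trunc_kernel a b r) \<le> ennreal (36 * hilbert_const) * modular f"
proof (cases "modular f < \<infinity>")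
  case False
  then have "modular f = \<infinity>" by (simp add: less_top[symmetric])
  moreover have "hilbert_const > 0" by (simp add: hilbert_const_def)
  ultimately show ?thesis by (simp add: ennreal_mult_top)
next
  case True
  define A' where "A' = \<bar>A\<bar> + 1"
  have A': "0 < A'" by (simp add: A'_def)
  have supp': "\<bar>t\<bar> \<le> A'" if "f t \<noteq> 0" for t using supp[OF that] by (simp add: A'_def)
  have f: "integrable lborel f"
    by (rule modular_finite_imp_integrable[OF _ True, of "{-A'..A'}"]) (use supp' A' in \<open>auto simp: abs_le_iff minus_le_iff\<close>)
  let ?p = "\<lambda>t. max (f t) 0" and ?m = "\<lambda>t. max (- f t) 0"
  have p: "integrable lborel ?p" "integrable lborel ?m" using f by auto
  have Tp: "modular (\<lambda>x. LINT t|lborel. ?p t * trunc_kernel a b (x - t)) \<le> ennreal (6 * hilbert_const) * modular ?p"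
           "\<And>x. integrable lborel (\<lambda>t. ?p t * trunc_kernel a b (x - t))"
    by (rule truncated_hilbert_pos_part[OF p(1) _ _ A' ab]; use supp' in \<open>force simp: max_def split: if_splits\<close>)+
  have Tm: "modular (\<lambda>x. LINT t|lborel. ?m t * trunc_kernel a b (x - t)) \<le> ennreal (6 * hilbert_const) * modular ?m"
           "\<And>x. integrable lborel (\<lambda>t. ?m t * trunc_kernel a b (x - t))"
    by (rule truncated_hilbert_pos_part[OF p(2) _ _ A' ab]; use supp' in \<open>force simp: max_def split: if_splits\<close>)+
  have eq: "(LINT r|lborel. f (s - r) * trunc_kernel a b r)
      = (LINT t|lborel. ?p t * trunc_kernel a b (s - t)) - (LINT t|lborel. ?m t * trunc_kernel a b (s - t))" for s
  proof -
    have "(LINT r|lborel. f (s - r) * trunc_kernel a b r) = (LINT t|lborel. f t * trunc_kernel a b (s - t))"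
      by (subst lborel_integral_real_affine[where c="-1" and t=s]) auto
    also have "\<dots> = (LINT t|lborel. ?p t * trunc_kernel a b (s - t) - ?m t * trunc_kernel a b (s - t))"
      by (intro Bochner_Integration.integral_cong refl) (auto simp: max_def)
    also have "\<dots> = (LINT t|lborel. ?p t * trunc_kernel a b (s - t)) - (LINT t|lborel. ?m t * trunc_kernel a b (s - t))"
      by (rule Bochner_Integration.integral_diff[OF Tp(2) Tm(2)])
    finally show ?thesis .
  qed
  have "modular (\<lambda>s. LINT r|lborel. f (s - r) * trunc_kernel a b r)
     \<le> 3 * (modular (\<lambda>x. LINT t|lborel. ?p t * trunc_kernel a b (x - t)) + modular (\<lambda>x. LINT t|lborel. ?m t * trunc_kernel a b (x - t)))"
    unfolding eq by (rule modular_diff_le) measurable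
  also have "\<dots> \<le> 3 * (ennreal (6 * hilbert_const) * modular f + ennreal (6 * hilbert_const) * modular f)"
    by (intro mult_left_mono add_mono order_trans[OF Tp(1)] order_trans[OF Tm(1)] modular_mono) auto
  also have "\<dots> = ennreal (36 * hilbert_const) * modular f"
    using six_times_ennreal[of "6 * hilbert_const"] hilbert_const_nonneg by simp
  finally show ?thesis .
qed

section \<open>Transference and rotations\<close>

lemma vec_nth_measurable [measurable (raw)]:
  fixes f :: "'a \<Rightarrow> 'b::{second_countable_topology, real_normed_vector} ^ 'n::finite"
  assumes "f \<in> borel_measurable N"
  shows "(\<lambda>x. f x $ j) \<in> borel_measurable N"
proof (rule measurable_compose[OF assms])
  show "(\<lambda>v::'b^'n. v $ j) \<in> borel_measurable borel"
    by (intro borel_measurable_continuous_onI continuous_intros)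
qed

lemma trunc_kernel_measurable' [measurable (raw)]:
  fixes f g h :: "'a \<Rightarrow> real"
  assumes [measurable]: "f \<in> borel_measurable N" "g \<in> borel_measurable N" "h \<in> borel_measurable N"
  shows "(\<lambda>x. trunc_kernel (f x) (g x) (h x)) \<in> borel_measurable N"
  unfolding trunc_kernel_def by measurable

lemma nn_integral_lborel_affine:
  fixes t :: "'a::euclidean_space"
  assumes [measurable]: "f \<in> borel_measurable borel" and c: "c \<noteq> 0"
  shows "(\<integral>\<^sup>+x. f x \<partial>lborel) = ennreal (\<bar>c\<bar> ^ DIM('a)) * (\<integral>\<^sup>+x. f (t + c *\<^sub>R x) \<partial>lborel)"
  by (subst lborel_affine[OF c, of t]) (simp add: nn_integral_density nn_integral_distr nn_integral_cmult)

lemma integral_lborel_affine: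
  fixes t :: "'a::euclidean_space" and f :: "'a \<Rightarrow> real"
  assumes [measurable]: "f \<in> borel_measurable borel" and c: "c \<noteq> 0"
  shows "(LINT x|lborel. f x) = \<bar>c\<bar> ^ DIM('a) * (LINT x|lborel. f (t + c *\<^sub>R x))"
  by (subst lborel_affine[OF c, of t]) (simp add: integral_density integral_distr)

lemma nn_integral_lborel_shift:
  fixes t :: "'a::euclidean_space"
  assumes [measurable]: "f \<in> borel_measurable borel"
  shows "(\<integral>\<^sup>+x. f (x + t) \<partial>lborel) = (\<integral>\<^sup>+x. f x \<partial>lborel)"
  using nn_integral_lborel_affine[of f 1 t] by (simp add: add.commute)

section \<open>Transference from the line to a fixed direction\<close>

definition dir_hilbert :: "real \<Rightarrow> real \<Rightarrow> 'a::euclidean_space \<Rightarrow> ('a \<Rightarrow> real) \<Rightarrow> 'a \<Rightarrow> real" where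
  "dir_hilbert a b w g x = (LINT r|lborel. g (x - r *\<^sub>R w) * trunc_kernel a b r)"

lemma dir_hilbert_measurable [measurable (raw)]:
  fixes g :: "'a::euclidean_space \<Rightarrow> real"
  assumes [measurable]: "g \<in> borel_measurable borel" "a \<in> borel_measurable N" "b \<in> borel_measurable N"
    "w \<in> borel_measurable N" "x \<in> borel_measurable N"
  shows "(\<lambda>z. dir_hilbert (a z) (b z) (w z) g (x z)) \<in> borel_measurable N"
  unfolding dir_hilbert_def by measurable

text \<open>Transference: the average of the translates of \<open>dir_hilbert a b w g\<close> by \<open>s w\<close>, \<open>0 \<le> s \<le> b\<close>, only
  involves the one-dimensional operator on the lines in direction \<open>w\<close>.\<close>

lemma modular_dir_hilbert_le:
  fixes g :: "'a::euclidean_space \<Rightarrow> real"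
  assumes [measurable]: "g \<in> borel_measurable borel" and ab: "0 < a" "a < b"
  shows "modular (dir_hilbert a b w g) \<le> ennreal (108 * hilbert_const) * modular g"
proof -
  let ?C = "ennreal (36 * hilbert_const)"
  let ?T = "dir_hilbert a b w g"
  let ?p = "\<lambda>v::real. ennreal (\<bar>v\<bar> powr (3/2))"
  have b: "0 < b" using ab by simp
  have line: "(\<integral>\<^sup>+s. indicator {0..b} s * ?p (?T (x + s *\<^sub>R w)) \<partial>lborel)
      \<le> ?C * (\<integral>\<^sup>+s. indicator {-b..2*b} s * ?p (g (x + s *\<^sub>R w)) \<partial>lborel)" for x
  proof -
    \<comment> \<open>For 0 <= s <= b and |r| <= b the argument s - r stays in
      \<open>{-b..2*b}\<close>. Cutting \<open>g\<close> off outside this range leaves the operator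
      unchanged for these \<open>s\<close> and makes the function on the line compactly
      supported.\<close>
    define f where "f s = indicator {-b..2*b} s * g (x + s *\<^sub>R w)" for s
    have [measurable]: "f \<in> borel_measurable borel" unfolding f_def[abs_def] by measurable
    have eq: "?T (x + s *\<^sub>R w) = (LINT r|lborel. f (s - r) * trunc_kernel a b r)" if "s \<in> {0..b}" for s
      unfolding dir_hilbert_def
    proof (intro Bochner_Integration.integral_cong refl)
      fix r
      show "g (x + s *\<^sub>R w - r *\<^sub>R w) * trunc_kernel a b r = f (s - r) * trunc_kernel a b r"
      proof (cases "\<bar>r\<bar> \<le> b")
        case True
        then have "s - r \<in> {-b..2*b}" using that by auto
        then show ?thesis by (simp add: f_def scaleR_diff_left algebra_simps)
      qed (simp add: trunc_kernel_def)
    qed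
    have "(\<integral>\<^sup>+s. indicator {0..b} s * ?p (?T (x + s *\<^sub>R w)) \<partial>lborel)
        \<le> modular (\<lambda>s. LINT r|lborel. f (s - r) * trunc_kernel a b r)"
      unfolding modular_def by (intro nn_integral_mono) (auto simp: indicator_def eq)
    also have "\<dots> \<le> ?C * modular f"
      by (rule truncated_hilbert_bound[OF _ _ ab, where A="2*b"]) (auto simp: f_def indicator_def split: if_splits)
    also have "modular f = (\<integral>\<^sup>+s. indicator {-b..2*b} s * ?p (g (x + s *\<^sub>R w)) \<partial>lborel)"
      unfolding modular_def f_def by (intro nn_integral_cong) (auto simp: indicator_def)
    finally show ?thesis .
  qed
  have avg: "(\<integral>\<^sup>+x. \<integral>\<^sup>+s. indicator S s * ?p (h (x + s *\<^sub>R w)) \<partial>lborel \<partial>lborel) = emeasure lborel S * modular h"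
    if [measurable]: "h \<in> borel_measurable borel" "S \<in> sets borel" for h :: "'a \<Rightarrow> real" and S :: "real set"
  proof -
    have "(\<integral>\<^sup>+x. \<integral>\<^sup>+s. indicator S s * ?p (h (x + s *\<^sub>R w)) \<partial>lborel \<partial>lborel)
        = (\<integral>\<^sup>+s. \<integral>\<^sup>+x. indicator S s * ?p (h (x + s *\<^sub>R w)) \<partial>lborel \<partial>lborel)"
      by (rule lborel_pair.Fubini') measurable
    also have "\<dots> = (\<integral>\<^sup>+s. indicator S s * modular h \<partial>lborel)"
    proof (rule nn_integral_cong)
      fix s
      have "(\<integral>\<^sup>+x. indicator S s * ?p (h (x + s *\<^sub>R w)) \<partial>lborel) = indicator S s * (\<integral>\<^sup>+x. ?p (h (x + s *\<^sub>R w)) \<partial>lborel)"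
        by (rule nn_integral_cmult) measurable
      also have "(\<integral>\<^sup>+x. ?p (h (x + s *\<^sub>R w)) \<partial>lborel) = modular h"
        unfolding modular_def real_norm_def by (rule nn_integral_lborel_shift) measurable
      finally show "(\<integral>\<^sup>+x. indicator S s * ?p (h (x + s *\<^sub>R w)) \<partial>lborel) = indicator S s * modular h" .
    qed
    also have "\<dots> = emeasure lborel S * modular h" by (simp add: nn_integral_multc)
    finally show ?thesis .
  qed
  \<comment> \<open>The average runs over an interval of length b on the left and 3 b on the right;
    their quotient 3 turns 36 into 108.\<close>
  have "ennreal b * modular ?T = (\<integral>\<^sup>+x. \<integral>\<^sup>+s. indicator {0..b} s * ?p (?T (x + s *\<^sub>R w)) \<partial>lborel \<partial>lborel)"
    by (subst avg) (use b in auto)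
  also have "\<dots> \<le> (\<integral>\<^sup>+x. ?C * (\<integral>\<^sup>+s. indicator {-b..2*b} s * ?p (g (x + s *\<^sub>R w)) \<partial>lborel) \<partial>lborel)"
    by (intro nn_integral_mono line)
  also have "\<dots> = ?C * (ennreal (3 * b) * modular g)"
    by (subst nn_integral_cmult, measurable) (subst avg, use b in auto)
  also have "\<dots> = ennreal b * (ennreal (108 * hilbert_const) * modular g)"
  proof -
    have "?C * ennreal (3 * b) = ennreal b * ennreal (108 * hilbert_const)"
      using b hilbert_const_nonneg by (simp add: ennreal_mult[symmetric] mult_ac)
    then show ?thesis by (simp only: mult.assoc[symmetric])
  qed
  finally show ?thesis using b by (subst (asm) ennreal_mult_le_mult_iff) auto
qed

section \<open>Averages over directions\<close>

definition annulus :: "'a::euclidean_space set" where "annulus = {w. 1 < norm w \<and> norm w < 2}"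

lemma annulus_measurable [measurable]: "annulus \<in> sets borel"
  unfolding annulus_def by measurable

text \<open>The weight left on \<open>r\<close>, for \<rho> = |y|, by the substitution w = y / r:
  the Jacobian gives |r|^(-3), w_j / r = y_j / r^2 gives the rest, and the condition says that y / r
  lies in the annulus.\<close>

definition rot_density :: "real \<Rightarrow> real \<Rightarrow> real" where
  "rot_density \<rho> r = (if \<bar>r\<bar> < \<rho> \<and> \<rho> < 2 * \<bar>r\<bar> then 1 / \<bar>r\<bar>^5 else 0)"

lemma rot_density_measurable [measurable (raw)]:
  fixes f g :: "'a \<Rightarrow> real"
  assumes [measurable]: "f \<in> borel_measurable N" "g \<in> borel_measurable N"
  shows "(\<lambda>x. rot_density (f x) (g x)) \<in> borel_measurable N"
  unfolding rot_density_def by measurable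

definition rot_const :: real where "rot_const = (LINT r|lborel. rot_density 1 r)"

lemma rot_density_nonneg: "0 \<le> rot_density \<rho> r" by (simp add: rot_density_def)

lemma rot_density_integrable: "integrable lborel (rot_density 1)"
proof (rule Bochner_Integration.integrable_bound)
  show "integrable lborel (\<lambda>r. 32 * indicator {-1..1::real} r :: real)" by simp
  have "rot_density 1 r \<le> 32 * indicator {-1..1} r" for r
  proof (cases "\<bar>r\<bar> < 1 \<and> 1 < 2 * \<bar>r\<bar>")
    case True
    have "(1/2)^5 \<le> \<bar>r\<bar>^5" by (rule power_mono) (use True in auto)
    then have "1 / \<bar>r\<bar>^5 \<le> 1 / (1/2)^5" by (intro divide_left_mono) (use True in auto)
    moreover have "r \<in> {-1..1}" using True by auto
    ultimately show ?thesis using True by (simp add: rot_density_def power_divide)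
  qed (auto simp: rot_density_def)
  then show "AE r in lborel. norm (rot_density 1 r) \<le> norm (32 * indicator {-1..1} r :: real)"
    using rot_density_nonneg[of 1] by (auto intro!: AE_I2)
qed measurable

lemma rot_const_pos: "0 < rot_const"
proof -
  have "(LINT r|lborel. indicator {1/2<..<1::real} r :: real) \<le> rot_const"
    unfolding rot_const_def
  proof (rule integral_mono)
    show "integrable lborel (rot_density 1)" by (rule rot_density_integrable)
    fix r :: real
    show "indicator {1/2<..<1} r \<le> rot_density 1 r"
    proof (cases "r \<in> {1/2<..<1}")
      case True
      then have "\<bar>r\<bar>^5 \<le> 1" by (intro power_le_one) auto
      then show ?thesis using True by (simp add: rot_density_def le_divide_eq)
    qed (simp add: rot_density_nonneg)
  qed (rule integrable_real_indicator, simp, rule emeasure_bounded_finite, simp)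
  then show ?thesis by simp
qed

lemma rot_density_scale:
  assumes "0 < \<rho>"
  shows "rot_density \<rho> (\<rho> * s) = rot_density 1 s / \<rho>^5"
  using assms by (auto simp: rot_density_def abs_mult power_mult_distrib)

text \<open>Homogeneity of degree -4 in \<rho> is what turns the factor \<open>y $ j\<close> into
  the Riesz kernel \<open>y $ j / norm y ^ 4\<close>.\<close>

lemma integral_rot_density:
  assumes \<rho>: "0 < \<rho>"
  shows "(LINT r|lborel. rot_density \<rho> r) = rot_const / \<rho>^4" "integrable lborel (rot_density \<rho>)"
proof -
  have "rot_density \<rho> = (\<lambda>r. rot_density 1 (0 + (1/\<rho>) * r) / \<rho>^5)"
    by (rule ext) (use rot_density_scale[OF \<rho>, of "_ / \<rho>"] \<rho> in simp)
  moreover have "integrable lborel (\<lambda>r. rot_density 1 (0 + (1/\<rho>) * r))"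
    by (rule lborel_integrable_real_affine[OF rot_density_integrable]) (use \<rho> in simp)
  ultimately show "integrable lborel (rot_density \<rho>)" by (metis integrable_divide)
  have "(LINT r|lborel. rot_density \<rho> r) = \<bar>\<rho>\<bar> *\<^sub>R (LINT s|lborel. rot_density \<rho> (0 + \<rho> * s))"
    by (rule lborel_integral_real_affine) (use \<rho> in simp)
  also have "\<dots> = rot_const / \<rho>^4"
    using \<rho> by (simp add: rot_density_scale rot_const_def power_eq_if)
  finally show "(LINT r|lborel. rot_density \<rho> r) = rot_const / \<rho>^4" .
qed

lemma integrable_lborel_pairI:
  fixes f :: "'a::euclidean_space \<times> 'b::euclidean_space \<Rightarrow> real"
  assumes "f \<in> borel_measurable (lborel \<Otimes>\<^sub>M lborel)"
    and "(\<integral>\<^sup>+y. \<integral>\<^sup>+x. ennreal \<bar>f (x, y)\<bar> \<partial>lborel \<partial>lborel) < \<infinity>"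
  shows "integrable (lborel \<Otimes>\<^sub>M lborel) f"
  using assms by (subst integrable_iff_bounded) (auto simp: lborel_pair.nn_integral_snd[symmetric])

definition riesz_annulus :: "3 \<Rightarrow> real \<Rightarrow> real \<Rightarrow> (point \<Rightarrow> real) \<Rightarrow> point \<Rightarrow> real" where
  "riesz_annulus j \<epsilon> M g x =
     (LINT y|lborel. (if \<epsilon> < norm y \<and> norm y \<le> M then y $ j / norm y ^ 4 else 0) * g (x - y))"

text \<open>Method of rotations.  Averaging the one-dimensional kernels over directions in an annulus rather
  than over the sphere makes polar coordinates unnecessary: Fubini's theorem and the substitution
  \<open>w = y / r\<close> suffice.\<close>

lemma method_of_rotations:
  fixes G :: "point \<Rightarrow> real"
  assumes [measurable]: "G \<in> borel_measurable borel"
    and fin: "integrable lborel (\<lambda>y. indicator (cball 0 M) y * G y)" and \<epsilon>: "0 < \<epsilon>"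
  shows "rot_const * (LINT y|lborel. (if \<epsilon> < norm y \<and> norm y \<le> M then y $ j / norm y ^ 4 else 0) * G y)
    = (LINT w|lborel. indicator annulus w * (w $ j * (LINT r|lborel. G (r *\<^sub>R w) * trunc_kernel (\<epsilon> / norm w) (M / norm w) r)))"
proof -
  \<comment> \<open>\<open>K\<close> is the integrand of the averaged line operators in the
    variables w and r; \<open>K'\<close> is the same integrand after w = y / r, Jacobian
    included.\<close>
  define K where "K = (\<lambda>(w::point) r. if 1 < norm w \<and> norm w < 2 \<and> \<epsilon> < \<bar>r\<bar> * norm w \<and> \<bar>r\<bar> * norm w \<le> M
      then w $ j / r * G (r *\<^sub>R w) else 0)"
  define P where "P = (\<lambda>y. if \<epsilon> < norm y \<and> norm y \<le> M then y $ j * G y else 0)"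
  define K' where "K' = (\<lambda>(y::point) r. P y * rot_density (norm y) r)"
  have [measurable]: "case_prod K \<in> borel_measurable (lborel \<Otimes>\<^sub>M lborel)" unfolding K_def by measurable
  have [measurable]: "(\<lambda>y. indicator (cball 0 M) y * G y) \<in> borel_measurable borel"
    using borel_measurable_integrable[OF fin] by simp
  have [measurable]: "P \<in> borel_measurable borel" unfolding P_def by measurable
  have [measurable]: "case_prod K' \<in> borel_measurable (lborel \<Otimes>\<^sub>M lborel)" unfolding K'_def by measurable
  have KK': "\<bar>1 / r\<bar>^3 * K ((1/r) *\<^sub>R y) r = K' y r" if r: "r \<noteq> 0" for y r
  proof -
    have n: "norm ((1/r) *\<^sub>R y) = norm y / \<bar>r\<bar>" by simp
    have c: "1 < norm y / \<bar>r\<bar> \<longleftrightarrow> \<bar>r\<bar> < norm y" "norm y / \<bar>r\<bar> < 2 \<longleftrightarrow> norm y < 2 * \<bar>r\<bar>"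
      "\<bar>r\<bar> * (norm y / \<bar>r\<bar>) = norm y"
      using r by (simp_all add: less_divide_eq divide_less_eq)
    have "\<bar>r\<bar>^5 = \<bar>r\<bar>^3 * (r * r)" by (simp add: power_eq_if)
    then have "\<bar>1/r\<bar>^3 * ((1/r) * y $ j / r * G y) = y $ j * G y * (1 / \<bar>r\<bar>^5)"
      using r by (simp add: power_divide field_simps)
    then show ?thesis
      unfolding K_def K'_def P_def rot_density_def n c using r by simp
  qed
  \<comment> \<open>At r = 0 the substitution breaks down, but both integrands vanish there.\<close>
  have K0: "K w 0 = 0" for w using \<epsilon> by (simp add: K_def)
  have K'0: "K' y 0 = 0" for y by (simp add: K'_def rot_density_def)
  have inner: "(LINT w|lborel. K w r) = (LINT y|lborel. K' y r)" for r
  proof (cases "r = 0")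
    case False
    have "(LINT w|lborel. K w r) = \<bar>1/r\<bar> ^ DIM(point) * (LINT y|lborel. K (0 + (1/r) *\<^sub>R y) r)"
      by (rule integral_lborel_affine) (use False in auto)
    also have "\<dots> = (LINT y|lborel. \<bar>1/r\<bar>^3 * K ((1/r) *\<^sub>R y) r)" by simp
    finally show ?thesis unfolding KK'[OF False] .
  qed (simp add: K0 K'0)
  have nn_inner: "(\<integral>\<^sup>+w. ennreal \<bar>K w r\<bar> \<partial>lborel) = (\<integral>\<^sup>+y. ennreal \<bar>K' y r\<bar> \<partial>lborel)" for r
  proof (cases "r = 0")
    case False
    have "(\<integral>\<^sup>+w. ennreal \<bar>K w r\<bar> \<partial>lborel) = ennreal (\<bar>1/r\<bar> ^ DIM(point)) * (\<integral>\<^sup>+y. ennreal \<bar>K (0 + (1/r) *\<^sub>R y) r\<bar> \<partial>lborel)"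
      by (rule nn_integral_lborel_affine) (use False in auto)
    also have "\<dots> = (\<integral>\<^sup>+y. ennreal (\<bar>1/r\<bar>^3) * ennreal \<bar>K ((1/r) *\<^sub>R y) r\<bar> \<partial>lborel)"
      by (subst nn_integral_cmult) auto
    also have "\<dots> = (\<integral>\<^sup>+y. ennreal \<bar>\<bar>1/r\<bar>^3 * K ((1/r) *\<^sub>R y) r\<bar> \<partial>lborel)"
      by (intro nn_integral_cong) (simp add: abs_mult ennreal_mult)
    finally show ?thesis unfolding KK'[OF False] .
  qed (simp add: K0 K'0)
  \<comment> \<open>For |y| > \<epsilon> the factor |y_j| / |y|^4 is at most \<epsilon>^(-3), so the
    absolute integrability that Fubini needs reduces to that of G on the ball of radius M.\<close>
  have finK': "(\<integral>\<^sup>+y. \<integral>\<^sup>+r. ennreal \<bar>K' y r\<bar> \<partial>lborel \<partial>lborel) < \<infinity>"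
  proof -
    have "(\<integral>\<^sup>+y. \<integral>\<^sup>+r. ennreal \<bar>K' y r\<bar> \<partial>lborel \<partial>lborel)
        \<le> (\<integral>\<^sup>+y. ennreal (rot_const / \<epsilon>^3) * ennreal (norm (indicator (cball 0 M) y * G y)) \<partial>lborel)"
    proof (rule nn_integral_mono)
      fix y :: point
      show "(\<integral>\<^sup>+r. ennreal \<bar>K' y r\<bar> \<partial>lborel) \<le> ennreal (rot_const / \<epsilon>^3) * ennreal (norm (indicator (cball 0 M) y * G y))"
      proof (cases "\<epsilon> < norm y \<and> norm y \<le> M")
        case False
        then show ?thesis by (auto simp: K'_def P_def)
      next
        case True
        then have y: "0 < norm y" using \<epsilon> by linarith
        have "(\<integral>\<^sup>+r. ennreal \<bar>K' y r\<bar> \<partial>lborel) = (\<integral>\<^sup>+r. ennreal \<bar>P y\<bar> * ennreal (rot_density (norm y) r) \<partial>lborel)"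
          by (intro nn_integral_cong) (simp add: K'_def abs_mult ennreal_mult rot_density_nonneg)
        also have "\<dots> = ennreal \<bar>P y\<bar> * ennreal (LINT r|lborel. rot_density (norm y) r)"
          by (subst nn_integral_cmult, measurable)
             (simp add: nn_integral_eq_integral[OF integral_rot_density(2)[OF y]] rot_density_nonneg)
        also have "\<dots> = ennreal (\<bar>P y\<bar> * (rot_const / norm y ^ 4))"
          unfolding integral_rot_density(1)[OF y] using rot_const_pos by (simp add: ennreal_mult[symmetric])
        also have "\<dots> \<le> ennreal ((rot_const / \<epsilon>^3) * norm (indicator (cball 0 M) y * G y))"
        proof (rule ennreal_leI)
          have "\<bar>P y\<bar> * (rot_const / norm y ^ 4) = \<bar>G y\<bar> * rot_const * (\<bar>y $ j\<bar> / norm y ^ 4)"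
            using True by (simp add: P_def abs_mult)
          also have "\<dots> \<le> \<bar>G y\<bar> * rot_const * (1 / \<epsilon>^3)"
          proof (intro mult_left_mono)
            have "\<bar>y $ j\<bar> / norm y ^ 4 \<le> norm y / norm y ^ 4"
              by (intro divide_right_mono component_le_norm_cart) auto
            also have "\<dots> = 1 / norm y ^ 3" using y by (simp add: power_eq_if)
            also have "\<dots> \<le> 1 / \<epsilon>^3" using True \<epsilon> y by (intro divide_left_mono power_mono) auto
            finally show "\<bar>y $ j\<bar> / norm y ^ 4 \<le> 1 / \<epsilon>^3" .
          qed (use rot_const_pos in auto)
          finally show "\<bar>P y\<bar> * (rot_const / norm y ^ 4) \<le> (rot_const / \<epsilon>^3) * norm (indicator (cball 0 M) y * G y)"
            using True by (simp add: mult_ac)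
        qed
        also have "\<dots> = ennreal (rot_const / \<epsilon>^3) * ennreal (norm (indicator (cball 0 M) y * G y))"
          by (rule ennreal_mult) (use rot_const_pos \<epsilon> in auto)
        finally show ?thesis .
      qed
    qed
    also have "\<dots> = ennreal (rot_const / \<epsilon>^3) * (\<integral>\<^sup>+y. ennreal (norm (indicator (cball 0 M) y * G y)) \<partial>lborel)"
      by (rule nn_integral_cmult) measurable
    also have "\<dots> < \<infinity>"
      using fin by (simp add: integrable_iff_bounded ennreal_mult_less_top)
    finally show ?thesis .
  qed
  have finK'2: "(\<integral>\<^sup>+r. \<integral>\<^sup>+y. ennreal \<bar>K' y r\<bar> \<partial>lborel \<partial>lborel) < \<infinity>"
    using finK' by (subst lborel_pair.Fubini') auto
  have intK: "integrable (lborel \<Otimes>\<^sub>M lborel) (case_prod K)"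
    by (rule integrable_lborel_pairI) (use finK'2 in \<open>auto simp: nn_inner\<close>)
  have intK': "integrable (lborel \<Otimes>\<^sub>M lborel) (case_prod K')"
    by (rule integrable_lborel_pairI) (use finK'2 in auto)
  have "(LINT w|lborel. indicator annulus w * (w $ j * (LINT r|lborel. G (r *\<^sub>R w) * trunc_kernel (\<epsilon> / norm w) (M / norm w) r)))
      = (LINT w|lborel. LINT r|lborel. K w r)"
  proof (intro Bochner_Integration.integral_cong refl)
    fix w :: point
    show "indicator annulus w * (w $ j * (LINT r|lborel. G (r *\<^sub>R w) * trunc_kernel (\<epsilon> / norm w) (M / norm w) r)) = (LINT r|lborel. K w r)"
    proof (cases "w \<in> annulus")
      case True
      then have w: "1 < norm w" "norm w < 2" by (auto simp: annulus_def)
      then have "0 < norm w" by linarith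
      then have "w $ j * (G (r *\<^sub>R w) * trunc_kernel (\<epsilon> / norm w) (M / norm w) r) = K w r" for r
        using w by (simp add: K_def trunc_kernel_def divide_less_eq le_divide_eq)
      then have "w $ j * (LINT r|lborel. G (r *\<^sub>R w) * trunc_kernel (\<epsilon> / norm w) (M / norm w) r) = (LINT r|lborel. K w r)"
        by (subst integral_mult_right_zero[symmetric]) simp
      with True show ?thesis by simp
    qed (auto simp: K_def annulus_def)
  qed
  also have "\<dots> = (LINT r|lborel. LINT w|lborel. K w r)" by (rule lborel_pair.Fubini_integral[OF intK, symmetric])
  also have "\<dots> = (LINT r|lborel. LINT y|lborel. K' y r)" by (simp only: inner)
  also have "\<dots> = (LINT y|lborel. LINT r|lborel. K' y r)" by (rule lborel_pair.Fubini_integral[OF intK'])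
  also have "\<dots> = (LINT y|lborel. rot_const * ((if \<epsilon> < norm y \<and> norm y \<le> M then y $ j / norm y ^ 4 else 0) * G y))"
  proof (intro Bochner_Integration.integral_cong refl)
    fix y :: point
    show "(LINT r|lborel. K' y r) = rot_const * ((if \<epsilon> < norm y \<and> norm y \<le> M then y $ j / norm y ^ 4 else 0) * G y)"
    proof (cases "\<epsilon> < norm y \<and> norm y \<le> M")
      case True
      then have y: "0 < norm y" using \<epsilon> by linarith
      then show ?thesis using True by (simp add: K'_def P_def integral_rot_density(1))
    qed (auto simp: K'_def P_def)
  qed
  finally show ?thesis by simp
qed

section \<open>Bounds in three dimensions, uniform in the radii\<close>

lemma modular_Fatou:
  fixes f :: "nat \<Rightarrow> 'a::euclidean_space \<Rightarrow> real"
  assumes [measurable]: "\<And>n. f n \<in> borel_measurable borel"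
    and lim: "AE x in lborel. (\<lambda>n. f n x) \<longlonglongrightarrow> h x"
    and le: "\<forall>\<^sub>F n in sequentially. modular (f n) \<le> B"
  shows "modular h \<le> B"
proof -
  have "modular h = (\<integral>\<^sup>+x. liminf (\<lambda>n. ennreal (norm (f n x) powr (3/2))) \<partial>lborel)"
    unfolding modular_def
  proof (rule nn_integral_cong_AE)
    show "AE x in lborel. ennreal (norm (h x) powr (3/2)) = liminf (\<lambda>n. ennreal (norm (f n x) powr (3/2)))"
      using lim
    proof eventually_elim
      case (elim x)
      have "(\<lambda>n. ennreal (norm (f n x) powr (3/2))) \<longlonglongrightarrow> ennreal (norm (h x) powr (3/2))"
        by (intro tendsto_ennrealI tendsto_powr' tendsto_norm elim tendsto_const) auto
      then show ?case by (rule lim_imp_Liminf[OF trivial_limit_sequentially, symmetric])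
    qed
  qed
  also have "\<dots> \<le> liminf (\<lambda>n. modular (f n))"
    unfolding modular_def by (rule nn_integral_liminf) measurable
  also have "\<dots> \<le> B"
    using Liminf_mono[OF le] by (simp add: Liminf_const)
  finally show ?thesis .
qed

lemma modular_shift:
  fixes f :: "'a::euclidean_space \<Rightarrow> real"
  assumes [measurable]: "f \<in> borel_measurable borel"
  shows "modular (\<lambda>y. f (x - y)) = modular f"
proof -
  have "modular f = (\<integral>\<^sup>+y. ennreal (norm (f (x + (-1) *\<^sub>R y)) powr (3/2)) \<partial>lborel)"
    unfolding modular_def by (subst nn_integral_lborel_affine[of _ "-1" x]) auto
  then show ?thesis by (simp add: modular_def)
qed

lemma modular_finite_imp_local_integrable:
  fixes g :: "'a::euclidean_space \<Rightarrow> real"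
  assumes [measurable]: "g \<in> borel_measurable borel" and fin: "modular g < \<infinity>"
  shows "integrable lborel (\<lambda>y. indicator (cball 0 M) y * g (x - y))"
proof (rule modular_finite_imp_integrable)
  have "modular (\<lambda>y. indicator (cball 0 M) y * g (x - y)) \<le> modular (\<lambda>y. g (x - y))"
    by (rule modular_mono) (auto simp: indicator_def)
  then show "modular (\<lambda>y. indicator (cball 0 M) y * g (x - y)) < \<infinity>"
    using fin by (simp add: modular_shift le_less_trans)
  show "emeasure lborel (cball 0 M :: 'a set) < \<infinity>" by (rule emeasure_bounded_finite) simp
qed (auto simp: indicator_def split: if_splits)

lemma annulus_emeasure_finite: "emeasure lborel (annulus :: 'a::euclidean_space set) < \<infinity>"
proof (rule emeasure_bounded_finite)
  have "annulus \<subseteq> (ball 0 2 :: 'a set)" by (auto simp: annulus_def)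
  then show "bounded (annulus :: 'a set)" using bounded_ball bounded_subset by blast
qed

text \<open>The summand 1 makes positivity, which the weighted inequality asks of its mass bound,
  immediate without computing a volume.\<close>

definition ann_mass :: real where "ann_mass = measure lborel (annulus :: point set) + 1"

lemma ann_mass_pos: "0 < ann_mass" by (simp add: ann_mass_def add_nonneg_pos)

lemma ann_mass: "(\<integral>\<^sup>+w. ennreal (indicator (annulus :: point set) w) \<partial>lborel) \<le> ennreal ann_mass"
proof -
  have "(\<integral>\<^sup>+w. ennreal (indicator (annulus :: point set) w) \<partial>lborel) = emeasure lborel (annulus :: point set)"
    by (simp add: ennreal_indicator)
  also have "\<dots> = ennreal (measure lborel (annulus :: point set))"
    using annulus_emeasure_finite[where 'a = point] by (intro emeasure_eq_ennreal_measure) auto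
  also have "\<dots> \<le> ennreal ann_mass" by (rule ennreal_leI) (simp add: ann_mass_def)
  finally show ?thesis .
qed

text \<open>From left to right: the normalisation of the rotations, the weighted inequality with
  mass \<open>ann_mass\<close>, the integral over the annulus, the bound 3 for |w_j|^(3/2), and the
  transference constant.\<close>

definition riesz_const :: real where
  "riesz_const = (1 / rot_const) powr (3/2) * (3 * sqrt ann_mass * (ann_mass * (3 * (108 * hilbert_const))))"

lemma riesz_const_nonneg: "0 \<le> riesz_const"
  using ann_mass_pos hilbert_const_nonneg by (simp add: riesz_const_def)

text \<open>The directions are not unit vectors: |r w| = |r| |w|, so the radii on each line are
  divided by |w|.\<close>

lemma rotations_riesz_annulus:
  assumes [measurable]: "g \<in> borel_measurable borel" and fin: "modular g < \<infinity>" and \<epsilon>: "0 < \<epsilon>"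
  shows "riesz_annulus j \<epsilon> M g x
    = 1 / rot_const * (LINT w|lborel. indicator annulus w * (w $ j * dir_hilbert (\<epsilon> / norm w) (M / norm w) w g x))"
  using method_of_rotations[OF _ modular_finite_imp_local_integrable[OF assms(1) fin, of M x] \<epsilon>, of j] rot_const_pos
  by (simp add: riesz_annulus_def dir_hilbert_def field_simps)

lemma riesz_annulus_measurable [measurable (raw)]:
  fixes g :: "'b \<Rightarrow> point \<Rightarrow> real"
  assumes [measurable]: "case_prod g \<in> borel_measurable (N \<Otimes>\<^sub>M borel)" "x \<in> borel_measurable N"
  shows "(\<lambda>z. riesz_annulus j \<epsilon> M (g z) (x z)) \<in> borel_measurable N"
  unfolding riesz_annulus_def by measurable

text \<open>The weighted inequality moves the power 3/2 inside the average over directions; after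
  Tonelli each direction is bounded by transference, whose constant depends neither on the direction
  nor on the radii.\<close>

lemma modular_riesz_annulus_le:
  assumes [measurable]: "g \<in> borel_measurable borel" and fin: "modular g < \<infinity>" and \<epsilon>: "0 < \<epsilon>" "\<epsilon> < M"
  shows "modular (riesz_annulus j \<epsilon> M g) \<le> ennreal riesz_const * modular g"
proof -
  define T where "T = (\<lambda>w::point. dir_hilbert (\<epsilon> / norm w) (M / norm w) w g)"
  have [measurable]: "case_prod T \<in> borel_measurable (lborel \<Otimes>\<^sub>M lborel)" unfolding T_def by measurable
  let ?A = "annulus :: point set" and ?p = "\<lambda>v::real. ennreal (\<bar>v\<bar> powr (3/2))"
  let ?m = ann_mass and ?R = "ennreal ((1 / rot_const) powr (3/2))"
  have "modular (riesz_annulus j \<epsilon> M g) \<le>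
      (\<integral>\<^sup>+x. ?R * (ennreal (3 * sqrt ?m) * (\<integral>\<^sup>+w. ennreal (indicator ?A w) * ?p (w $ j * T w x) \<partial>lborel)) \<partial>lborel)"
    unfolding modular_def
  proof (rule nn_integral_mono)
    fix x
    have "norm (riesz_annulus j \<epsilon> M g x) powr (3/2)
        = (1 / rot_const) powr (3/2) * \<bar>LINT w|lborel. indicator ?A w * (w $ j * T w x)\<bar> powr (3/2)"
      unfolding rotations_riesz_annulus[OF assms(1) fin \<epsilon>(1)] T_def using rot_const_pos
      by (simp only: real_norm_def abs_mult) (subst powr_mult, auto)
    then have "ennreal (norm (riesz_annulus j \<epsilon> M g x) powr (3/2))
        = ?R * ?p (LINT w|lborel. indicator ?A w * (w $ j * T w x))"
      by (simp only:) (rule ennreal_mult, auto)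
    also have "\<dots> \<le> ?R * (ennreal (3 * sqrt ?m) * (\<integral>\<^sup>+w. ennreal (indicator ?A w) * ?p (w $ j * T w x) \<partial>lborel))"
      by (intro mult_left_mono powr_three_halves_weighted_integral_le ann_mass ann_mass_pos) auto
    finally show "ennreal (norm (riesz_annulus j \<epsilon> M g x) powr (3/2))
       \<le> ?R * (ennreal (3 * sqrt ?m) * (\<integral>\<^sup>+w. ennreal (indicator ?A w) * ?p (w $ j * T w x) \<partial>lborel))" .
  qed
  also have "\<dots> = ?R * (ennreal (3 * sqrt ?m) * (\<integral>\<^sup>+x. \<integral>\<^sup>+w. ennreal (indicator ?A w) * ?p (w $ j * T w x) \<partial>lborel \<partial>lborel))"
    by (subst nn_integral_cmult, measurable, subst nn_integral_cmult, measurable)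
  also have "(\<integral>\<^sup>+x. \<integral>\<^sup>+w. ennreal (indicator ?A w) * ?p (w $ j * T w x) \<partial>lborel \<partial>lborel)
      = (\<integral>\<^sup>+w. \<integral>\<^sup>+x. ennreal (indicator ?A w) * ?p (w $ j * T w x) \<partial>lborel \<partial>lborel)"
    by (rule lborel_pair.Fubini') measurable
  also have "\<dots> \<le> (\<integral>\<^sup>+w. ennreal (indicator ?A w) * (3 * (ennreal (108 * hilbert_const) * modular g)) \<partial>lborel)"
  proof (rule nn_integral_mono)
    fix w :: point
    show "(\<integral>\<^sup>+x. ennreal (indicator ?A w) * ?p (w $ j * T w x) \<partial>lborel) \<le> ennreal (indicator ?A w) * (3 * (ennreal (108 * hilbert_const) * modular g))"
    proof (cases "w \<in> ?A")
      case True
      then have w: "0 < norm w" "norm w < 2" by (auto simp: annulus_def)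
      have wj: "\<bar>w $ j\<bar> powr (3/2) \<le> 3"
      proof -
        have "\<bar>w $ j\<bar> powr (3/2) \<le> 2 powr (3/2)"
          using component_le_norm_cart[of w j] w by (intro powr_mono2) auto
        then show ?thesis using two_powr_three_halves_le by linarith
      qed
      have "(\<integral>\<^sup>+x. ennreal (indicator ?A w) * ?p (w $ j * T w x) \<partial>lborel) = modular (\<lambda>x. w $ j * T w x)"
        using True by (simp add: modular_def)
      also have "\<dots> = ennreal (\<bar>w $ j\<bar> powr (3/2)) * modular (T w)"
        by (rule modular_cmult) measurable
      also have "\<dots> \<le> 3 * (ennreal (108 * hilbert_const) * modular g)"
      proof (rule mult_mono)
        show "ennreal (\<bar>w $ j\<bar> powr (3/2)) \<le> 3" using ennreal_leI[OF wj] by simp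
        show "modular (T w) \<le> ennreal (108 * hilbert_const) * modular g"
          unfolding T_def by (rule modular_dir_hilbert_le) (use \<epsilon> w in \<open>auto intro!: divide_strict_right_mono\<close>)
      qed auto
      finally show ?thesis using True by simp
    qed simp
  qed
  also have "\<dots> = (\<integral>\<^sup>+w. ennreal (indicator ?A w) \<partial>lborel) * (3 * (ennreal (108 * hilbert_const) * modular g))"
    by (rule nn_integral_multc) measurable
  also have "\<dots> \<le> ennreal ?m * (3 * (ennreal (108 * hilbert_const) * modular g))"
    by (intro mult_right_mono ann_mass) auto
  also have "?R * (ennreal (3 * sqrt ?m) * (ennreal ?m * (3 * (ennreal (108 * hilbert_const) * modular g)))) = ennreal riesz_const * modular g"
  proof -
    have "ennreal riesz_const = ?R * (ennreal (3 * sqrt ?m) * (ennreal ?m * (ennreal 3 * ennreal (108 * hilbert_const))))"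
      unfolding riesz_const_def using ann_mass_pos hilbert_const_nonneg
      by (subst ennreal_mult, simp, simp)+ simp
    then show ?thesis by (simp add: mult.assoc)
  qed
  finally show ?thesis by (simp add: mult_left_mono)
qed

text \<open>The power 9 is |y|^(-3) raised to 3, the exponent dual to 3/2. A layer-cake
  representation replaces polar coordinates: |y|^(-9) is the integral of 9 s^(-10) over s >= |y|,
  and exchanging the integrals brings in the volume of a ball, so that s^(-7) remains.\<close>

lemma riesz_kernel_tail_integrable:
  assumes \<epsilon>: "0 < \<epsilon>"
  shows "(\<integral>\<^sup>+(y::point). indicator {y. \<epsilon> < norm y} y * ennreal (1 / norm y ^ 9) \<partial>lborel) < \<infinity>"
proof -
  have tail: "(\<integral>\<^sup>+s. ennreal (real k / s ^ (k + 1)) * indicator {a..} s \<partial>lborel) = ennreal (1 / a ^ k)"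
    if a: "0 < a" and k: "0 < k" for a :: real and k :: nat
  proof -
    have "(\<integral>\<^sup>+s. ennreal (real k / s ^ (k + 1)) * indicator {a..} s \<partial>lborel) = ennreal (0 - (- (1 / a ^ k)))"
    proof (rule nn_integral_FTC_atLeast[where F = "\<lambda>s. - (1 / s ^ k)"])
      fix s assume s: "a \<le> s"
      then have "s \<noteq> 0" using a by auto
      have "s ^ k = s ^ (k - 1) * s" using k by (metis power_minus_mult)
      then show "((\<lambda>s. - (1 / s ^ k)) has_real_derivative real k / s ^ (k + 1)) (at s)"
        using \<open>s \<noteq> 0\<close> k by (auto intro!: derivative_eq_intros simp: field_simps)
      show "0 \<le> real k / s ^ (k + 1)" using s a by simp
    next
      have "((\<lambda>s::real. - (1 / s ^ k)) \<longlongrightarrow> - 0) at_top"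
        using k by (intro tendsto_minus tendsto_divide_0[OF tendsto_const] filterlim_at_top_imp_at_infinity filterlim_pow_at_top filterlim_ident)
      then show "((\<lambda>s::real. - (1 / s ^ k)) \<longlongrightarrow> 0) at_top" by simp
    qed auto
    then show ?thesis by simp
  qed
  let ?V = "unit_ball_vol 3"
  have "(\<integral>\<^sup>+(y::point). indicator {y. \<epsilon> < norm y} y * ennreal (1 / norm y ^ 9) \<partial>lborel)
      \<le> (\<integral>\<^sup>+(y::point). \<integral>\<^sup>+s. ennreal (9 / s ^ 10) * indicator {\<epsilon>..} s * indicator (cball 0 s) y \<partial>lborel \<partial>lborel)"
  proof (rule nn_integral_mono)
    fix y :: point
    show "indicator {y. \<epsilon> < norm y} y * ennreal (1 / norm y ^ 9)
      \<le> (\<integral>\<^sup>+s. ennreal (9 / s ^ 10) * indicator {\<epsilon>..} s * indicator (cball 0 s) y \<partial>lborel)"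
    proof (cases "\<epsilon> < norm y")
      case True
      have "ennreal (1 / norm y ^ 9) = (\<integral>\<^sup>+s. ennreal (9 / s ^ 10) * indicator {norm y..} s \<partial>lborel)"
        using tail[OF less_trans[OF \<epsilon> True], of 9] by simp
      also have "\<dots> \<le> (\<integral>\<^sup>+s. ennreal (9 / s ^ 10) * indicator {\<epsilon>..} s * indicator (cball 0 s) y \<partial>lborel)"
        using True by (intro nn_integral_mono) (auto simp: indicator_def)
      finally show ?thesis using True by simp
    qed simp
  qed
  also have "\<dots> = (\<integral>\<^sup>+s. \<integral>\<^sup>+(y::point). ennreal (9 / s ^ 10) * indicator {\<epsilon>..} s * indicator (cball 0 s) y \<partial>lborel \<partial>lborel)"
  proof (rule lborel_pair.Fubini')
    have "(\<lambda>(s, y::point). ennreal (9 / s ^ 10) * indicator {\<epsilon>..} s * (if norm y \<le> s then 1 else 0)) \<in> borel_measurable (lborel \<Otimes>\<^sub>M lborel)"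
      by measurable
    then show "(\<lambda>(s, y::point). ennreal (9 / s ^ 10) * indicator {\<epsilon>..} s * indicator (cball 0 s) y) \<in> borel_measurable (lborel \<Otimes>\<^sub>M lborel)"
      by (simp add: indicator_def)
  qed
  also have "\<dots> = (\<integral>\<^sup>+s. ennreal (9 * ?V / 6) * (ennreal (real 6 / s ^ (6 + 1)) * indicator {\<epsilon>..} s) \<partial>lborel)"
  proof (rule nn_integral_cong)
    fix s :: real
    show "(\<integral>\<^sup>+(y::point). ennreal (9 / s ^ 10) * indicator {\<epsilon>..} s * indicator (cball 0 s) y \<partial>lborel)
        = ennreal (9 * ?V / 6) * (ennreal (real 6 / s ^ (6 + 1)) * indicator {\<epsilon>..} s)"
    proof (cases "\<epsilon> \<le> s")
      case True
      then have s: "0 < s" using \<epsilon> by simp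
      have "(\<integral>\<^sup>+(y::point). ennreal (9 / s ^ 10) * indicator {\<epsilon>..} s * indicator (cball 0 s) y \<partial>lborel)
          = ennreal (9 / s ^ 10) * emeasure lborel (cball (0::point) s)"
        using True by (simp add: nn_integral_cmult_indicator)
      also have "\<dots> = ennreal (9 / s ^ 10 * (?V * s ^ 3))"
        using s by (subst emeasure_cball) (auto simp: ennreal_mult'[symmetric])
      also have "9 / s ^ 10 * (?V * s ^ 3) = (9 * ?V / 6) * (real 6 / s ^ (6 + 1))"
        using s by (simp add: field_simps power_eq_if)
      also have "ennreal \<dots> = ennreal (9 * ?V / 6) * ennreal (real 6 / s ^ (6 + 1))"
        using s by (intro ennreal_mult) auto
      finally show ?thesis using True by simp
    qed simp
  qed
  also have "\<dots> = ennreal (9 * ?V / 6) * ennreal (1 / \<epsilon> ^ 6)"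
    by (subst nn_integral_cmult) (use tail[of \<epsilon> 6] \<epsilon> in auto)
  also have "\<dots> < \<infinity>" by (simp add: ennreal_mult_less_top)
  finally show ?thesis .
qed

text \<open>By the Young-type inequality a b <= a^3 + b^(3/2) with a = |y|^(-3) and b = |g (x - y)|.
  The truncated integrals thus converge absolutely at every point, and linearity never meets the
  default value of a divergent integral.\<close>

lemma riesz_trunc_integrable:
  assumes [measurable]: "g \<in> borel_measurable borel" and fin: "modular g < \<infinity>" and \<epsilon>: "0 < \<epsilon>"
  shows "integrable lborel (\<lambda>y::point. indicator {y. \<epsilon> < norm y} y * (y $ j / norm y ^ 4 * g (x - y)))"
  unfolding integrable_iff_bounded
proof
  have "(\<integral>\<^sup>+(y::point). ennreal (norm (indicator {y. \<epsilon> < norm y} y * (y $ j / norm y ^ 4 * g (x - y)))) \<partial>lborel)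
     \<le> (\<integral>\<^sup>+y. indicator {y. \<epsilon> < norm y} y * ennreal (1 / norm y ^ 9) + ennreal (norm (g (x - y)) powr (3/2)) \<partial>lborel)"
  proof (rule nn_integral_mono)
    fix y :: point
    show "ennreal (norm (indicator {y. \<epsilon> < norm y} y * (y $ j / norm y ^ 4 * g (x - y))))
      \<le> indicator {y. \<epsilon> < norm y} y * ennreal (1 / norm y ^ 9) + ennreal (norm (g (x - y)) powr (3/2))"
    proof (cases "\<epsilon> < norm y")
      case True
      then have y: "0 < norm y" using \<epsilon> by linarith
      define a where "a = 1 / norm y ^ 3"
      define b where "b = \<bar>g (x - y)\<bar>"
      have ab: "0 \<le> a" "0 \<le> b" by (auto simp: a_def b_def)
      have young: "a * b \<le> a ^ 3 + b powr (3/2)"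
      proof (cases "b \<le> a\<^sup>2")
        case True
        then have "a * b \<le> a * a\<^sup>2" using ab by (intro mult_left_mono) auto
        moreover have "0 \<le> b powr (3/2)" "a ^ 3 = a * a\<^sup>2" by (simp_all add: power_eq_if)
        ultimately show ?thesis by linarith
      next
        case False
        then have "a \<le> sqrt b" by (intro real_le_rsqrt) auto
        then have "a * b \<le> sqrt b * b" using ab by (intro mult_right_mono) auto
        then show ?thesis using ab by (simp add: powr_three_halves add_increasing mult.commute)
      qed
      have "\<bar>y $ j\<bar> / norm y ^ 4 \<le> norm y / norm y ^ 4"
        by (intro divide_right_mono component_le_norm_cart) auto
      also have "\<dots> = a" using y by (simp add: a_def power_eq_if)
      finally have "norm (y $ j / norm y ^ 4 * g (x - y)) \<le> a * b"
        unfolding b_def using mult_right_mono[of "\<bar>y $ j\<bar> / norm y ^ 4" a "\<bar>g (x - y)\<bar>"] by (simp add: abs_mult)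
      also have "\<dots> \<le> 1 / norm y ^ 9 + norm (g (x - y)) powr (3/2)"
        using young by (simp add: a_def b_def power_divide power_mult[symmetric])
      finally have "ennreal (norm (y $ j / norm y ^ 4 * g (x - y))) \<le> ennreal (1 / norm y ^ 9 + norm (g (x - y)) powr (3/2))"
        by (rule ennreal_leI)
      then show ?thesis using True by simp
    qed simp
  qed
  also have "\<dots> = (\<integral>\<^sup>+(y::point). indicator {y. \<epsilon> < norm y} y * ennreal (1 / norm y ^ 9) \<partial>lborel) + modular (\<lambda>y. g (x - y))"
    unfolding modular_def by (rule nn_integral_add) measurable
  also have "\<dots> < \<infinity>" using riesz_kernel_tail_integrable[OF \<epsilon>] fin by (simp add: modular_shift)
  finally show "(\<integral>\<^sup>+(y::point). ennreal (norm (indicator {y. \<epsilon> < norm y} y * (y $ j / norm y ^ 4 * g (x - y)))) \<partial>lborel) < \<infinity>" .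
qed measurable

lemma riesz_trunc_measurable [measurable (raw)]:
  fixes g :: "'b \<Rightarrow> point \<Rightarrow> real"
  assumes [measurable]: "case_prod g \<in> borel_measurable (N \<Otimes>\<^sub>M borel)" "x \<in> borel_measurable N"
  shows "(\<lambda>z. riesz_trunc j \<epsilon> (g z) (x z)) \<in> borel_measurable N"
  unfolding riesz_trunc_def set_lebesgue_integral_def by measurable

lemma riesz_trunc_diff_radius:
  assumes [measurable]: "g \<in> borel_measurable borel" and fin: "modular g < \<infinity>" and \<epsilon>: "0 < \<epsilon>" "\<epsilon> < \<delta>"
  shows "riesz_trunc j \<epsilon> g x - riesz_trunc j \<delta> g x = 1 / pi\<^sup>2 * riesz_annulus j \<epsilon> \<delta> g x"
proof -
  have \<delta>: "0 < \<delta>" using \<epsilon> by simp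
  have "riesz_annulus j \<epsilon> \<delta> g x = (LINT y|lborel. indicator {y. \<epsilon> < norm y} y * (y $ j / norm y ^ 4 * g (x - y))
         - indicator {y. \<delta> < norm y} y * (y $ j / norm y ^ 4 * g (x - y)))"
    unfolding riesz_annulus_def using \<epsilon> by (intro Bochner_Integration.integral_cong refl) (auto simp: indicator_def)
  also have "\<dots> = (LINT y|lborel. indicator {y. \<epsilon> < norm y} y * (y $ j / norm y ^ 4 * g (x - y)))
      - (LINT y|lborel. indicator {y. \<delta> < norm y} y * (y $ j / norm y ^ 4 * g (x - y)))"
    by (rule Bochner_Integration.integral_diff[OF riesz_trunc_integrable[OF assms(1) fin \<epsilon>(1)] riesz_trunc_integrable[OF assms(1) fin \<delta>]])
  finally show ?thesis
    unfolding riesz_trunc_def set_lebesgue_integral_def real_scaleR_def by (simp add: right_diff_distrib)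
qed

lemma riesz_trunc_diff:
  assumes [measurable]: "g \<in> borel_measurable borel" "h \<in> borel_measurable borel"
    and fin: "modular g < \<infinity>" "modular h < \<infinity>" and \<epsilon>: "0 < \<epsilon>"
  shows "riesz_trunc j \<epsilon> (\<lambda>y. g y - h y) x = riesz_trunc j \<epsilon> g x - riesz_trunc j \<epsilon> h x"
proof -
  have "(LINT y|lborel. indicator {y. \<epsilon> < norm y} y * (y $ j / norm y ^ 4 * (g (x - y) - h (x - y))))
    = (LINT y|lborel. indicator {y. \<epsilon> < norm y} y * (y $ j / norm y ^ 4 * g (x - y)) - indicator {y. \<epsilon> < norm y} y * (y $ j / norm y ^ 4 * h (x - y)))"
    by (simp only: right_diff_distrib)
  also have "\<dots> = (LINT y|lborel. indicator {y. \<epsilon> < norm y} y * (y $ j / norm y ^ 4 * g (x - y)))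
      - (LINT y|lborel. indicator {y. \<epsilon> < norm y} y * (y $ j / norm y ^ 4 * h (x - y)))"
    by (rule Bochner_Integration.integral_diff[OF riesz_trunc_integrable[OF assms(1) fin(1) \<epsilon>] riesz_trunc_integrable[OF assms(2) fin(2) \<epsilon>]])
  finally show ?thesis
    unfolding riesz_trunc_def set_lebesgue_integral_def real_scaleR_def by (simp add: right_diff_distrib)
qed

lemma inverse_pi_square_le_1: "1 / pi\<^sup>2 \<le> 1"
proof -
  have "1 \<le> pi\<^sup>2" using pi_gt3 by (intro one_le_power) auto
  then show ?thesis by (simp add: divide_le_eq)
qed

lemma modular_riesz_trunc_diff_radius_le:
  assumes [measurable]: "g \<in> borel_measurable borel" and fin: "modular g < \<infinity>" and \<epsilon>: "0 < \<epsilon>" "0 < \<delta>"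
  shows "modular (\<lambda>x. riesz_trunc j \<epsilon> g x - riesz_trunc j \<delta> g x) \<le> ennreal riesz_const * modular g"
proof -
  have *: "modular (\<lambda>x. riesz_trunc j \<epsilon> g x - riesz_trunc j \<delta> g x) \<le> ennreal riesz_const * modular g"
    if "0 < \<epsilon>" "\<epsilon> < \<delta>" for \<epsilon> \<delta>
  proof -
    have "modular (\<lambda>x. riesz_trunc j \<epsilon> g x - riesz_trunc j \<delta> g x) \<le> modular (riesz_annulus j \<epsilon> \<delta> g)"
    proof (rule modular_mono)
      fix x
      have "1 / pi\<^sup>2 * \<bar>riesz_annulus j \<epsilon> \<delta> g x\<bar> \<le> 1 * \<bar>riesz_annulus j \<epsilon> \<delta> g x\<bar>"
        by (intro mult_right_mono inverse_pi_square_le_1) auto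
      then show "norm (riesz_trunc j \<epsilon> g x - riesz_trunc j \<delta> g x) \<le> norm (riesz_annulus j \<epsilon> \<delta> g x)"
        unfolding riesz_trunc_diff_radius[OF assms(1) fin that] by (simp add: abs_mult)
    qed
    also have "\<dots> \<le> ennreal riesz_const * modular g" by (rule modular_riesz_annulus_le[OF assms(1) fin that])
    finally show ?thesis .
  qed
  consider "\<epsilon> < \<delta>" | "\<delta> < \<epsilon>" | "\<epsilon> = \<delta>" by linarith
  then show ?thesis
  proof cases
    case 2
    have "modular (\<lambda>x. riesz_trunc j \<epsilon> g x - riesz_trunc j \<delta> g x) = modular (\<lambda>x. riesz_trunc j \<delta> g x - riesz_trunc j \<epsilon> g x)"
      unfolding modular_def by (simp add: abs_minus_commute)
    with *[of \<delta> \<epsilon>] 2 \<epsilon> show ?thesis by simp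
  qed (use * \<epsilon> in \<open>auto simp: modular_def\<close>)
qed

text \<open>The annular bound does not see the outer radius. As that radius grows, the far tail
  tends to 0 at every point by dominated convergence, and Fatou carries the bound over.\<close>

lemma modular_riesz_trunc_le:
  assumes [measurable]: "g \<in> borel_measurable borel" and fin: "modular g < \<infinity>" and \<epsilon>: "0 < \<epsilon>"
  shows "modular (riesz_trunc j \<epsilon> g) \<le> ennreal riesz_const * modular g"
proof (rule modular_Fatou)
  let ?f = "\<lambda>n x. riesz_trunc j \<epsilon> g x - riesz_trunc j (\<epsilon> + real n) g x"
  show "?f n \<in> borel_measurable borel" for n by measurable
  show "\<forall>\<^sub>F n in sequentially. modular (?f n) \<le> ennreal riesz_const * modular g"
    by (intro always_eventually allI modular_riesz_trunc_diff_radius_le[OF assms(1) fin \<epsilon>]) (use \<epsilon> in linarith)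
  show "AE x in lborel. (\<lambda>n. ?f n x) \<longlonglongrightarrow> riesz_trunc j \<epsilon> g x"
  proof (rule AE_I2)
    fix x
    let ?k = "\<lambda>\<epsilon> y. indicator {y. \<epsilon> < norm y} y * (y $ j / norm y ^ 4 * g (x - y))"
    have "(\<lambda>n::nat. LINT y|lborel. ?k (\<epsilon> + real n) y) \<longlonglongrightarrow> (LINT (y::point)|lborel. 0 :: real)"
    proof (rule integral_dominated_convergence[where w = "\<lambda>y. norm (?k \<epsilon> y)" and f = "\<lambda>_. 0" and s = "\<lambda>n. ?k (\<epsilon> + real n)"])
      show "integrable lborel (\<lambda>y. norm (?k \<epsilon> y))"
        by (intro integrable_norm riesz_trunc_integrable[OF assms(1) fin \<epsilon>])
      show "AE y in lborel. (\<lambda>n. ?k (\<epsilon> + real n) y) \<longlonglongrightarrow> 0"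
      proof (intro AE_I2 tendsto_eventually)
        fix y :: point
        obtain N :: nat where "norm y \<le> real N" using real_arch_simple by blast
        then have "\<not> \<epsilon> + real n < norm y" if "N \<le> n" for n using \<epsilon> that by (simp add: not_less)
        then show "\<forall>\<^sub>F n in sequentially. ?k (\<epsilon> + real n) y = 0"
          unfolding eventually_sequentially by (intro exI[of _ N]) simp
      qed
      show "AE y in lborel. norm (?k (\<epsilon> + real n) y) \<le> norm (?k \<epsilon> y)" for n
        by (auto simp: indicator_def)
    qed measurable
    then have "(\<lambda>n. riesz_trunc j (\<epsilon> + real n) g x) \<longlonglongrightarrow> 1 / pi\<^sup>2 * 0"
      unfolding riesz_trunc_def set_lebesgue_integral_def real_scaleR_def
      by (intro tendsto_mult tendsto_const) simp
    then have "(\<lambda>n. ?f n x) \<longlonglongrightarrow> riesz_trunc j \<epsilon> g x - 1 / pi\<^sup>2 * 0"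
      by (intro tendsto_diff tendsto_const)
    then show "(\<lambda>n. ?f n x) \<longlonglongrightarrow> riesz_trunc j \<epsilon> g x" by simp
  qed
qed

section \<open>Convergence of the truncations\<close>

lemma integrable_abs_boundI:
  fixes f g :: "'a \<Rightarrow> real"
  assumes "integrable M g" "f \<in> borel_measurable M" "\<And>x. \<bar>f x\<bar> \<le> g x"
  shows "integrable M f"
proof (rule Bochner_Integration.integrable_bound[OF assms(1,2)], rule AE_I2)
  show "norm (f x) \<le> norm (g x)" for x using assms(3)[of x] by simp
qed

lemma three_times_ennreal: "3 * ennreal x = ennreal (3 * x)"
  by (simp add: ennreal_mult')

lemma integral_trunc_kernel: "(LINT r|lborel. trunc_kernel a b r) = 0"
proof -
  have "(LINT r|lborel. trunc_kernel a b r) = (LINT r|lborel. trunc_kernel a b (0 + (-1) * r))"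
    by (subst lborel_integral_real_affine[where c = "-1" and t = 0]) auto
  also have "\<dots> = (LINT r|lborel. - trunc_kernel a b r)"
    by (intro Bochner_Integration.integral_cong refl) (auto simp: trunc_kernel_def)
  finally show ?thesis by simp
qed

lemma trunc_kernel_integrable:
  assumes "0 < a"
  shows "integrable lborel (trunc_kernel a b)"
proof (rule integrable_abs_boundI)
  show "integrable lborel (\<lambda>r. 1 / a * indicator {-b..b} r :: real)"
    by (intro integrable_mult_right integrable_real_indicator emeasure_bounded_finite) auto
  show "\<bar>trunc_kernel a b r\<bar> \<le> 1 / a * indicator {-b..b} r" for r
    using abs_trunc_kernel_le[OF assms, of b r] by (auto simp: trunc_kernel_def indicator_def)
qed measurable

text \<open>The kernel is odd, so \<open>h x\<close> may be subtracted from the values of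
  \<open>h\<close>. The difference quotient left over is at most L |w| on an interval of length 2 b,
  whatever the inner radius.\<close>

lemma abs_dir_hilbert_lipschitz_le:
  fixes h :: "'a::euclidean_space \<Rightarrow> real"
  assumes lip: "\<And>x y. \<bar>h x - h y\<bar> \<le> L * norm (x - y)" and [measurable]: "h \<in> borel_measurable borel"
    and a: "0 < a" and b: "0 \<le> b"
  shows "\<bar>dir_hilbert a b w h x\<bar> \<le> 2 * b * (L * norm w)"
proof -
  let ?k = "trunc_kernel a b"
  have bd: "\<bar>(h (x - r *\<^sub>R w) - h x) * ?k r\<bar> \<le> (L * norm w) * indicator {-b..b} r" for r
  proof (cases "a < \<bar>r\<bar> \<and> \<bar>r\<bar> \<le> b")
    case True
    have "\<bar>(h (x - r *\<^sub>R w) - h x) * ?k r\<bar> = \<bar>h (x - r *\<^sub>R w) - h x\<bar> / \<bar>r\<bar>"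
      using True by (simp add: trunc_kernel_def abs_divide)
    also have "\<dots> \<le> (L * norm (x - r *\<^sub>R w - x)) / \<bar>r\<bar>" by (intro divide_right_mono lip) auto
    also have "\<dots> = L * norm w"
    proof -
      have "r \<noteq> 0" using True a by auto
      then show ?thesis by simp
    qed
    finally show ?thesis using True by (simp add: indicator_def abs_le_iff)
  next
    case False
    have "0 \<le> L * norm w" using lip[of w 0] by (metis abs_ge_zero diff_zero order_trans)
    with False show ?thesis by (auto simp: trunc_kernel_def indicator_def)
  qed
  have ind: "integrable lborel (\<lambda>r. (L * norm w) * indicator {-b..b} r)"
    by (intro integrable_mult_right integrable_real_indicator emeasure_bounded_finite) auto
  have int: "integrable lborel (\<lambda>r. (h (x - r *\<^sub>R w) - h x) * ?k r)"
    by (rule integrable_abs_boundI[OF ind _ bd]) measurable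
  have int2: "integrable lborel (\<lambda>r. h x * ?k r)" by (intro integrable_mult_right trunc_kernel_integrable a)
  have "dir_hilbert a b w h x = (LINT r|lborel. (h (x - r *\<^sub>R w) - h x) * ?k r + h x * ?k r)"
    unfolding dir_hilbert_def by (simp add: algebra_simps)
  also have "\<dots> = (LINT r|lborel. (h (x - r *\<^sub>R w) - h x) * ?k r)"
    by (subst Bochner_Integration.integral_add[OF int int2]) (simp add: integral_trunc_kernel)
  finally have "\<bar>dir_hilbert a b w h x\<bar> \<le> (LINT r|lborel. (L * norm w) * indicator {-b..b} r)"
    using Bochner_Integration.integral_norm_bound_integral[OF int ind] bd by simp
  also have "\<dots> = 2 * b * (L * norm w)" using b by simp
  finally show ?thesis .
qed

section \<open>Convergence on Lipschitz functions of compact support\<close>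

definition lip_compact :: "(point \<Rightarrow> real) \<Rightarrow> bool" where
  "lip_compact h \<longleftrightarrow> (\<exists>L R. (\<forall>x y. \<bar>h x - h y\<bar> \<le> L * norm (x - y)) \<and> (\<forall>x. R < norm x \<longrightarrow> h x = 0))"

lemma lip_compact_measurable:
  assumes "lip_compact h"
  shows "h \<in> borel_measurable borel"
proof -
  obtain L where L: "\<And>x y. \<bar>h x - h y\<bar> \<le> L * norm (x - y)" using assms by (auto simp: lip_compact_def)
  have "continuous_on UNIV h"
  proof (rule lipschitz_on_continuous_on)
    show "\<bar>L\<bar>-lipschitz_on UNIV h"
    proof (rule lipschitz_onI)
      fix x y :: point
      have "L * norm (x - y) \<le> \<bar>L\<bar> * norm (x - y)" by (intro mult_right_mono) auto
      then show "dist (h x) (h y) \<le> \<bar>L\<bar> * dist x y" using L[of x y] by (simp add: dist_norm)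
    qed simp
  qed
  then show ?thesis by (rule borel_measurable_continuous_onI)
qed

lemma modular_bounded_support_le:
  fixes f :: "'a::euclidean_space \<Rightarrow> real"
  assumes "\<And>x. \<bar>f x\<bar> \<le> B" "\<And>x. R < norm x \<Longrightarrow> f x = 0"
  shows "modular f \<le> ennreal (B powr (3/2)) * emeasure lborel (cball (0::'a) R)"
proof -
  have "modular f \<le> (\<integral>\<^sup>+(x::'a). ennreal (B powr (3/2)) * indicator (cball 0 R) x \<partial>lborel)"
    unfolding modular_def
  proof (rule nn_integral_mono)
    fix x :: 'a
    show "ennreal (norm (f x) powr (3/2)) \<le> ennreal (B powr (3/2)) * indicator (cball 0 R) x"
    proof (cases "R < norm x")
      case False
      have "norm (f x) powr (3/2) \<le> B powr (3/2)" by (rule powr_mono2) (use assms(1) in auto)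
      then show ?thesis using False by (simp add: ennreal_leI)
    qed (simp add: assms(2))
  qed
  also have "\<dots> = ennreal (B powr (3/2)) * emeasure lborel (cball (0::'a) R)"
    by (simp add: nn_integral_cmult_indicator)
  finally show ?thesis .
qed

lemma lip_compact_modular_finite:
  assumes "lip_compact h"
  shows "modular h < \<infinity>"
proof -
  obtain L R where L: "\<And>x y. \<bar>h x - h y\<bar> \<le> L * norm (x - y)" and R: "\<And>x. R < norm x \<Longrightarrow> h x = 0"
    using assms by (auto simp: lip_compact_def)
  have bd: "\<bar>h x\<bar> \<le> \<bar>h 0\<bar> + \<bar>L\<bar> * \<bar>R\<bar>" for x
  proof (cases "R < norm x")
    case False
    then have "L * norm x \<le> \<bar>L\<bar> * \<bar>R\<bar>" by (intro mult_mono) auto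
    then show ?thesis using L[of x 0] by simp
  qed (simp add: R)
  have "modular h \<le> ennreal ((\<bar>h 0\<bar> + \<bar>L\<bar> * \<bar>R\<bar>) powr (3/2)) * emeasure lborel (cball (0::point) R)"
    by (rule modular_bounded_support_le[OF bd R])
  also have "\<dots> < \<infinity>"
    using emeasure_bounded_finite[OF bounded_cball, of "0::point" R] by (auto simp: ennreal_mult_less_top)
  finally show ?thesis .
qed

text \<open>A Cauchy criterion in L^(3/2) as the radius tends to 0, formulated by differences
  because no limit function is at hand yet.\<close>

definition riesz_cauchy :: "3 \<Rightarrow> (point \<Rightarrow> real) \<Rightarrow> bool" where
  "riesz_cauchy j g \<longleftrightarrow> (\<forall>\<eta>>0. \<exists>\<delta>\<^sub>0>0. \<forall>\<epsilon> \<delta>. 0 < \<epsilon> \<and> \<epsilon> < \<delta> \<and> \<delta> < \<delta>\<^sub>0 \<longrightarrow>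
     modular (\<lambda>x. riesz_trunc j \<epsilon> g x - riesz_trunc j \<delta> g x) \<le> ennreal \<eta>)"

text \<open>The difference of the truncations at radii \<epsilon> < \<delta> is an annular integral.
  It is O(\<delta>) pointwise and vanishes outside a fixed ball, so its modular tends to 0 with
  \<delta>.\<close>

lemma riesz_cauchy_lip_compact:
  assumes h: "lip_compact h"
  shows "riesz_cauchy j h"
proof -
  note [measurable] = lip_compact_measurable[OF h]
  note fin = lip_compact_modular_finite[OF h]
  obtain L R where L: "\<And>x y. \<bar>h x - h y\<bar> \<le> L * norm (x - y)" and R: "\<And>x. R < norm x \<Longrightarrow> h x = 0"
    using h by (auto simp: lip_compact_def)
  have L0: "0 \<le> L"
  proof -
    have "0 \<le> L * norm (axis j 1 - 0 :: point)" by (rule order_trans[OF abs_ge_zero L])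
    then show ?thesis by simp
  qed
  \<comment> \<open>On a line the Lipschitz bound is 2 (\<delta> / |w|) (L |w|) = 2 L \<delta>; with
    |w_j| <= 2 this is 4 L \<delta>, integrated over the annulus and divided by
    \<open>rot_const\<close>.\<close>
  define c where "c = 1 / rot_const * (measure lborel (annulus :: point set) * (4 * L))"
  have c0: "0 \<le> c" unfolding c_def using rot_const_pos L0 by (intro mult_nonneg_nonneg) auto
  have fm: "emeasure lborel (annulus :: point set) < \<infinity>" by (rule annulus_emeasure_finite)
  have pt: "\<bar>riesz_annulus j \<epsilon> \<delta> h x\<bar> \<le> c * \<delta>" if \<epsilon>: "0 < \<epsilon>" "\<epsilon> < \<delta>" for \<epsilon> \<delta> x
  proof -
    let ?T = "\<lambda>w. indicator annulus w * (w $ j * dir_hilbert (\<epsilon> / norm w) (\<delta> / norm w) w h x)"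
    have bd: "\<bar>?T w\<bar> \<le> indicator annulus w * (4 * L * \<delta>)" for w :: point
    proof (cases "w \<in> annulus")
      case True
      then have w: "0 < norm w" "norm w < 2" by (auto simp: annulus_def)
      have "\<bar>dir_hilbert (\<epsilon> / norm w) (\<delta> / norm w) w h x\<bar> \<le> 2 * (\<delta> / norm w) * (L * norm w)"
        by (rule abs_dir_hilbert_lipschitz_le) (use L \<epsilon> w in auto)
      also have "\<dots> = 2 * L * \<delta>" using w by simp
      finally have d: "\<bar>dir_hilbert (\<epsilon> / norm w) (\<delta> / norm w) w h x\<bar> \<le> 2 * L * \<delta>" .
      have "\<bar>w $ j\<bar> * \<bar>dir_hilbert (\<epsilon> / norm w) (\<delta> / norm w) w h x\<bar> \<le> 2 * (2 * L * \<delta>)"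
        using component_le_norm_cart[of w j] w d by (intro mult_mono) auto
      then show ?thesis using True by (simp add: abs_mult)
    qed simp
    have ind: "integrable lborel (\<lambda>w::point. indicator annulus w * (4 * L * \<delta>))"
      by (intro integrable_mult_left integrable_real_indicator fm) auto
    have int: "integrable lborel ?T"
      by (rule integrable_abs_boundI[OF ind _ bd]) measurable
    have "\<bar>LINT w|lborel. ?T w\<bar> \<le> (LINT w|lborel. indicator (annulus :: point set) w * (4 * L * \<delta>))"
      using Bochner_Integration.integral_norm_bound_integral[OF int ind] bd by simp
    also have "\<dots> = measure lborel (annulus :: point set) * (4 * L * \<delta>)" by simp
    finally have "1 / rot_const * \<bar>LINT w|lborel. ?T w\<bar> \<le> 1 / rot_const * (measure lborel (annulus :: point set) * (4 * L * \<delta>))"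
      using rot_const_pos by (intro mult_left_mono) auto
    then show ?thesis
      unfolding rotations_riesz_annulus[OF lip_compact_measurable[OF h] fin \<epsilon>(1)] using rot_const_pos
      by (simp add: abs_mult c_def mult.assoc)
  qed
  have supp: "riesz_annulus j \<epsilon> \<delta> h x = 0" if "R + \<delta> < norm x" for \<epsilon> \<delta> x
  proof -
    have "(if \<epsilon> < norm y \<and> norm y \<le> \<delta> then y $ j / norm y ^ 4 else 0) * h (x - y) = 0" for y
    proof (cases "norm y \<le> \<delta>")
      case True
      then have "R < norm (x - y)" using that norm_triangle_ineq2[of x y] by linarith
      then show ?thesis by (simp add: R)
    qed simp
    then show ?thesis unfolding riesz_annulus_def by (simp only: Bochner_Integration.integral_zero)
  qed
  define V where "V = measure lborel (cball (0::point) (R + 1))"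
  have V: "emeasure lborel (cball (0::point) (R + 1)) = ennreal V"
    unfolding V_def by (rule emeasure_eq_ennreal_measure)
      (use emeasure_bounded_finite[OF bounded_cball, of "0::point" "R + 1"] in auto)
  have V0: "0 \<le> V" by (simp add: V_def)
  show ?thesis
    unfolding riesz_cauchy_def
  proof (intro allI impI)
    fix \<eta> :: real assume \<eta>: "0 < \<eta>"
    have "((\<lambda>\<delta>. (c * \<delta>) powr (3/2) * V) \<longlongrightarrow> (c * 0) powr (3/2) * V) (at_right 0)"
      using c0 by (intro tendsto_mult tendsto_powr' tendsto_const tendsto_ident_at)
        (auto simp: eventually_at_right_less intro!: eventually_at_rightI[of 0 1])
    then have "\<forall>\<^sub>F \<delta> in at_right 0. (c * \<delta>) powr (3/2) * V < \<eta>"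
      using \<eta> by (intro order_tendstoD(2)) auto
    then obtain d where d: "0 < d" "\<And>\<delta>. 0 < \<delta> \<Longrightarrow> \<delta> < d \<Longrightarrow> (c * \<delta>) powr (3/2) * V < \<eta>"
      unfolding eventually_at_right_field by auto
    show "\<exists>\<delta>\<^sub>0>0. \<forall>\<epsilon> \<delta>. 0 < \<epsilon> \<and> \<epsilon> < \<delta> \<and> \<delta> < \<delta>\<^sub>0 \<longrightarrow> modular (\<lambda>x. riesz_trunc j \<epsilon> h x - riesz_trunc j \<delta> h x) \<le> ennreal \<eta>"
    proof (intro exI[of _ "min d 1"] conjI allI impI)
      fix \<epsilon> \<delta> :: real assume "0 < \<epsilon> \<and> \<epsilon> < \<delta> \<and> \<delta> < min d 1"
      then have \<epsilon>: "0 < \<epsilon>" "\<epsilon> < \<delta>" "\<delta> < d" "\<delta> < 1" by auto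
      have "modular (\<lambda>x. riesz_trunc j \<epsilon> h x - riesz_trunc j \<delta> h x) \<le> ennreal ((c * \<delta>) powr (3/2)) * emeasure lborel (cball (0::point) (R + 1))"
      proof (rule modular_bounded_support_le)
        fix x
        have "1 / pi\<^sup>2 * \<bar>riesz_annulus j \<epsilon> \<delta> h x\<bar> \<le> 1 * (c * \<delta>)"
          by (intro mult_mono inverse_pi_square_le_1 pt \<epsilon>) auto
        then show "\<bar>riesz_trunc j \<epsilon> h x - riesz_trunc j \<delta> h x\<bar> \<le> c * \<delta>"
          unfolding riesz_trunc_diff_radius[OF lip_compact_measurable[OF h] fin \<epsilon>(1,2)] by (simp add: abs_mult)
      next
        fix x :: point assume "R + 1 < norm x"
        then show "riesz_trunc j \<epsilon> h x - riesz_trunc j \<delta> h x = 0"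
          unfolding riesz_trunc_diff_radius[OF lip_compact_measurable[OF h] fin \<epsilon>(1,2)] using \<epsilon> by (subst supp) auto
      qed
      also have "\<dots> = ennreal ((c * \<delta>) powr (3/2) * V)" unfolding V using V0 by (simp add: ennreal_mult)
      also have "\<dots> \<le> ennreal \<eta>" using d(2)[of \<delta>] \<epsilon> by (intro ennreal_leI) auto
      finally show "modular (\<lambda>x. riesz_trunc j \<epsilon> h x - riesz_trunc j \<delta> h x) \<le> ennreal \<eta>" .
    qed (use d in simp)
  qed
qed

text \<open>The step that consumes the uniform bound: the truncations of the error g - h n are
  controlled by its modular for all radii at once.\<close>

lemma riesz_cauchy_limit:
  assumes [measurable]: "g \<in> borel_measurable borel" "\<And>n. h n \<in> borel_measurable borel"
    and fin: "modular g < \<infinity>" "\<And>n. modular (h n) < \<infinity>"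
    and h: "\<And>n. riesz_cauchy j (h n)" and lim: "(\<lambda>n. modular (\<lambda>x. g x - h n x)) \<longlonglongrightarrow> 0"
  shows "riesz_cauchy j g"
  unfolding riesz_cauchy_def
proof (intro allI impI)
  fix \<eta> :: real assume \<eta>: "0 < \<eta>"
  \<comment> \<open>Chosen so that 3 (C e + e) = \<eta> with C = \<open>riesz_const\<close>; the
    added 1 also prevents division by zero.\<close>
  define e where "e = \<eta> / (3 * (riesz_const + 1))"
  have e: "0 < e" using \<eta> riesz_const_nonneg by (simp add: e_def add_nonneg_pos)
  have "\<forall>\<^sub>F n in sequentially. modular (\<lambda>x. g x - h n x) < ennreal e"
    by (rule order_tendstoD(2)[OF lim]) (use e in simp)
  then obtain n where n: "modular (\<lambda>x. g x - h n x) < ennreal e" by (auto simp: eventually_sequentially)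
  then have dfin: "modular (\<lambda>x. g x - h n x) < \<infinity>" using less_trans ennreal_less_top by (metis infinity_ennreal_def)
  obtain d where d: "0 < d" "\<And>\<epsilon> \<delta>. 0 < \<epsilon> \<Longrightarrow> \<epsilon> < \<delta> \<Longrightarrow> \<delta> < d \<Longrightarrow>
      modular (\<lambda>x. riesz_trunc j \<epsilon> (h n) x - riesz_trunc j \<delta> (h n) x) \<le> ennreal e"
    using h[of n] e unfolding riesz_cauchy_def by meson
  show "\<exists>\<delta>\<^sub>0>0. \<forall>\<epsilon> \<delta>. 0 < \<epsilon> \<and> \<epsilon> < \<delta> \<and> \<delta> < \<delta>\<^sub>0 \<longrightarrow> modular (\<lambda>x. riesz_trunc j \<epsilon> g x - riesz_trunc j \<delta> g x) \<le> ennreal \<eta>"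
  proof (intro exI[of _ d] conjI allI impI)
    fix \<epsilon> \<delta> :: real assume "0 < \<epsilon> \<and> \<epsilon> < \<delta> \<and> \<delta> < d"
    then have \<epsilon>: "0 < \<epsilon>" "\<epsilon> < \<delta>" "\<delta> < d" "0 < \<delta>" by auto
    let ?D = "\<lambda>f x. riesz_trunc j \<epsilon> f x - riesz_trunc j \<delta> f x"
    let ?f = "\<lambda>x. g x - h n x"
    have eq: "?D g x = ?D ?f x + ?D (h n) x" for x
      using riesz_trunc_diff[OF assms(1,2) fin(1,2) \<epsilon>(1)] riesz_trunc_diff[OF assms(1,2) fin(1,2) \<epsilon>(4)] by simp
    have "modular (?D g) \<le> 3 * (modular (?D ?f) + modular (?D (h n)))"
      unfolding eq by (rule modular_add_le) measurable
    also have "\<dots> \<le> 3 * (ennreal riesz_const * ennreal e + ennreal e)"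
    proof (intro mult_left_mono add_mono)
      have "modular (?D ?f) \<le> ennreal riesz_const * modular ?f"
        by (rule modular_riesz_trunc_diff_radius_le[OF _ dfin \<epsilon>(1,4)]) measurable
      also have "\<dots> \<le> ennreal riesz_const * ennreal e" using n by (intro mult_left_mono) auto
      finally show "modular (?D ?f) \<le> ennreal riesz_const * ennreal e" .
    qed (use d(2) \<epsilon> in auto)
    also have "\<dots> = 3 * ennreal (riesz_const * e + e)"
      using riesz_const_nonneg e by (subst ennreal_plus) (auto simp: ennreal_mult)
    also have "\<dots> = ennreal (3 * (riesz_const * e + e))" by (rule three_times_ennreal)
    also have "3 * (riesz_const * e + e) = e * (3 * (riesz_const + 1))" by (simp add: algebra_simps)
    also have "\<dots> = \<eta>" unfolding e_def using riesz_const_nonneg by simp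
    finally show "modular (?D g) \<le> ennreal \<eta>" .
  qed (rule d(1))
qed

lemma riesz_cauchy_diff:
  assumes [measurable]: "g \<in> borel_measurable borel" "h \<in> borel_measurable borel"
    and fin: "modular g < \<infinity>" "modular h < \<infinity>" and g: "riesz_cauchy j g" and h: "riesz_cauchy j h"
  shows "riesz_cauchy j (\<lambda>x. g x - h x)"
  unfolding riesz_cauchy_def
proof (intro allI impI)
  fix \<eta> :: real assume \<eta>: "0 < \<eta>"
  define e where "e = \<eta> / 6"
  have e: "0 < e" using \<eta> by (simp add: e_def)
  obtain d where d: "0 < d" "\<And>\<epsilon> \<delta>. 0 < \<epsilon> \<Longrightarrow> \<epsilon> < \<delta> \<Longrightarrow> \<delta> < d \<Longrightarrow>
      modular (\<lambda>x. riesz_trunc j \<epsilon> g x - riesz_trunc j \<delta> g x) \<le> ennreal e"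
    using g e unfolding riesz_cauchy_def by meson
  obtain d' where d': "0 < d'" "\<And>\<epsilon> \<delta>. 0 < \<epsilon> \<Longrightarrow> \<epsilon> < \<delta> \<Longrightarrow> \<delta> < d' \<Longrightarrow>
      modular (\<lambda>x. riesz_trunc j \<epsilon> h x - riesz_trunc j \<delta> h x) \<le> ennreal e"
    using h e unfolding riesz_cauchy_def by meson
  show "\<exists>\<delta>\<^sub>0>0. \<forall>\<epsilon> \<delta>. 0 < \<epsilon> \<and> \<epsilon> < \<delta> \<and> \<delta> < \<delta>\<^sub>0 \<longrightarrow>
      modular (\<lambda>x. riesz_trunc j \<epsilon> (\<lambda>x. g x - h x) x - riesz_trunc j \<delta> (\<lambda>x. g x - h x) x) \<le> ennreal \<eta>"
  proof (intro exI[of _ "min d d'"] conjI allI impI)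
    fix \<epsilon> \<delta> :: real assume "0 < \<epsilon> \<and> \<epsilon> < \<delta> \<and> \<delta> < min d d'"
    then have \<epsilon>: "0 < \<epsilon>" "\<epsilon> < \<delta>" "\<delta> < d" "\<delta> < d'" "0 < \<delta>" by auto
    let ?D = "\<lambda>f x. riesz_trunc j \<epsilon> f x - riesz_trunc j \<delta> f x"
    have eq: "?D (\<lambda>x. g x - h x) x = ?D g x - ?D h x" for x
      using riesz_trunc_diff[OF assms(1,2) fin(1,2) \<epsilon>(1)] riesz_trunc_diff[OF assms(1,2) fin(1,2) \<epsilon>(5)] by simp
    have "modular (?D (\<lambda>x. g x - h x)) \<le> 3 * (modular (?D g) + modular (?D h))"
      unfolding eq by (rule modular_diff_le) measurable
    also have "\<dots> \<le> 3 * (ennreal e + ennreal e)"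
      using d(2)[OF \<epsilon>(1,2,3)] d'(2)[OF \<epsilon>(1,2,4)] by (intro mult_left_mono add_mono) auto
    also have "\<dots> = ennreal \<eta>" using six_times_ennreal[of e 1] e by (simp add: e_def)
    finally show "modular (?D (\<lambda>x. g x - h x)) \<le> ennreal \<eta>" .
  qed (use d d' in simp)
qed

section \<open>From indicators to all functions of finite modular\<close>

lemma modular_dominated_convergence:
  fixes f :: "nat \<Rightarrow> 'a::euclidean_space \<Rightarrow> real"
  assumes [measurable]: "\<And>n. f n \<in> borel_measurable borel" "w \<in> borel_measurable borel"
    and lim: "\<And>x. (\<lambda>n. f n x) \<longlonglongrightarrow> 0" and bd: "\<And>n x. \<bar>f n x\<bar> \<le> \<bar>w x\<bar>" and w: "modular w < \<infinity>"
  shows "(\<lambda>n. modular (f n)) \<longlonglongrightarrow> 0"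
proof -
  have "(\<lambda>n. \<integral>\<^sup>+x. ennreal (norm (f n x) powr (3/2)) \<partial>lborel) \<longlonglongrightarrow> (\<integral>\<^sup>+(x::'a). 0 \<partial>lborel)"
  proof (rule nn_integral_dominated_convergence[where w = "\<lambda>x. ennreal (norm (w x) powr (3/2))"])
    show "(\<integral>\<^sup>+x. ennreal (norm (w x) powr (3/2)) \<partial>lborel) < \<infinity>" using w by (simp add: modular_def)
    show "AE x in lborel. ennreal (norm (f n x) powr (3/2)) \<le> ennreal (norm (w x) powr (3/2))" for n
      by (intro AE_I2 ennreal_leI powr_mono2) (use bd in auto)
    show "AE x in lborel. (\<lambda>n. ennreal (norm (f n x) powr (3/2))) \<longlonglongrightarrow> 0"
    proof (rule AE_I2)
      fix x
      have "(\<lambda>n. ennreal (norm (f n x) powr (3/2))) \<longlonglongrightarrow> ennreal (norm (0::real) powr (3/2))"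
        by (intro tendsto_ennrealI tendsto_powr' tendsto_norm lim tendsto_const) auto
      then show "(\<lambda>n. ennreal (norm (f n x) powr (3/2))) \<longlonglongrightarrow> 0" by simp
    qed
  qed measurable
  then show ?thesis by (simp add: modular_def)
qed

lemma modular_indicator: "A \<in> sets borel \<Longrightarrow> modular (indicator A :: 'a::euclidean_space \<Rightarrow> real) = emeasure lborel A"
proof -
  assume "A \<in> sets borel"
  have "modular (indicator A :: 'a \<Rightarrow> real) = (\<integral>\<^sup>+x. indicator A x \<partial>lborel)"
    unfolding modular_def by (intro nn_integral_cong) (simp add: indicator_def)
  then show ?thesis using \<open>A \<in> sets borel\<close> by simp
qed

text \<open>The functions max 0 (1 - (n+1) dist(x, T)) are Lipschitz, equal 1 on T and decrease to
  the indicator because T is closed; the first of them dominates the differences.\<close>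

lemma riesz_cauchy_indicator_compact:
  assumes "compact T"
  shows "riesz_cauchy j (indicator T)"
proof (cases "T = {}")
  case True
  have "lip_compact (\<lambda>x. 0)" by (auto simp: lip_compact_def intro!: exI[of _ 0])
  moreover have "indicator T = (\<lambda>x::point. 0::real)" using True by (simp add: fun_eq_iff)
  ultimately show ?thesis by (simp add: riesz_cauchy_lip_compact)
next
  case False
  note [measurable] = borel_compact[OF assms]
  have cl: "closed T" using assms by (rule compact_imp_closed)
  obtain R where R: "\<And>x. x \<in> T \<Longrightarrow> norm x \<le> R"
    using compact_imp_bounded[OF assms] by (auto simp: bounded_iff)
  define h where "h = (\<lambda>n x. max 0 (1 - real (Suc n) * infdist x T))"
  have far: "1 \<le> infdist x T" if "R + 1 < norm x" for x
  proof (unfold infdist_notempty[OF False], rule cINF_greatest)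
    fix y assume "y \<in> T"
    show "1 \<le> dist x y" using R[OF \<open>y \<in> T\<close>] that norm_triangle_ineq2[of x y] by (simp add: dist_norm)
  qed (rule False)
  have lc: "lip_compact (h n)" for n
    unfolding lip_compact_def
  proof (rule exI[of _ "real (Suc n)"], rule exI[of _ "R + 1"], intro conjI allI impI)
    fix x y :: point
    have "\<bar>infdist x T - infdist y T\<bar> \<le> norm (x - y)"
      using infdist_triangle[of x T y] infdist_triangle[of y T x] by (simp add: dist_norm norm_minus_commute abs_le_iff)
    then have "real (Suc n) * \<bar>infdist x T - infdist y T\<bar> \<le> real (Suc n) * norm (x - y)"
      by (intro mult_left_mono) auto
    moreover have "\<bar>h n x - h n y\<bar> \<le> real (Suc n) * \<bar>infdist x T - infdist y T\<bar>"
    proof -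
      have max_lip: "\<bar>max 0 a - max 0 b\<bar> \<le> \<bar>a - b\<bar>" for a b :: real by (simp add: max_def)
      have "\<bar>h n x - h n y\<bar> \<le> \<bar>(1 - real (Suc n) * infdist x T) - (1 - real (Suc n) * infdist y T)\<bar>"
        unfolding h_def by (rule max_lip)
      also have "\<dots> = \<bar>real (Suc n) * (infdist y T - infdist x T)\<bar>" by (simp add: right_diff_distrib)
      also have "\<dots> = real (Suc n) * \<bar>infdist x T - infdist y T\<bar>" by (simp only: abs_mult abs_minus_commute abs_of_nat)
      finally show ?thesis .
    qed
    ultimately show "\<bar>h n x - h n y\<bar> \<le> real (Suc n) * norm (x - y)" by linarith
  next
    fix x :: point assume "R + 1 < norm x"
    from far[OF this] have "1 * 1 \<le> real (Suc n) * infdist x T" by (intro mult_mono) auto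
    then show "h n x = 0" unfolding h_def by simp
  qed
  note [measurable] = lip_compact_measurable[OF lc]
  have ht: "h n x = 1" if "x \<in> T" for n x using that by (simp add: h_def)
  have h01: "0 \<le> h n x" "h n x \<le> h 0 x" "h n x \<le> 1" for n x
  proof -
    have "1 * infdist x T \<le> real (Suc n) * infdist x T" by (intro mult_right_mono) (auto simp: infdist_nonneg)
    then show "0 \<le> h n x" "h n x \<le> h 0 x" "h n x \<le> 1" unfolding h_def by (auto simp: infdist_nonneg)
  qed
  show ?thesis
  proof (rule riesz_cauchy_limit[OF _ lip_compact_measurable[OF lc] _ lip_compact_modular_finite[OF lc] riesz_cauchy_lip_compact[OF lc]])
    show "modular (indicator T :: point \<Rightarrow> real) < \<infinity>"
      using emeasure_bounded_finite[OF compact_imp_bounded[OF assms]] by (subst modular_indicator) auto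
    show "(\<lambda>n. modular (\<lambda>x. indicator T x - h n x)) \<longlonglongrightarrow> 0"
    proof (rule modular_dominated_convergence[where w = "h 0"])
      show "modular (h 0) < \<infinity>" by (rule lip_compact_modular_finite[OF lc])
      fix x
      show "\<bar>indicator T x - h n x\<bar> \<le> \<bar>h 0 x\<bar>" for n
        using h01[where x = x] ht[of x] by (cases "x \<in> T") auto
      show "(\<lambda>n. indicator T x - h n x) \<longlonglongrightarrow> 0"
      proof (cases "x \<in> T")
        case False
        then have pos: "0 < infdist x T" using cl \<open>T \<noteq> {}\<close> by (meson infdist_pos_not_in_closed)
        obtain N :: nat where N: "1 / infdist x T \<le> real N" using real_arch_simple by blast
        show ?thesis
        proof (rule tendsto_eventually, unfold eventually_sequentially, intro exI[of _ N] allI impI)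
          fix n assume "N \<le> n"
          then have "1 / infdist x T \<le> real (Suc n)" using N by simp
          then have "1 \<le> real (Suc n) * infdist x T" using pos by (simp add: divide_le_eq)
          then show "indicator T x - h n x = 0" using False unfolding h_def by simp
        qed
      qed (simp add: ht)
    qed measurable
  qed measurable
qed

text \<open>Closed sets of finite measure are exhausted by their intersections with balls, which are
  compact; Borel sets of finite measure are then approximated from inside by closed sets, and the
  modular of a difference of nested indicators is the measure of the difference set.\<close>

lemma riesz_cauchy_indicator:
  assumes A [measurable]: "A \<in> sets borel" and fin: "emeasure lborel A < \<infinity>"
  shows "riesz_cauchy j (indicator A)"
proof -
  have *: "riesz_cauchy j (indicator T)" if T: "closed T" and finT: "emeasure lborel T < \<infinity>" for T
  proof (rule riesz_cauchy_limit[where h = "\<lambda>n. indicator (T \<inter> cball 0 (real n))"])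
    note [measurable] = borel_closed[OF T] borel_closed[OF closed_cball]
    show "modular (indicator T :: point \<Rightarrow> real) < \<infinity>" using finT by (subst modular_indicator) auto
    show "indicator (T \<inter> cball 0 (real n)) \<in> borel_measurable borel" for n by measurable
    show "modular (indicator (T \<inter> cball 0 (real n)) :: point \<Rightarrow> real) < \<infinity>" for n
      using emeasure_bounded_finite[of "T \<inter> cball 0 (real n)"] by (subst modular_indicator) (auto simp: bounded_Int)
    show "riesz_cauchy j (indicator (T \<inter> cball 0 (real n)))" for n
      by (rule riesz_cauchy_indicator_compact) (simp add: closed_Int_compact T)
    show "(\<lambda>n. modular (\<lambda>x. indicator T x - indicator (T \<inter> cball 0 (real n)) x :: real)) \<longlonglongrightarrow> 0"
    proof (rule modular_dominated_convergence[where w = "indicator T"])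
      show "modular (indicator T :: point \<Rightarrow> real) < \<infinity>" using finT by (subst modular_indicator) auto
      fix x :: point
      obtain N :: nat where N: "norm x \<le> real N" using real_arch_simple by blast
      show "(\<lambda>n. indicator T x - indicator (T \<inter> cball 0 (real n)) x :: real) \<longlonglongrightarrow> 0"
      proof (rule tendsto_eventually, unfold eventually_sequentially, intro exI[of _ N] allI impI)
        fix n assume "N \<le> n"
        then have "norm x \<le> real n" using N by simp
        then show "indicator T x - indicator (T \<inter> cball 0 (real n)) x = (0::real)" by (simp add: indicator_def)
      qed
    qed (auto simp: indicator_def)
  qed (use T in auto)
  have "\<exists>T. closed T \<and> T \<subseteq> A \<and> emeasure lborel (A - T) \<le> ennreal (1 / real (Suc n))" for n
  proof -
    have "A \<in> sets lebesgue" using A by (simp add: sets_completionI_sets)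
    then obtain T where T: "closed T" "T \<subseteq> A" "emeasure lebesgue (A - T) < ennreal (1 / real (Suc n))"
      using sets_lebesgue_inner_closed[of A "1 / real (Suc n)"] by (metis of_nat_0_less_iff zero_less_Suc zero_less_divide_1_iff)
    have "emeasure lebesgue (A - T) = emeasure lborel (A - T)"
      using A borel_closed[OF T(1)] by (simp add: sets.Diff)
    with T show ?thesis by (metis less_imp_le)
  qed
  then obtain T where T: "\<And>n. closed (T n)" "\<And>n. T n \<subseteq> A" "\<And>n. emeasure lborel (A - T n) \<le> ennreal (1 / real (Suc n))"
    by metis
  note [measurable] = borel_closed[OF T(1)]
  have Tfin: "emeasure lborel (T n) < \<infinity>" for n using emeasure_mono[OF T(2)[of n], of lborel] fin by (auto intro: le_less_trans)
  show ?thesis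
  proof (rule riesz_cauchy_limit[OF _ _ _ _ *[OF T(1) Tfin]])
    show "modular (indicator A :: point \<Rightarrow> real) < \<infinity>" using fin by (subst modular_indicator) auto
    show "modular (indicator (T n) :: point \<Rightarrow> real) < \<infinity>" for n using Tfin by (subst modular_indicator) auto
    have eq: "modular (\<lambda>x. indicator A x - indicator (T n) x :: real) = emeasure lborel (A - T n)" for n
    proof -
      have "(\<lambda>x. indicator A x - indicator (T n) x :: real) = indicator (A - T n)"
        using T(2)[of n] by (auto simp: indicator_def fun_eq_iff)
      then show ?thesis by (simp add: modular_indicator)
    qed
    have "(\<lambda>n. ennreal (1 / real (Suc n))) \<longlonglongrightarrow> ennreal 0"
      by (intro tendsto_ennrealI LIMSEQ_Suc lim_1_over_n)
    then show "(\<lambda>n. modular (\<lambda>x. indicator A x - indicator (T n) x :: real)) \<longlonglongrightarrow> 0"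
      unfolding eq by (intro tendsto_sandwich[OF _ _ tendsto_const, of _ "\<lambda>n. emeasure lborel (A - T n)"])
        (use T(3) in auto)
  qed measurable
qed

lemma riesz_trunc_cmult: "riesz_trunc j \<epsilon> (\<lambda>y. c * g y) x = c * riesz_trunc j \<epsilon> g x"
proof -
  have "(LINT y|lborel. indicator {y. norm y > \<epsilon>} y * (y $ j / norm y ^ 4 * (c * g (x - y))))
      = (LINT y|lborel. c * (indicator {y. norm y > \<epsilon>} y * (y $ j / norm y ^ 4 * g (x - y))))"
    by (intro Bochner_Integration.integral_cong refl) (simp only: mult_ac)
  also have "\<dots> = c * (LINT y|lborel. indicator {y. norm y > \<epsilon>} y * (y $ j / norm y ^ 4 * g (x - y)))"
    by (rule integral_mult_right_zero)
  finally show ?thesis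
    unfolding riesz_trunc_def set_lebesgue_integral_def real_scaleR_def by (simp only: mult.left_commute)
qed

lemma riesz_cauchy_cmult:
  assumes [measurable]: "g \<in> borel_measurable borel" and g: "riesz_cauchy j g"
  shows "riesz_cauchy j (\<lambda>x. c * g x)"
  unfolding riesz_cauchy_def
proof (intro allI impI)
  fix \<eta> :: real assume \<eta>: "0 < \<eta>"
  define C where "C = \<bar>c\<bar> powr (3/2)"
  have C: "0 \<le> C" by (simp add: C_def)
  have "0 < \<eta> / (C + 1)" using \<eta> C by simp
  then obtain d where d: "0 < d" "\<And>\<epsilon> \<delta>. 0 < \<epsilon> \<Longrightarrow> \<epsilon> < \<delta> \<Longrightarrow> \<delta> < d \<Longrightarrow>
      modular (\<lambda>x. riesz_trunc j \<epsilon> g x - riesz_trunc j \<delta> g x) \<le> ennreal (\<eta> / (C + 1))"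
    using g unfolding riesz_cauchy_def by meson
  show "\<exists>\<delta>\<^sub>0>0. \<forall>\<epsilon> \<delta>. 0 < \<epsilon> \<and> \<epsilon> < \<delta> \<and> \<delta> < \<delta>\<^sub>0 \<longrightarrow>
      modular (\<lambda>x. riesz_trunc j \<epsilon> (\<lambda>x. c * g x) x - riesz_trunc j \<delta> (\<lambda>x. c * g x) x) \<le> ennreal \<eta>"
  proof (intro exI[of _ d] conjI allI impI)
    fix \<epsilon> \<delta> :: real assume *: "0 < \<epsilon> \<and> \<epsilon> < \<delta> \<and> \<delta> < d"
    have "modular (\<lambda>x. riesz_trunc j \<epsilon> (\<lambda>x. c * g x) x - riesz_trunc j \<delta> (\<lambda>x. c * g x) x)
        = ennreal C * modular (\<lambda>x. riesz_trunc j \<epsilon> g x - riesz_trunc j \<delta> g x)"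
      unfolding riesz_trunc_cmult right_diff_distrib[symmetric] C_def by (rule modular_cmult) measurable
    also have "\<dots> \<le> ennreal C * ennreal (\<eta> / (C + 1))" using d(2) * by (intro mult_left_mono) auto
    also have "\<dots> = ennreal (C * (\<eta> / (C + 1)))" by (rule ennreal_mult[symmetric]) (use C \<eta> in auto)
    also have "\<dots> \<le> ennreal \<eta>" using C \<eta> by (intro ennreal_leI) (simp add: field_simps)
    finally show "modular (\<lambda>x. riesz_trunc j \<epsilon> (\<lambda>x. c * g x) x - riesz_trunc j \<delta> (\<lambda>x. c * g x) x) \<le> ennreal \<eta>" .
  qed (rule d(1))
qed

text \<open>Finiteness of the modular sits inside the claim because the induction over measurable
  functions supplies it for no intermediate function. It is recovered in each case from that of the
  larger function, which also dominates in the monotone limit.\<close>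

lemma riesz_cauchy_nonneg:
  assumes "g \<in> borel_measurable borel" "\<And>x. 0 \<le> g x"
  shows "modular g < \<infinity> \<longrightarrow> riesz_cauchy j g"
  using assms
proof (induction g rule: borel_measurable_induct_real)
  case (set A)
  then show ?case by (auto simp: modular_indicator intro: riesz_cauchy_indicator)
next
  case (mult u c)
  note [measurable] = mult.hyps(2)
  show ?case
  proof (cases "c = 0")
    case True
    have "lip_compact (\<lambda>x. 0)" by (auto simp: lip_compact_def intro!: exI[of _ 0])
    then show ?thesis using True riesz_cauchy_lip_compact by simp
  next
    case False
    have "modular u < \<infinity>" if "modular (\<lambda>x. c * u x) < \<infinity>"
    proof -
      have "modular u = modular (\<lambda>x. 1 / c * (c * u x))" using False by simp
      also have "\<dots> = ennreal (\<bar>1 / c\<bar> powr (3/2)) * modular (\<lambda>x. c * u x)" by (rule modular_cmult) measurable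
      also have "\<dots> < \<infinity>" using that by (simp add: ennreal_mult_less_top)
      finally show ?thesis .
    qed
    then show ?thesis using mult.IH riesz_cauchy_cmult[of u] by auto
  qed
next
  case (add u v)
  note [measurable] = add.hyps(1,3)
  show ?case
  proof
    assume fin: "modular (\<lambda>x. v x + u x) < \<infinity>"
    have "modular u \<le> modular (\<lambda>x. v x + u x)" "modular v \<le> modular (\<lambda>x. v x + u x)"
      using add.hyps(2,4) by (auto intro!: modular_mono)
    then have f: "modular u < \<infinity>" "modular v < \<infinity>" using fin by (auto intro: le_less_trans)
    \<comment> \<open>The sum is written as a difference so that closure under differences and
      multiples covers it.\<close>
    have "riesz_cauchy j (\<lambda>x. v x - (- 1) * u x)"
      by (rule riesz_cauchy_diff) (use add.IH f in \<open>auto intro: riesz_cauchy_cmult[of u j "- 1", simplified]\<close>)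
    then show "riesz_cauchy j (\<lambda>x. v x + u x)" by simp
  qed
next
  case (seq U)
  note [measurable] = seq.hyps(1)
  show ?case
  proof
    assume fin: "modular g < \<infinity>"
    have [measurable]: "g \<in> borel_measurable borel" 
      by (rule borel_measurable_LIMSEQ_real[of _ U]) (use seq.hyps in auto)
    have Ug: "U n x \<le> g x" for n x
      by (rule incseq_le[of "\<lambda>n. U n x"]) (use seq.hyps in \<open>auto simp: incseq_def le_fun_def\<close>)
    have U0: "0 \<le> U n x" for n x by (rule seq.hyps(2))
    have g0: "0 \<le> g x" for x using order_trans[OF U0 Ug] .
    have fU: "modular (U n) < \<infinity>" for n
    proof (rule le_less_trans[OF modular_mono fin])
      show "norm (U n x) \<le> norm (g x)" for x using U0[of n x] Ug[of n x] by simp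
    qed
    show "riesz_cauchy j g"
    proof (rule riesz_cauchy_limit[OF _ seq.hyps(1) fin fU])
      show "riesz_cauchy j (U n)" for n using seq.IH fU by auto
      show "(\<lambda>n. modular (\<lambda>x. g x - U n x)) \<longlonglongrightarrow> 0"
      proof (rule modular_dominated_convergence[where w = g])
        show "\<bar>g x - U n x\<bar> \<le> \<bar>g x\<bar>" for n x using U0[of n x] Ug[of n x] by auto
        show "(\<lambda>n. g x - U n x) \<longlonglongrightarrow> 0" for x
          using tendsto_diff[OF tendsto_const seq.hyps(4)[of x], of "g x"] by simp
      qed (use fin in measurable)
    qed measurable
  qed
qed

lemma riesz_cauchy:
  assumes [measurable]: "g \<in> borel_measurable borel" and fin: "modular g < \<infinity>"
  shows "riesz_cauchy j g"
proof -
  let ?p = "\<lambda>x. max (g x) 0" and ?m = "\<lambda>x. max (- g x) 0"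
  have "modular ?p \<le> modular g" "modular ?m \<le> modular g" by (auto intro!: modular_mono)
  then have f: "modular ?p < \<infinity>" "modular ?m < \<infinity>" using fin by (auto intro: le_less_trans)
  have "riesz_cauchy j (\<lambda>x. ?p x - ?m x)"
    by (rule riesz_cauchy_diff) (use f riesz_cauchy_nonneg in auto)
  also have "(\<lambda>x. ?p x - ?m x) = g" by (auto simp: fun_eq_iff max_def)
  finally show ?thesis .
qed

section \<open>Riesz transforms of space-time functions\<close>

lemma epowr_inverse:
  assumes "0 < r"
  shows "epowr (epowr a (1 / r)) r = a" "epowr (epowr a r) (1 / r) = a"
  using assms by (cases a; simp add: epowr_def powr_powr)+

lemma epowr_less_top_iff: "epowr a r < top \<longleftrightarrow> a < top"
  by (cases a) (auto simp: epowr_def)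

lemma tendsto_epowr_0:
  assumes f: "(f \<longlongrightarrow> 0) F" and r: "0 < r"
  shows "((\<lambda>x. epowr (f x) r) \<longlongrightarrow> 0) F"
proof -
  have ev: "\<forall>\<^sub>F x in F. f x < 1" by (rule order_tendstoD(2)[OF f]) simp
  have "((\<lambda>x. enn2real (f x)) \<longlongrightarrow> enn2real 0) F"
    by (rule tendsto_enn2real) (use f in auto)
  then have "((\<lambda>x. enn2real (f x) powr r) \<longlongrightarrow> 0 powr r) F"
    by (intro tendsto_powr') (use r in auto)
  then have "((\<lambda>x. ennreal (enn2real (f x) powr r)) \<longlongrightarrow> ennreal 0) F"
    by (intro tendsto_ennrealI) simp
  then have "((\<lambda>x. ennreal (enn2real (f x) powr r)) \<longlongrightarrow> 0) F" by simp
  moreover have "\<forall>\<^sub>F x in F. epowr (f x) r = ennreal (enn2real (f x) powr r)"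
    using ev by eventually_elim (auto simp: epowr_def)
  ultimately show ?thesis by (simp add: tendsto_cong)
qed

lemma eLnorm_three_halves: "eLnorm (3/2) UNIV f = epowr (modular f) (1 / (3/2))"
  by (simp add: eLnorm_def modular_def)

lemma tendsto_eLnorm_iff_modular:
  "((\<lambda>\<epsilon>. eLnorm (3/2) UNIV (f \<epsilon>)) \<longlongrightarrow> 0) F \<longleftrightarrow> ((\<lambda>\<epsilon>. modular (f \<epsilon>)) \<longlongrightarrow> 0) F"
proof
  assume "((\<lambda>\<epsilon>. eLnorm (3/2) UNIV (f \<epsilon>)) \<longlongrightarrow> 0) F"
  from tendsto_epowr_0[OF this, of "3/2"]
  show "((\<lambda>\<epsilon>. modular (f \<epsilon>)) \<longlongrightarrow> 0) F"
    unfolding eLnorm_three_halves epowr_inverse(1)[of "3/2", OF divide_pos_pos[OF zero_less_numeral zero_less_numeral]]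
    by simp
next
  assume "((\<lambda>\<epsilon>. modular (f \<epsilon>)) \<longlongrightarrow> 0) F"
  then show "((\<lambda>\<epsilon>. eLnorm (3/2) UNIV (f \<epsilon>)) \<longlongrightarrow> 0) F"
    unfolding eLnorm_three_halves by (rule tendsto_epowr_0) simp
qed

lemma eLLnorm_same_exponent:
  assumes "0 < r"
  shows "eLLnorm r r S f = epowr (\<integral>\<^sup>+ t\<in>window. (\<integral>\<^sup>+ x\<in>S. ennreal (norm (f (x, t)) powr r) \<partial>lborel) \<partial>lborel) (1 / r)"
  using assms by (simp add: eLLnorm_def eLnorm_def epowr_inverse)

lemma modular_commute: "modular (\<lambda>x. f x - g x) = modular (\<lambda>x. g x - f x)"
  unfolding modular_def by (simp add: norm_minus_commute)

lemma riesz_limit_unique: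
  assumes [measurable]: "g \<in> borel_measurable borel" "h \<in> borel_measurable borel" "h' \<in> borel_measurable borel"
    and h: "((\<lambda>\<epsilon>. modular (\<lambda>x. riesz_trunc j \<epsilon> g x - h x)) \<longlongrightarrow> 0) (at_right 0)"
    and h': "((\<lambda>\<epsilon>. modular (\<lambda>x. riesz_trunc j \<epsilon> g x - h' x)) \<longlongrightarrow> 0) (at_right 0)"
  shows "modular (\<lambda>x. h x - h' x) = 0"
proof -
  have le: "modular (\<lambda>x. h x - h' x) \<le> 3 * (modular (\<lambda>x. riesz_trunc j \<epsilon> g x - h' x) + modular (\<lambda>x. riesz_trunc j \<epsilon> g x - h x))" for \<epsilon>
  proof -
    have "modular (\<lambda>x. h x - h' x) = modular (\<lambda>x. (riesz_trunc j \<epsilon> g x - h' x) - (riesz_trunc j \<epsilon> g x - h x))"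
      by (simp add: algebra_simps)
    also have "\<dots> \<le> 3 * (modular (\<lambda>x. riesz_trunc j \<epsilon> g x - h' x) + modular (\<lambda>x. riesz_trunc j \<epsilon> g x - h x))"
      by (rule modular_diff_le) measurable
    finally show ?thesis .
  qed
  have "((\<lambda>\<epsilon>. 3 * (modular (\<lambda>x. riesz_trunc j \<epsilon> g x - h' x) + modular (\<lambda>x. riesz_trunc j \<epsilon> g x - h x))) \<longlongrightarrow> 3 * (0 + 0)) (at_right 0)"
    by (intro ennreal_tendsto_cmult tendsto_add h h') simp
  then have "modular (\<lambda>x. h x - h' x) \<le> 3 * (0 + 0)"
    by (rule tendsto_lowerbound) (use le in auto)
  then show ?thesis by simp
qed

lemma tendsto_0_if_small:
  fixes f :: "'a \<Rightarrow> ennreal"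
  assumes "\<And>\<eta>::real. 0 < \<eta> \<Longrightarrow> \<forall>\<^sub>F x in F. f x \<le> ennreal \<eta>"
  shows "(f \<longlongrightarrow> 0) F"
proof (rule order_tendstoI)
  fix a :: ennreal assume "0 < a"
  then obtain b where b: "0 < b" "b < a" using dense by blast
  then obtain r where r: "b = ennreal r" "0 \<le> r" by (cases b) (auto simp: top.not_eq_extremum)
  then have "0 < r" using b by simp
  from assms[OF this] show "\<forall>\<^sub>F x in F. f x < a"
    by eventually_elim (use b r in auto)
qed simp

lemma le_suminf_ennreal:
  fixes f :: "nat \<Rightarrow> ennreal"
  shows "f i \<le> suminf f"
  using sum_le_suminf[OF summableI, of "{i}" f] by simp

text \<open>For almost every time the Cauchy criterion yields a limit of the slice, but separate
  choices need not be measurable in time. The limit is therefore taken pointwise in space-time along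
  one sequence of radii, chosen so fast that it converges at almost every point of almost every
  slice; the Cauchy criterion then extends convergence to all radii.\<close>

lemma space_time_riesz_exists:
  fixes G :: "point \<times> real \<Rightarrow> real"
  assumes G [measurable]: "G \<in> borel_measurable (borel \<Otimes>\<^sub>M borel)"
    and fin: "(\<integral>\<^sup>+t. modular (\<lambda>x. G (x, t)) \<partial>lborel) < \<infinity>"
  obtains H where "H \<in> borel_measurable (borel \<Otimes>\<^sub>M borel)"
    and "(\<integral>\<^sup>+t. modular (\<lambda>x. H (x, t)) \<partial>lborel) < \<infinity>"
    and "AE t in lborel. ((\<lambda>\<epsilon>. modular (\<lambda>x. riesz_trunc j \<epsilon> (\<lambda>y. G (y, t)) x - H (x, t))) \<longlongrightarrow> 0) (at_right 0)"
proof -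
  define g where "g = (\<lambda>t x. G (x, t))"
  have gm [measurable]: "g t \<in> borel_measurable borel" for t unfolding g_def by measurable
  define e where "e n = 1 / real (Suc n)" for n
  have e0: "0 < e n" for n by (simp add: e_def)
  have e_mono: "e m \<le> e n" if "n \<le> m" for m n using that by (simp add: e_def frac_le)
  have e_lim: "e \<longlonglongrightarrow> 0" unfolding e_def by (intro LIMSEQ_Suc lim_1_over_n)
  define h where "h n z = riesz_trunc j (e n) (g (snd z)) (fst z)" for n z
  have hm [measurable]: "h n \<in> borel_measurable (borel \<Otimes>\<^sub>M borel)" for n
    unfolding h_def g_def by measurable
  have hs: "(\<lambda>x. h n (x, t)) = riesz_trunc j (e n) (g t)" for n t by (simp add: h_def)
  let ?d = "\<lambda>n m t. modular (\<lambda>x. h n (x, t) - h m (x, t))"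
  have dm [measurable]: "?d n m \<in> borel_measurable borel" for n m
    unfolding modular_def by measurable
  have modm [measurable]: "(\<lambda>t. modular (g t)) \<in> borel_measurable borel"
    unfolding modular_def g_def by measurable
  \<comment> \<open>The oscillation beyond the n-th radius. As a countable supremum it is measurable
    in time; it is dominated by a multiple of \<open>modular (g t)\<close> and tends to 0 wherever
    that modular is finite, so its time integral tends to 0.\<close>
  define \<omega> where "\<omega> n t = (SUP m\<in>{n..}. ?d n m t)" for n t
  have \<omega>m [measurable]: "\<omega> n \<in> borel_measurable borel" for n
    unfolding \<omega>_def by (rule borel_measurable_SUP) auto
  have d_\<omega>: "?d n m t \<le> \<omega> n t" if "n \<le> m" for n m t
    unfolding \<omega>_def by (rule SUP_upper) (use that in simp)
  have good: "AE t in lborel. modular (g t) < \<infinity>"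
    using nn_integral_PInf_AE[OF _ fin[THEN less_imp_neq]] modm by (auto simp: g_def top.not_eq_extremum)
  have \<omega>_bd: "\<omega> n t \<le> ennreal riesz_const * modular (g t)" if "modular (g t) < \<infinity>" for n t
    unfolding \<omega>_def
  proof (rule SUP_least)
    fix m
    show "?d n m t \<le> ennreal riesz_const * modular (g t)"
      using modular_riesz_trunc_diff_radius_le[OF gm that e0 e0, of j n m] by (simp add: h_def)
  qed
  have \<omega>_lim: "(\<lambda>n. \<omega> n t) \<longlonglongrightarrow> 0" if t: "modular (g t) < \<infinity>" for t
  proof (rule tendsto_0_if_small)
    fix \<eta> :: real assume \<eta>: "0 < \<eta>"
    obtain \<delta> where \<delta>: "0 < \<delta>" "\<And>\<epsilon> \<delta>'. 0 < \<epsilon> \<Longrightarrow> \<epsilon> < \<delta>' \<Longrightarrow> \<delta>' < \<delta> \<Longrightarrow>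
        modular (\<lambda>x. riesz_trunc j \<epsilon> (g t) x - riesz_trunc j \<delta>' (g t) x) \<le> ennreal \<eta>"
      using riesz_cauchy[OF gm t, of j] \<eta> unfolding riesz_cauchy_def by meson
    have "\<forall>\<^sub>F n in sequentially. e n < \<delta>" by (rule order_tendstoD(2)[OF e_lim \<delta>(1)])
    then show "\<forall>\<^sub>F n in sequentially. \<omega> n t \<le> ennreal \<eta>"
    proof eventually_elim
      case (elim n)
      show ?case unfolding \<omega>_def
      proof (rule SUP_least)
        fix m assume "m \<in> {n..}"
        then have "e m \<le> e n" by (intro e_mono) simp
        then consider "e m = e n" | "e m < e n" by linarith
        then show "?d n m t \<le> ennreal \<eta>"
        proof cases
          case 1
          then show ?thesis by (simp add: h_def modular_def)
        next
          case 2
          then show ?thesis using \<delta>(2)[OF e0 2 elim] modular_commute[of "\<lambda>x. h n (x, t)" "\<lambda>x. h m (x, t)"] by (simp add: h_def)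
        qed
      qed
    qed
  qed
  have "(\<lambda>n. \<integral>\<^sup>+t. \<omega> n t \<partial>lborel) \<longlonglongrightarrow> (\<integral>\<^sup>+(t::real). 0 \<partial>lborel)"
  proof (rule nn_integral_dominated_convergence[where w = "\<lambda>t. ennreal riesz_const * modular (g t)"])
    show "(\<integral>\<^sup>+t. ennreal riesz_const * modular (g t) \<partial>lborel) < \<infinity>"
      by (subst nn_integral_cmult, measurable) (use fin in \<open>simp add: g_def ennreal_mult_less_top\<close>)
    show "AE t in lborel. \<omega> n t \<le> ennreal riesz_const * modular (g t)" for n
      using good by eventually_elim (rule \<omega>_bd)
    show "AE t in lborel. (\<lambda>n. \<omega> n t) \<longlonglongrightarrow> 0"
      using good by eventually_elim (rule \<omega>_lim)
  qed measurable
  then have int_lim: "(\<lambda>n. \<integral>\<^sup>+t. \<omega> n t \<partial>lborel) \<longlonglongrightarrow> 0" by simp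
  \<comment> \<open>The threshold 8^(-i) absorbs the factor (2^i)^(3/2) <= 4^i of the weights below
    and leaves the summable 2^(-i).\<close>
  have "\<exists>N. \<forall>n\<ge>N. (\<integral>\<^sup>+t. \<omega> n t \<partial>lborel) < ennreal ((1/8)^i)" for i
    using order_tendstoD(2)[OF int_lim, of "ennreal ((1/8)^i)"] by (simp add: eventually_sequentially)
  then obtain N where N: "\<And>i n. N i \<le> n \<Longrightarrow> (\<integral>\<^sup>+t. \<omega> n t \<partial>lborel) < ennreal ((1/8)^i)" by metis
  \<comment> \<open>Adding up the thresholds makes \<open>k\<close> monotone, with
    \<open>k i\<close> at least \<open>N i\<close> and at least \<open>i\<close>.\<close>
  define k where "k i = i + (\<Sum>l\<le>i. N l)" for i
  have k_N: "N i \<le> k i" for i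
  proof -
    have "N i \<le> (\<Sum>l\<le>i. N l)" by (rule member_le_sum) auto
    then show ?thesis by (simp add: k_def)
  qed
  have k_mono: "k i \<le> k l" if "i \<le> l" for i l
  proof -
    have "(\<Sum>m\<le>i. N m) \<le> (\<Sum>m\<le>l. N m)" by (rule sum_mono2) (use that in auto)
    then show ?thesis using that by (simp add: k_def)
  qed
  have k_ge: "i \<le> k i" for i by (simp add: k_def)
  let ?D = "\<lambda>i z. h (k (Suc i)) z - h (k i) z"
  \<comment> \<open>The weights 2^i make pointwise convergence a matter of finiteness: where S
    equals a finite s, each term is at most s, so the i-th increment is at most s^(2/3) 2^(-i) and
    the telescoping series converges geometrically.\<close>
  define S where "S z = (\<Sum>i. ennreal (\<bar>2^i * ?D i z\<bar> powr (3/2)))" for z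
  have Sm [measurable]: "S \<in> borel_measurable (borel \<Otimes>\<^sub>M borel)" unfolding S_def by measurable
  have scaled_le: "(\<integral>\<^sup>+t. modular (\<lambda>x. 2^i * ?D i (x, t)) \<partial>lborel) \<le> ennreal ((1/2)^i)" for i
  proof -
    have "(\<integral>\<^sup>+t. modular (\<lambda>x. 2^i * ?D i (x, t)) \<partial>lborel) \<le> (\<integral>\<^sup>+t. ennreal (4^i) * \<omega> (k i) t \<partial>lborel)"
    proof (rule nn_integral_mono)
      fix t
      have "modular (\<lambda>x. 2^i * ?D i (x, t)) = ennreal (\<bar>2^i\<bar> powr (3/2)) * modular (\<lambda>x. ?D i (x, t))"
        by (rule modular_cmult) measurable
      also have "\<dots> \<le> ennreal (4^i) * \<omega> (k i) t"
      proof (rule mult_mono)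
        have "\<bar>2^i\<bar> powr (3/2) \<le> (2^i) powr (2::real)" using powr_mono[of "3/2" 2 "2^i :: real"] by simp
        also have "\<dots> = (4::real)^i" by (simp add: power_mult_distrib[symmetric] power2_eq_square)
        finally show "ennreal (\<bar>2^i\<bar> powr (3/2)) \<le> ennreal (4^i)" by (rule ennreal_leI)
        show "modular (\<lambda>x. ?D i (x, t)) \<le> \<omega> (k i) t"
          unfolding modular_commute[of "\<lambda>x. h (k (Suc i)) (x, t)"] by (rule d_\<omega>) (simp add: k_mono)
      qed auto
      finally show "modular (\<lambda>x. 2^i * ?D i (x, t)) \<le> ennreal (4^i) * \<omega> (k i) t" .
    qed
    also have "\<dots> = ennreal (4^i) * (\<integral>\<^sup>+t. \<omega> (k i) t \<partial>lborel)" by (rule nn_integral_cmult) measurable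
    also have "\<dots> \<le> ennreal (4^i) * ennreal ((1/8)^i)" using N[OF k_N] by (intro mult_left_mono) (auto intro: less_imp_le)
    also have "\<dots> = ennreal ((1/2)^i)"
      by (simp add: ennreal_mult'[symmetric] power_mult_distrib[symmetric] del: power_divide)
    finally show ?thesis .
  qed
  have "(\<integral>\<^sup>+t. \<integral>\<^sup>+x. S (x, t) \<partial>lborel \<partial>lborel) = (\<integral>\<^sup>+t. (\<Sum>i. modular (\<lambda>x. 2^i * ?D i (x, t))) \<partial>lborel)"
    unfolding S_def modular_def real_norm_def by (intro nn_integral_cong nn_integral_suminf) measurable
  also have "\<dots> = (\<Sum>i. \<integral>\<^sup>+t. modular (\<lambda>x. 2^i * ?D i (x, t)) \<partial>lborel)"
    unfolding modular_def by (rule nn_integral_suminf) measurable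
  also have "\<dots> \<le> (\<Sum>i. ennreal ((1/2)^i))" by (intro suminf_le scaled_le) auto
  also have "\<dots> = ennreal (\<Sum>i. (1/2)^i)" by (rule suminf_ennreal2) (auto intro: summable_geometric)
  also have "\<dots> < \<infinity>" by simp
  finally have "AE t in lborel. (\<integral>\<^sup>+x. S (x, t) \<partial>lborel) \<noteq> \<infinity>"
    by (intro nn_integral_PInf_AE) auto
  then have S_fin: "AE t in lborel. AE x in lborel. S (x, t) \<noteq> \<infinity>"
    by eventually_elim (intro nn_integral_PInf_AE, auto)
  have conv: "convergent (\<lambda>i. h (k i) z)" if Sz: "S z \<noteq> \<infinity>" for z
  proof -
    obtain s where s: "S z = ennreal s" "0 \<le> s" using Sz by (cases "S z") auto
    have bd: "\<bar>?D i z\<bar> \<le> s powr (2/3) * (1/2)^i" for i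
    proof -
      have "ennreal (\<bar>2^i * ?D i z\<bar> powr (3/2)) \<le> S z"
        unfolding S_def by (rule le_suminf_ennreal)
      then have "\<bar>2^i * ?D i z\<bar> powr (3/2) \<le> s" using s by simp
      then have "(\<bar>2^i * ?D i z\<bar> powr (3/2)) powr (2/3) \<le> s powr (2/3)" by (intro powr_mono2) auto
      then have "2^i * \<bar>?D i z\<bar> \<le> s powr (2/3)" by (simp add: powr_powr abs_mult)
      then show ?thesis by (simp add: power_one_over pos_le_divide_eq mult.commute)
    qed
    have "summable (\<lambda>i. ?D i z)"
      by (rule summable_comparison_test[where g = "\<lambda>i. s powr (2/3) * (1/2)^i"])
         (use bd in \<open>auto intro!: summable_mult summable_geometric\<close>)
    then have "convergent (\<lambda>n. \<Sum>i<n. ?D i z)" by (simp add: summable_iff_convergent)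
    then have "convergent (\<lambda>n. h (k n) z - h (k 0) z)" by (simp only: sum_lessThan_telescope[of "\<lambda>i. h (k i) z"])
    then obtain l where "(\<lambda>n. h (k n) z - h (k 0) z) \<longlonglongrightarrow> l" by (auto simp: convergent_def)
    from tendsto_add[OF this tendsto_const[of "h (k 0) z"]] show ?thesis by (auto simp: convergent_def)
  qed
  define H where "H z = lim (\<lambda>i. h (k i) z)" for z
  have Hm [measurable]: "H \<in> borel_measurable (borel \<Otimes>\<^sub>M borel)"
    unfolding H_def by (rule borel_measurable_lim_metric) measurable
  \<comment> \<open>Fatou along the subsequence: the distance of a truncation to H inherits the
    oscillation bound.\<close>
  have H_close: "modular (\<lambda>x. h (k i) (x, t) - H (x, t)) \<le> \<omega> (k i) t" if t: "AE x in lborel. S (x, t) \<noteq> \<infinity>" for i t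
  proof (rule modular_Fatou[where f = "\<lambda>l x. h (k i) (x, t) - h (k l) (x, t)"])
    show "AE x in lborel. (\<lambda>l. h (k i) (x, t) - h (k l) (x, t)) \<longlonglongrightarrow> h (k i) (x, t) - H (x, t)"
      using t
    proof eventually_elim
      case (elim x)
      show ?case by (intro tendsto_diff tendsto_const) (use conv[OF elim] in \<open>simp add: H_def convergent_LIMSEQ_iff\<close>)
    qed
    show "\<forall>\<^sub>F l in sequentially. modular (\<lambda>x. h (k i) (x, t) - h (k l) (x, t)) \<le> \<omega> (k i) t"
      unfolding eventually_sequentially by (intro exI[of _ i] allI impI d_\<omega> k_mono)
  qed measurable
  show ?thesis
  proof (rule that[OF Hm])
    have "AE t in lborel. modular (\<lambda>x. H (x, t)) \<le> 3 * (ennreal riesz_const * modular (g t) + ennreal riesz_const * modular (g t))"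
      using good S_fin
    proof eventually_elim
      case (elim t)
      have "modular (\<lambda>x. H (x, t)) = modular (\<lambda>x. h (k 0) (x, t) - (h (k 0) (x, t) - H (x, t)))" by simp
      also have "\<dots> \<le> 3 * (modular (\<lambda>x. h (k 0) (x, t)) + modular (\<lambda>x. h (k 0) (x, t) - H (x, t)))"
        by (rule modular_diff_le) measurable
      also have "\<dots> \<le> 3 * (ennreal riesz_const * modular (g t) + ennreal riesz_const * modular (g t))"
      proof (intro mult_left_mono add_mono)
        show "modular (\<lambda>x. h (k 0) (x, t)) \<le> ennreal riesz_const * modular (g t)"
          unfolding hs by (rule modular_riesz_trunc_le[OF gm elim(1) e0])
        show "modular (\<lambda>x. h (k 0) (x, t) - H (x, t)) \<le> ennreal riesz_const * modular (g t)"
          by (rule order_trans[OF H_close[OF elim(2)] \<omega>_bd[OF elim(1)]])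
      qed auto
      finally show ?case .
    qed
    then have "(\<integral>\<^sup>+t. modular (\<lambda>x. H (x, t)) \<partial>lborel) \<le> (\<integral>\<^sup>+t. ennreal (6 * riesz_const) * modular (g t) \<partial>lborel)"
      unfolding six_times_ennreal[OF riesz_const_nonneg] by (rule nn_integral_mono_AE)
    also have "\<dots> = ennreal (6 * riesz_const) * (\<integral>\<^sup>+t. modular (g t) \<partial>lborel)" by (rule nn_integral_cmult) measurable
    also have "\<dots> < \<infinity>" using fin by (simp add: g_def ennreal_mult_less_top)
    finally show "(\<integral>\<^sup>+t. modular (\<lambda>x. H (x, t)) \<partial>lborel) < \<infinity>" .
    show "AE t in lborel. ((\<lambda>\<epsilon>. modular (\<lambda>x. riesz_trunc j \<epsilon> (\<lambda>y. G (y, t)) x - H (x, t))) \<longlongrightarrow> 0) (at_right 0)"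
      using good S_fin
    proof eventually_elim
      case (elim t)
      show ?case
      proof (rule tendsto_0_if_small)
        fix \<eta> :: real assume \<eta>: "0 < \<eta>"
        then have \<eta>6: "0 < \<eta> / 6" by simp
        obtain \<delta> where \<delta>: "0 < \<delta>" "\<And>\<epsilon> \<delta>'. 0 < \<epsilon> \<Longrightarrow> \<epsilon> < \<delta>' \<Longrightarrow> \<delta>' < \<delta> \<Longrightarrow>
            modular (\<lambda>x. riesz_trunc j \<epsilon> (g t) x - riesz_trunc j \<delta>' (g t) x) \<le> ennreal (\<eta> / 6)"
          using riesz_cauchy[OF gm elim(1), of j] \<eta>6 unfolding riesz_cauchy_def by meson
        have "\<forall>\<^sub>F n in sequentially. e n < \<delta> \<and> \<omega> n t < ennreal (\<eta> / 6)"
          by (intro eventually_conj order_tendstoD(2)[OF e_lim \<delta>(1)] order_tendstoD(2)[OF \<omega>_lim[OF elim(1)]])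
             (use \<eta>6 in simp)
        then obtain n where n: "\<And>m. n \<le> m \<Longrightarrow> e m < \<delta> \<and> \<omega> m t < ennreal (\<eta> / 6)" by (auto simp: eventually_sequentially)
        \<comment> \<open>The radius \<open>e (k n)\<close> is the intermediary between an arbitrary
          smaller \<epsilon> and H. The Cauchy criterion covers the first distance and the
          oscillation the second, each at most \<eta> / 6, which the constant 3 turns into
          \<eta>.\<close>
        have en: "e (k n) < \<delta>" "\<omega> (k n) t < ennreal (\<eta> / 6)" using n[OF k_ge] by auto
        show "\<forall>\<^sub>F \<epsilon> in at_right 0. modular (\<lambda>x. riesz_trunc j \<epsilon> (\<lambda>y. G (y, t)) x - H (x, t)) \<le> ennreal \<eta>"
          unfolding eventually_at_right_field
        proof (intro exI[of _ "e (k n)"] conjI allI impI e0)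
          fix \<epsilon> :: real assume \<epsilon>: "0 < \<epsilon>" "\<epsilon> < e (k n)"
          have "modular (\<lambda>x. riesz_trunc j \<epsilon> (\<lambda>y. G (y, t)) x - H (x, t))
             = modular (\<lambda>x. (riesz_trunc j \<epsilon> (g t) x - riesz_trunc j (e (k n)) (g t) x) + (h (k n) (x, t) - H (x, t)))"
            by (simp add: h_def g_def)
          also have "\<dots> \<le> 3 * (modular (\<lambda>x. riesz_trunc j \<epsilon> (g t) x - riesz_trunc j (e (k n)) (g t) x) + modular (\<lambda>x. h (k n) (x, t) - H (x, t)))"
            by (rule modular_add_le) measurable
          also have "\<dots> \<le> 3 * (ennreal (\<eta> / 6) + ennreal (\<eta> / 6))"
            using \<delta>(2)[OF \<epsilon> en(1)] order_trans[OF H_close[OF elim(2), of n] less_imp_le[OF en(2)]]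
            by (intro mult_left_mono add_mono) auto
          also have "\<dots> = ennreal \<eta>" using six_times_ennreal[of "\<eta> / 6" 1] \<eta> by simp
          finally show "modular (\<lambda>x. riesz_trunc j \<epsilon> (\<lambda>y. G (y, t)) x - H (x, t)) \<le> ennreal \<eta>" .
        qed
      qed
    qed
  qed
qed

section \<open>Test functions\<close>

text \<open>The powers of 1/s beside the classical exp (-1/s) make the family closed under
  differentiation: the derivative of the k-th member combines the members k + 1 and k + 2. An
  induction over all \<open>k\<close> at once then gives smoothness.\<close>

definition flat :: "nat \<Rightarrow> real \<Rightarrow> real" where
  "flat k s = (if 0 < s then (1 / s) ^ k * exp (- (1 / s)) else 0)"

text \<open>Since \<open>flat k 0 = 0\<close>, this is the difference quotient at the origin; on the
  right, u = 1/s turns it into u^(k+1) / exp u.\<close>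

lemma flat_div_tendsto_0: "((\<lambda>s. flat k s / s) \<longlongrightarrow> 0) (at 0)"
proof -
  have "((\<lambda>u::real. u ^ Suc k / exp u) \<longlongrightarrow> 0) at_top" by (rule tendsto_power_div_exp_0)
  moreover have "filterlim (\<lambda>s::real. 1 / s) at_top (at_right 0)"
    using filterlim_inverse_at_top_right by (simp add: inverse_eq_divide)
  ultimately have "((\<lambda>s::real. (1 / s) ^ Suc k / exp (1 / s)) \<longlongrightarrow> 0) (at_right 0)"
    by (rule filterlim_compose)
  moreover have "\<forall>\<^sub>F s in at_right 0. (1 / s) ^ Suc k / exp (1 / s) = flat k s / s"
    unfolding eventually_at_right_field
    by (intro exI[of _ 1]) (auto simp: flat_def exp_minus field_simps)
  ultimately have "((\<lambda>s. flat k s / s) \<longlongrightarrow> 0) (at_right 0)"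
    by (simp add: tendsto_cong)
  moreover have "((\<lambda>s. flat k s / s) \<longlongrightarrow> 0) (at_left 0)"
  proof (rule tendsto_eventually)
    show "\<forall>\<^sub>F s in at_left 0. flat k s / s = 0"
      unfolding eventually_at_left_field by (intro exI[of _ "-1"]) (auto simp: flat_def)
  qed
  ultimately show ?thesis by (simp add: filterlim_split_at)
qed

lemma flat_has_derivative:
  "(flat k has_real_derivative (flat (k + 2) s - real k * flat (k + 1) s)) (at s)"
proof -
  consider "0 < s" | "s < 0" | "s = 0" by linarith
  then show ?thesis
  proof cases
    case 1
    have "((\<lambda>s. (1 / s) ^ k * exp (- (1 / s))) has_real_derivative (flat (k + 2) s - real k * flat (k + 1) s)) (at s)"
    proof (cases k)
      case 0
      then show ?thesis using 1
        by (auto intro!: derivative_eq_intros simp: flat_def power2_eq_square field_simps)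
    next
      case (Suc m)
      then show ?thesis using 1
        by (auto intro!: derivative_eq_intros simp: flat_def power2_eq_square divide_simps) (cases m; simp add: algebra_simps)
    qed
    moreover have "\<forall>\<^sub>F x in nhds s. flat k x = (1 / x) ^ k * exp (- (1 / x))"
      by (rule eventually_mono[OF eventually_nhds_in_open[of "{0<..}"]]) (use 1 in \<open>auto simp: flat_def\<close>)
    ultimately show ?thesis by (subst DERIV_cong_ev[OF refl _ refl]) auto
  next
    case 2
    have "\<forall>\<^sub>F x in nhds s. flat k x = 0"
      by (rule eventually_mono[OF eventually_nhds_in_open[of "{..<0}"]]) (use 2 in \<open>auto simp: flat_def\<close>)
    moreover have "((\<lambda>_. 0::real) has_real_derivative (flat (k + 2) s - real k * flat (k + 1) s)) (at s)"
      using 2 by (auto simp: flat_def)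
    ultimately show ?thesis by (subst DERIV_cong_ev[OF refl _ refl]) auto
  next
    case 3
    then show ?thesis
      using flat_div_tendsto_0[of k] by (simp add: DERIV_def flat_def[of _ 0])
  qed
qed

section \<open>Calculus of \<open>Ck\<close> functions\<close>

lemma Ck_Suc_D: "Ck (Suc k) f \<Longrightarrow> Ck k f"
proof (induction k arbitrary: f)
  case 0
  then show ?case by (auto intro!: continuous_at_imp_continuous_on differentiable_imp_continuous_within)
next
  case (Suc k)
  then show ?case by (metis Ck.simps(2))
qed

lemma dd_eqI: "(f has_derivative f') (at x) \<Longrightarrow> dd b f x = f' b"
  unfolding dd_def by (simp add: frechet_derivative_at[symmetric])

lemma Ck_const: "Ck k (\<lambda>x. c)"
proof (induction k arbitrary: c)
  case (Suc k)
  have "dd b (\<lambda>x. c) = (\<lambda>x. 0)" for b :: 'a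
    by (rule ext, rule dd_eqI[OF has_derivative_const])
  then show ?case using Suc by simp
qed simp

lemma dd_has_derivative: "f differentiable (at x) \<Longrightarrow> (f has_derivative (\<lambda>b. dd b f x)) (at x)"
  unfolding dd_def by (simp add: frechet_derivative_works[symmetric])

lemma Ck_add:
  assumes "Ck k f" "Ck k g"
  shows "Ck k (\<lambda>x. f x + g x)"
  using assms
proof (induction k arbitrary: f g)
  case 0
  then show ?case by (auto intro!: continuous_intros)
next
  case (Suc k)
  have d: "f differentiable (at x)" "g differentiable (at x)" for x using Suc.prems by auto
  have "dd b (\<lambda>x. f x + g x) = (\<lambda>x. dd b f x + dd b g x)" for b
    by (rule ext, rule dd_eqI[OF has_derivative_add[OF dd_has_derivative[OF d(1)] dd_has_derivative[OF d(2)]]])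
  then show ?case using Suc d by auto
qed

lemma Ck_mult:
  assumes "Ck k f" "Ck k g"
  shows "Ck k (\<lambda>x. f x * g x)"
  using assms
proof (induction k arbitrary: f g)
  case 0
  then show ?case by (auto intro!: continuous_intros)
next
  case (Suc k)
  have d: "f differentiable (at x)" "g differentiable (at x)" for x using Suc.prems by auto
  have "dd b (\<lambda>x. f x * g x) = (\<lambda>x. f x * dd b g x + dd b f x * g x)" for b
    by (rule ext, rule dd_eqI[OF has_derivative_mult[OF dd_has_derivative[OF d(1)] dd_has_derivative[OF d(2)]]])
  moreover have "Ck k (\<lambda>x. f x * dd b g x + dd b f x * g x)" if "b \<in> Basis" for b
    by (intro Ck_add Suc.IH) (use Suc.prems that in \<open>auto intro: Ck_Suc_D\<close>)
  ultimately show ?case using d by (auto intro: differentiable_mult)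
qed

lemma Ck_prod:
  assumes "finite I" "\<And>i. i \<in> I \<Longrightarrow> Ck k (f i)"
  shows "Ck k (\<lambda>x. \<Prod>i\<in>I. f i x)"
  using assms by (induction I) (auto intro: Ck_const Ck_mult)

lemma Ck_flat_affine: "Ck n (\<lambda>x. flat k (c \<bullet> x + d))"
proof (induction n arbitrary: k)
  case 0
  have "continuous_on UNIV (flat k)"
    by (intro continuous_at_imp_continuous_on ballI DERIV_isCont[OF flat_has_derivative])
  then have "continuous_on UNIV (flat k \<circ> (\<lambda>x. c \<bullet> x + d))"
    by (intro continuous_on_compose) (auto intro!: continuous_intros elim: continuous_on_subset)
  then show ?case by (simp add: o_def)
next
  case (Suc n)
  have der: "((\<lambda>x. flat k (c \<bullet> x + d)) has_derivative
      (\<lambda>b. (flat (k + 2) (c \<bullet> x + d) - real k * flat (k + 1) (c \<bullet> x + d)) * (c \<bullet> b))) (at x)" for x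
  proof -
    have "((\<lambda>x. c \<bullet> x + d) has_derivative (\<lambda>b. c \<bullet> b)) (at x)" by (auto intro!: derivative_eq_intros)
    moreover have "(flat k has_derivative (*) (flat (k + 2) (c \<bullet> x + d) - real k * flat (k + 1) (c \<bullet> x + d))) (at (c \<bullet> x + d))"
      using flat_has_derivative by (simp add: has_field_derivative_def)
    ultimately show ?thesis using diff_chain_at by (fastforce simp: o_def)
  qed
  have "dd b (\<lambda>x. flat k (c \<bullet> x + d)) = (\<lambda>x. (flat (k + 2) (c \<bullet> x + d) + (- real k) * flat (k + 1) (c \<bullet> x + d)) * (c \<bullet> b))" for b
    by (rule ext) (simp add: dd_eqI[OF der])
  moreover have "Ck n (\<lambda>x. (flat (k + 2) (c \<bullet> x + d) + (- real k) * flat (k + 1) (c \<bullet> x + d)) * (c \<bullet> b))" for b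
    by (intro Ck_mult Ck_add Ck_const Suc.IH)
  ultimately show ?case using der by (auto simp: differentiable_def)
qed

section \<open>Smooth bumps approximating open boxes\<close>

definition box_bump :: "nat \<Rightarrow> 'a::euclidean_space \<Rightarrow> 'a \<Rightarrow> 'a \<Rightarrow> real" where
  "box_bump n a b x = (\<Prod>i\<in>Basis. flat 0 (real n * (x \<bullet> i - a \<bullet> i)) * flat 0 (real n * (b \<bullet> i - x \<bullet> i)))"

lemma flat_0_bounds: "0 \<le> flat 0 s" "flat 0 s \<le> 1" by (auto simp: flat_def)

lemma box_bump_bounds: "0 \<le> box_bump n a b x" "box_bump n a b x \<le> 1"
  unfolding box_bump_def
  by (auto intro!: prod_nonneg prod_le_1 mult_nonneg_nonneg mult_le_one simp: flat_0_bounds)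

lemma box_bump_eq_0: "x \<notin> box a b \<Longrightarrow> box_bump n a b x = 0"
  unfolding box_bump_def box_def
  by (auto intro!: prod_zero simp: flat_def zero_less_mult_iff)

text \<open>Scaling the argument by n drives exp (-1 / (n s)) to 1 for each s > 0, while outside the
  open box some factor is 0 for every n; the approximants thus never leave the box.\<close>

lemma box_bump_tendsto:
  "(\<lambda>n. box_bump n a b x) \<longlonglongrightarrow> indicator (box a b) x"
proof (cases "x \<in> box a b")
  case True
  have f: "(\<lambda>n. flat 0 (real n * s)) \<longlonglongrightarrow> 1" if s: "0 < s" for s
  proof -
    have "(\<lambda>n. exp (- (1 / real n * (1 / s)))) \<longlonglongrightarrow> exp (- (0 * (1 / s)))"
      by (intro tendsto_exp tendsto_minus tendsto_mult lim_1_over_n tendsto_const)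
    moreover have "\<forall>\<^sub>F n in sequentially. exp (- (1 / real n * (1 / s))) = flat 0 (real n * s)"
      unfolding eventually_sequentially using s by (intro exI[of _ 1]) (auto simp: flat_def)
    ultimately show ?thesis by (simp add: tendsto_cong)
  qed
  have "(\<lambda>n. box_bump n a b x) \<longlonglongrightarrow> (\<Prod>i\<in>(Basis::'a set). 1 * 1)"
    unfolding box_bump_def by (intro tendsto_prod tendsto_mult f) (use True in \<open>auto simp: box_def\<close>)
  then show ?thesis using True by simp
qed (simp add: box_bump_eq_0)

lemma box_bump_Ck: "Ck k (box_bump n a b)"
proof -
  have "Ck k (\<lambda>x. \<Prod>i\<in>Basis. flat 0 ((real n *\<^sub>R i) \<bullet> x + (- real n * (a \<bullet> i))) * flat 0 ((- real n *\<^sub>R i) \<bullet> x + real n * (b \<bullet> i)))"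
    by (intro Ck_prod Ck_mult Ck_flat_affine) auto
  also have "(\<lambda>x. \<Prod>i\<in>Basis. flat 0 ((real n *\<^sub>R i) \<bullet> x + (- real n * (a \<bullet> i))) * flat 0 ((- real n *\<^sub>R i) \<bullet> x + real n * (b \<bullet> i))) = box_bump n a b"
    by (rule ext) (simp add: box_bump_def inner_commute algebra_simps)
  finally show ?thesis .
qed

lemma box_bump_in_Cc_inf:
  assumes "cbox a b \<subseteq> S"
  shows "box_bump n a b \<in> Cc_inf S"
proof -
  have "{x. box_bump n a b x \<noteq> 0} \<subseteq> cbox a b"
    using box_bump_eq_0[of _ a b n] box_subset_cbox[of a b] by blast
  then have s: "supp (box_bump n a b) \<subseteq> cbox a b"
    unfolding supp_def by (rule closure_minimal) (rule closed_cbox)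
  moreover have "compact (supp (box_bump n a b))"
    using compact_Int_closed[of "cbox a b" "supp (box_bump n a b)"] s compact_cbox
    by (simp add: supp_def Int_absorb1)
  ultimately show ?thesis using assms box_bump_Ck by (auto simp: Cc_inf_def)
qed

lemma Ck_0_continuous: "f \<in> Cc_inf S \<Longrightarrow> continuous_on UNIV f"
  by (auto simp: Cc_inf_def dest: spec[of _ 0])

text \<open>The positive and negative parts are densities of two measures that agree on open boxes,
  an intersection-stable generator, and hence everywhere; equal measures have densities equal almost
  everywhere.\<close>

lemma integral_boxes_zero_imp_AE:
  fixes k :: "'a::euclidean_space \<Rightarrow> real"
  assumes int: "integrable lborel k" and zero: "\<And>a b. (LINT x|lborel. indicator (box a b) x * k x) = 0"
  shows "AE x in lborel. k x = 0"
proof -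
  have [measurable]: "k \<in> borel_measurable borel" using int by auto
  let ?p = "\<lambda>x. max (k x) 0" and ?m = "\<lambda>x. max (- k x) 0"
  have i: "integrable lborel ?p" "integrable lborel ?m" using int by auto
  have meas: "emeasure (density lborel (\<lambda>x. ennreal (f x))) (box a b) = ennreal (LINT x|lborel. indicator (box a b) x * f x)"
    if f: "integrable lborel f" "\<And>x. 0 \<le> f x" for f :: "'a \<Rightarrow> real" and a b :: 'a
  proof -
    have [measurable]: "f \<in> borel_measurable borel" using f(1) by auto
    have "emeasure (density lborel (\<lambda>x. ennreal (f x))) (box a b) = (\<integral>\<^sup>+x. ennreal (indicator (box a b) x * f x) \<partial>lborel)"
      by (subst emeasure_density) (auto intro!: nn_integral_cong simp: indicator_def)
    also have "\<dots> = ennreal (LINT x|lborel. indicator (box a b) x * f x)"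
    proof (rule nn_integral_eq_integral)
      show "integrable lborel (\<lambda>x. indicator (box a b) x * f x)"
        using integrable_mult_indicator[OF _ f(1), of "box a b"] by simp
    qed (use f in auto)
    finally show ?thesis .
  qed
  have eq: "(LINT x|lborel. indicator (box a b) x * ?p x) = (LINT x|lborel. indicator (box a b) x * ?m x)" for a b
  proof -
    have j: "integrable lborel (\<lambda>x. indicator (box a b) x * ?p x)" "integrable lborel (\<lambda>x. indicator (box a b) x * ?m x)"
      using integrable_real_mult_indicator[OF _ i(1), of "box a b"] integrable_real_mult_indicator[OF _ i(2), of "box a b"]
      by (auto simp: mult.commute)
    have "(LINT x|lborel. indicator (box a b) x * ?p x) - (LINT x|lborel. indicator (box a b) x * ?m x)
        = (LINT x|lborel. indicator (box a b) x * ?p x - indicator (box a b) x * ?m x)"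
      by (rule Bochner_Integration.integral_diff[OF j, symmetric])
    also have "\<dots> = (LINT x|lborel. indicator (box a b) x * k x)"
      by (intro Bochner_Integration.integral_cong refl) (auto simp: max_def)
    finally show ?thesis using zero by simp
  qed
  have "density lborel (\<lambda>x. ennreal (?p x)) = density lborel (\<lambda>x. ennreal (?m x))"
  proof (rule measure_eqI_generator_eq[where A = "\<lambda>n::nat. box (- (real n *\<^sub>R One)) (real n *\<^sub>R One)"])
    let ?E = "range (\<lambda>(a, b). box a b :: 'a set)"
    show "Int_stable ?E" by (auto simp: Int_stable_def box_Int_box)
    show "?E \<subseteq> Pow UNIV" by auto
    show "sets (density lborel (\<lambda>x. ennreal (?p x))) = sigma_sets UNIV ?E"
      "sets (density lborel (\<lambda>x. ennreal (?m x))) = sigma_sets UNIV ?E"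
      by (simp_all add: borel_eq_box)
    show "emeasure (density lborel (\<lambda>x. ennreal (?p x))) X = emeasure (density lborel (\<lambda>x. ennreal (?m x))) X" if "X \<in> ?E" for X
      using that by (auto simp: meas[OF i(1)] meas[OF i(2)] eq)
    show "range (\<lambda>n::nat. box (- (real n *\<^sub>R One)) (real n *\<^sub>R One)) \<subseteq> ?E" by auto
    show "(\<Union>n::nat. box (- (real n *\<^sub>R One)) (real n *\<^sub>R One :: 'a)) = UNIV" by (rule UN_box_eq_UNIV)
    show "emeasure (density lborel (\<lambda>x. ennreal (?p x))) (box (- (real n *\<^sub>R One)) (real n *\<^sub>R One)) \<noteq> \<infinity>" for n
      by (simp add: meas[OF i(1)])
  qed
  then have "AE x in lborel. ennreal (?p x) = ennreal (?m x)"
    by (intro sigma_finite_measure.density_unique[OF sigma_finite_lborel]) auto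
  then show ?thesis
    by eventually_elim (auto simp: max_def split: if_splits)
qed

text \<open>Bumps converge to indicators of boxes, so the integral over every box whose closed hull
  lies in S vanishes. This settles the claim on each closed box in S, and countably many such boxes
  cover S.\<close>

lemma fundamental_lemma_calculus_of_variations:
  fixes h :: "'a::euclidean_space \<Rightarrow> real"
  assumes S: "open S" and int: "integrable lborel (\<lambda>x. indicator S x * h x)"
    and zero: "\<And>\<phi>. \<phi> \<in> Cc_inf S \<Longrightarrow> (LINT x|lborel. indicator S x * h x * \<phi> x) = 0"
  shows "AE x in lborel. x \<in> S \<longrightarrow> h x = 0"
proof -
  have mh [measurable]: "(\<lambda>x. indicator S x * h x) \<in> borel_measurable borel" using int by auto
  have box0: "(LINT x|lborel. indicator (box a b) x * (indicator S x * h x)) = 0" if ab: "cbox a b \<subseteq> S" for a b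
  proof -
    have "(\<lambda>n. LINT x|lborel. indicator S x * h x * box_bump n a b x) \<longlonglongrightarrow> (LINT x|lborel. indicator S x * h x * indicator (box a b) x)"
    proof (rule integral_dominated_convergence[where w = "\<lambda>x. norm (indicator S x * h x)"])
      have [measurable]: "box_bump n a b \<in> borel_measurable borel" for n
        by (rule borel_measurable_continuous_onI[OF Ck_0_continuous[OF box_bump_in_Cc_inf[OF ab]]])
      show "(\<lambda>x. indicator S x * h x * box_bump n a b x) \<in> borel_measurable lborel" for n by measurable
      show "(\<lambda>x. indicator S x * h x * indicator (box a b) x) \<in> borel_measurable lborel" by measurable
      show "integrable lborel (\<lambda>x. norm (indicator S x * h x))" by (rule integrable_norm[OF int])
      show "AE x in lborel. (\<lambda>n. indicator S x * h x * box_bump n a b x) \<longlonglongrightarrow> indicator S x * h x * indicator (box a b) x"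
        by (intro AE_I2 tendsto_mult tendsto_const box_bump_tendsto)
      show "AE x in lborel. norm (indicator S x * h x * box_bump n a b x) \<le> norm (indicator S x * h x)" for n
      proof (rule AE_I2)
        fix x
        show "norm (indicator S x * h x * box_bump n a b x) \<le> norm (indicator S x * h x)"
          using mult_left_mono[OF box_bump_bounds(2)[of n a b x], of "norm (indicator S x * h x)"] box_bump_bounds(1)[of n a b x]
          by (simp add: abs_mult)
      qed
    qed
    moreover have "(LINT x|lborel. indicator S x * h x * box_bump n a b x) = 0" for n
      by (rule zero[OF box_bump_in_Cc_inf[OF ab]])
    ultimately have "(LINT x|lborel. indicator S x * h x * indicator (box a b) x) = 0"
      using LIMSEQ_unique[OF tendsto_const] by fastforce
    then show ?thesis by (simp only: mult.commute[of "indicator (box a b) _"])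
  qed
  have cb: "AE x in lborel. x \<in> cbox A B \<longrightarrow> h x = 0" if AB: "cbox A B \<subseteq> S" for A B
  proof -
    have "AE x in lborel. indicator (box A B) x * (indicator S x * h x) = 0"
    proof (rule integral_boxes_zero_imp_AE)
      show "integrable lborel (\<lambda>x. indicator (box A B) x * (indicator S x * h x))"
        using integrable_real_mult_indicator[OF _ int, of "box A B"] by (simp add: mult_ac)
      fix a b
      \<comment> \<open>Intersections of boxes are boxes, but the closed hull must remain inside S.
        If the intersection is empty, a box with reversed corners is used, whose closed hull is
        empty too.\<close>
      obtain c d where cd: "box a b \<inter> box A B = box c d" "cbox c d \<subseteq> cbox A B"
      proof (cases "box a b \<inter> box A B = {}")
        case True
        show ?thesis
        proof (rule that[of One "- One"])
          have "cbox One (- One :: 'a) = {}"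
            unfolding box_eq_empty by (rule bexI[OF _ SOME_Basis]) (simp add: SOME_Basis inner_sum_left inner_Basis)
          then show "box a b \<inter> box A B = box One (- One)" "cbox One (- One) \<subseteq> cbox A B"
            using True box_subset_cbox[of One "- One :: 'a"] by auto
        qed
      next
        case False
        define c d where "c = (\<Sum>i\<in>Basis. max (a \<bullet> i) (A \<bullet> i) *\<^sub>R i)" and "d = (\<Sum>i\<in>Basis. min (b \<bullet> i) (B \<bullet> i) *\<^sub>R i)"
        show ?thesis
        proof (rule that[of c d])
          show "box a b \<inter> box A B = box c d" unfolding c_def d_def by (rule box_Int_box)
          show "cbox c d \<subseteq> cbox A B" unfolding c_def d_def by (auto simp: mem_box)
        qed
      qed
      have "indicator (box a b) x * (indicator (box A B) x * (indicator S x * h x)) = indicator (box c d) x * (indicator S x * h x)" for x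
        unfolding cd(1)[symmetric] by (simp add: indicator_inter_arith mult.assoc)
      then have "(LINT x|lborel. indicator (box a b) x * (indicator (box A B) x * (indicator S x * h x)))
          = (LINT x|lborel. indicator (box c d) x * (indicator S x * h x))"
        by (simp only:)
      also have "\<dots> = 0" by (rule box0[OF order_trans[OF cd(2) AB]])
      finally show "(LINT x|lborel. indicator (box a b) x * (indicator (box A B) x * (indicator S x * h x))) = 0" .
    qed
    \<comment> \<open>The argument on open boxes says nothing about the faces, which are null
      because open and closed box have the same volume.\<close>
    moreover have "AE x in lborel. x \<notin> cbox A B - box A B"
    proof (rule AE_not_in)
      have "emeasure lborel (cbox A B - box A B) = emeasure lborel (cbox A B) - emeasure lborel (box A B)"
        by (rule emeasure_Diff) (use emeasure_lborel_box_finite[of A B] in \<open>auto intro: box_subset_cbox[THEN subsetD]\<close>)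
      also have "\<dots> = 0" by (simp add: emeasure_lborel_cbox_eq emeasure_lborel_box_eq box_ne_empty)
      finally show "cbox A B - box A B \<in> null_sets lborel" by (simp add: null_sets_def)
    qed
    ultimately show ?thesis
      by eventually_elim (use AB in \<open>auto split: split_indicator_asm dest: subsetD\<close>)
  qed
  obtain \<D> where D: "countable \<D>" "\<D> \<subseteq> Pow S" "\<And>X. X \<in> \<D> \<Longrightarrow> \<exists>a b. X = cbox a b" "\<Union>\<D> = S"
    using open_countable_Union_open_cbox[OF S] by metis
  have "AE x in lborel. \<forall>X\<in>\<D>. x \<in> X \<longrightarrow> h x = 0"
    unfolding AE_ball_countable[OF D(1)]
  proof
    fix X assume "X \<in> \<D>"
    then obtain a b where "X = cbox a b" "X \<subseteq> S" using D by blast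
    then show "AE x in lborel. x \<in> X \<longrightarrow> h x = 0" using cb by auto
  qed
  then show ?thesis by eventually_elim (use D(4) in blast)
qed

section \<open>The canonical package\<close>

lemma window_measurable [measurable]: "window \<in> sets borel" by (simp add: window_def)

lemma times_window_measurable [measurable]:
  "S \<in> sets borel \<Longrightarrow> S \<times> window \<in> sets (borel :: spacetime measure)"
  unfolding borel_prod[symmetric] by (rule pair_measureI) auto

lemma Lspace_iff:
  assumes "0 < r"
  shows "f \<in> Lspace r S \<longleftrightarrow> set_borel_measurable lborel S f \<and> (\<integral>\<^sup>+ x\<in>S. ennreal (norm (f x) powr r) \<partial>lborel) < \<infinity>"
  by (simp add: Lspace_def eLnorm_def epowr_less_top_iff)

lemma nn_integral_times_window:
  fixes f :: "spacetime \<Rightarrow> 'b::real_normed_vector"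
  assumes f: "set_borel_measurable lborel (S \<times> window) f" and r: "0 < r"
  shows "(\<integral>\<^sup>+ t\<in>window. (\<integral>\<^sup>+ x\<in>S. ennreal (norm (f (x, t)) powr r) \<partial>lborel) \<partial>lborel)
    = (\<integral>\<^sup>+ z\<in>S \<times> window. ennreal (norm (f z) powr r) \<partial>lborel)"
proof -
  let ?g = "\<lambda>z. indicator (S \<times> window) z *\<^sub>R f z"
  have [measurable]: "?g \<in> borel_measurable (lborel \<Otimes>\<^sub>M lborel)"
    using f by (simp add: set_borel_measurable_def lborel_prod)
  have eq: "ennreal (norm (f z) powr r) * indicator (S \<times> window) z = ennreal (norm (?g z) powr r)" for z
    using r by (auto simp: indicator_def)
  have "(\<integral>\<^sup>+ z\<in>S \<times> window. ennreal (norm (f z) powr r) \<partial>lborel) = (\<integral>\<^sup>+ z. ennreal (norm (?g z) powr r) \<partial>(lborel \<Otimes>\<^sub>M lborel))"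
    by (simp only: eq lborel_prod)
  also have "\<dots> = (\<integral>\<^sup>+ t. \<integral>\<^sup>+ x. ennreal (norm (?g (x, t)) powr r) \<partial>lborel \<partial>lborel)"
    by (rule lborel_pair.nn_integral_snd[symmetric]) measurable
  also have "\<dots> = (\<integral>\<^sup>+ t\<in>window. (\<integral>\<^sup>+ x\<in>S. ennreal (norm (f (x, t)) powr r) \<partial>lborel) \<partial>lborel)"
  proof (rule nn_integral_cong)
    fix t
    show "(\<integral>\<^sup>+ x. ennreal (norm (?g (x, t)) powr r) \<partial>lborel) = (\<integral>\<^sup>+ x\<in>S. ennreal (norm (f (x, t)) powr r) \<partial>lborel) * indicator window t"
      unfolding eq[symmetric] by (cases "t \<in> window") (auto intro!: nn_integral_cong simp: indicator_def)
  qed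
  finally show ?thesis by simp
qed

text \<open>With equal exponents the inner root cancels, and Tonelli identifies the mixed space with
  the ordinary one on the product. Closure properties of \<open>Lspace\<close> thereby pass to
  \<open>X_src\<close>, \<open>Y_prs\<close> and \<open>Y_harm\<close>.\<close>

lemma LLspace_eq_Lspace: "0 < r \<Longrightarrow> LLspace r r S = Lspace r (S \<times> window)"
  by (auto simp: LLspace_def Lspace_iff eLLnorm_same_exponent epowr_less_top_iff nn_integral_times_window)

lemma LLspace_imp_eLLnorm_finite: "f \<in> LLspace q r S \<Longrightarrow> eLLnorm q r S f < \<infinity>"
  by (simp add: LLspace_def)

lemma Lspace_mono:
  fixes f :: "'a::euclidean_space \<Rightarrow> 'b::{banach, second_countable_topology}"
  assumes "f \<in> Lspace r T" "S \<subseteq> T" "S \<in> sets borel" "0 < r"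
  shows "f \<in> Lspace r S"
proof -
  have "(\<integral>\<^sup>+ x\<in>S. ennreal (norm (f x) powr r) \<partial>lborel) \<le> (\<integral>\<^sup>+ x\<in>T. ennreal (norm (f x) powr r) \<partial>lborel)"
    by (intro nn_integral_mono mult_left_mono) (use assms(2) in \<open>auto simp: indicator_def\<close>)
  then show ?thesis
    using assms set_borel_measurable_subset[of lborel T f S] by (auto simp: Lspace_iff intro: le_less_trans)
qed

lemma Lspace_add:
  fixes f g :: "'a::euclidean_space \<Rightarrow> 'b::{real_normed_vector, second_countable_topology}"
  assumes f: "f \<in> Lspace r S" and g: "g \<in> Lspace r S" and r: "0 < r"
  shows "(\<lambda>x. f x + g x) \<in> Lspace r S"
proof -
  let ?f = "\<lambda>x. indicator S x *\<^sub>R f x" and ?g = "\<lambda>x. indicator S x *\<^sub>R g x"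
  have [measurable]: "?f \<in> borel_measurable borel" "?g \<in> borel_measurable borel"
    using f g by (auto simp: Lspace_def set_borel_measurable_def)
  have I: "(\<integral>\<^sup>+ x\<in>S. ennreal (norm (h x) powr r) \<partial>lborel) = (\<integral>\<^sup>+ x. ennreal (norm (indicator S x *\<^sub>R h x) powr r) \<partial>lborel)"
    for h :: "'a \<Rightarrow> 'b"
    by (intro nn_integral_cong) (use r in \<open>auto simp: indicator_def\<close>)
  have "(\<integral>\<^sup>+ x\<in>S. ennreal (norm (f x + g x) powr r) \<partial>lborel)
     \<le> (\<integral>\<^sup>+ x. ennreal (2 powr r) * (ennreal (norm (?f x) powr r) + ennreal (norm (?g x) powr r)) \<partial>lborel)"
    unfolding I
  proof (rule nn_integral_mono)
    fix x
    have "norm (indicator S x *\<^sub>R (f x + g x)) \<le> norm (?f x) + norm (?g x)"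
      unfolding scaleR_add_right by (rule norm_triangle_ineq)
    also have "\<dots> \<le> 2 * max (norm (?f x)) (norm (?g x))" by (simp add: max_def)
    finally have "norm (indicator S x *\<^sub>R (f x + g x)) powr r \<le> (2 * max (norm (?f x)) (norm (?g x))) powr r"
      by (intro powr_mono2) (use r in auto)
    also have "\<dots> = 2 powr r * max (norm (?f x)) (norm (?g x)) powr r" by (subst powr_mult) auto
    also have "\<dots> \<le> 2 powr r * (norm (?f x) powr r + norm (?g x) powr r)"
      by (intro mult_left_mono) (auto simp: max_def)
    finally have "ennreal (norm (indicator S x *\<^sub>R (f x + g x)) powr r) \<le> ennreal (2 powr r * (norm (?f x) powr r + norm (?g x) powr r))"
      by (rule ennreal_leI)
    also have "\<dots> = ennreal (2 powr r) * (ennreal (norm (?f x) powr r) + ennreal (norm (?g x) powr r))"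
      by (subst ennreal_mult) auto
    finally show "ennreal (norm (indicator S x *\<^sub>R (f x + g x)) powr r)
       \<le> ennreal (2 powr r) * (ennreal (norm (?f x) powr r) + ennreal (norm (?g x) powr r))" .
  qed
  also have "\<dots> = ennreal (2 powr r) * ((\<integral>\<^sup>+ x. ennreal (norm (?f x) powr r) \<partial>lborel) + (\<integral>\<^sup>+ x. ennreal (norm (?g x) powr r) \<partial>lborel))"
    by (subst nn_integral_cmult, measurable) (subst nn_integral_add, measurable)
  also have "\<dots> < \<infinity>"
    using f g r unfolding Lspace_iff[OF r] I by (simp add: ennreal_mult_less_top)
  finally show ?thesis
    unfolding Lspace_iff[OF r] set_borel_measurable_def scaleR_add_right by simp
qed

lemma Lspace_uminus:
  fixes f :: "'a::euclidean_space \<Rightarrow> 'b::{real_normed_vector, second_countable_topology}"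
  shows "f \<in> Lspace r S \<Longrightarrow> (\<lambda>x. - f x) \<in> Lspace r S"
  by (auto simp: Lspace_def eLnorm_def set_borel_measurable_def intro: borel_measurable_uminus)

lemma Lspace_diff:
  fixes f g :: "'a::euclidean_space \<Rightarrow> 'b::{real_normed_vector, second_countable_topology}"
  assumes "f \<in> Lspace r S" "g \<in> Lspace r S" "0 < r"
  shows "(\<lambda>x. f x - g x) \<in> Lspace r S"
  using Lspace_add[OF assms(1) Lspace_uminus[OF assms(2)] assms(3)] by simp

lemma Lspace_zero: "0 < r \<Longrightarrow> (\<lambda>x. 0) \<in> Lspace r S"
  by (simp add: Lspace_iff set_borel_measurable_def)

lemma Lspace_sum:
  fixes f :: "'i \<Rightarrow> 'a::euclidean_space \<Rightarrow> 'b::{real_normed_vector, second_countable_topology}"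
  assumes "finite I" "\<And>i. i \<in> I \<Longrightarrow> f i \<in> Lspace r S" "0 < r"
  shows "(\<lambda>x. \<Sum>i\<in>I. f i x) \<in> Lspace r S"
  using assms by (induction I) (auto intro: Lspace_zero Lspace_add)

text \<open>Membership says nothing about G outside the window; extending by 0 gives a globally
  Borel function with a finite integral over all times, as the existence result requires.\<close>

lemma LLspace_UNIV_slice:
  fixes G :: "spacetime \<Rightarrow> real"
  assumes G: "G \<in> LLspace (3/2) (3/2) UNIV"
  defines "G' \<equiv> \<lambda>z. indicator (UNIV \<times> window) z *\<^sub>R G z"
  shows "G' \<in> borel_measurable (borel \<Otimes>\<^sub>M borel)" "(\<integral>\<^sup>+t. modular (\<lambda>x. G' (x, t)) \<partial>lborel) < \<infinity>"
    "t \<in> window \<Longrightarrow> G' (x, t) = G (x, t)"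
proof -
  show m: "G' \<in> borel_measurable (borel \<Otimes>\<^sub>M borel)"
    using G by (simp add: LLspace_def set_borel_measurable_def G'_def borel_prod)
  show "t \<in> window \<Longrightarrow> G' (x, t) = G (x, t)" by (simp add: G'_def)
  have "(\<integral>\<^sup>+t. modular (\<lambda>x. G' (x, t)) \<partial>lborel) = (\<integral>\<^sup>+ t\<in>window. (\<integral>\<^sup>+ x\<in>UNIV. ennreal (norm (G (x, t)) powr (3/2)) \<partial>lborel) \<partial>lborel)"
    unfolding modular_def G'_def by (intro nn_integral_cong) (simp add: indicator_def)
  also have "\<dots> < \<infinity>"
    using G by (simp add: LLspace_def eLLnorm_same_exponent epowr_less_top_iff)
  finally show "(\<integral>\<^sup>+t. modular (\<lambda>x. G' (x, t)) \<partial>lborel) < \<infinity>" .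
qed

text \<open>Existence comes from the space-time construction applied to the cut-off function, whose
  slices agree with those of G at times in the window. Any two admissible limits agree slice by
  slice, and Tonelli turns this into agreement almost everywhere in space-time.\<close>

lemma riesz_defined:
  assumes G: "G \<in> LLspace (3/2) (3/2) UNIV"
  shows "riesz_defined j G"
proof -
  let ?G = "\<lambda>z. indicator (UNIV \<times> window) z *\<^sub>R G z"
  note S = LLspace_UNIV_slice[OF G]
  obtain H where H: "H \<in> borel_measurable (borel \<Otimes>\<^sub>M borel)" "(\<integral>\<^sup>+t. modular (\<lambda>x. H (x, t)) \<partial>lborel) < \<infinity>"
    "AE t in lborel. ((\<lambda>\<epsilon>. modular (\<lambda>x. riesz_trunc j \<epsilon> (\<lambda>y. ?G (y, t)) x - H (x, t))) \<longlongrightarrow> 0) (at_right 0)"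
    using space_time_riesz_exists[OF S(1,2)] by blast
  have "is_riesz j G H"
    unfolding is_riesz_def
  proof (intro conjI)
    have "set_borel_measurable lborel (UNIV \<times> window) H"
      using H(1) times_window_measurable[of UNIV] by (simp add: set_borel_measurable_def borel_prod)
    moreover have "(\<integral>\<^sup>+ t\<in>window. (\<integral>\<^sup>+ x\<in>UNIV. ennreal (norm (H (x, t)) powr (3/2)) \<partial>lborel) \<partial>lborel) < \<infinity>"
      by (rule le_less_trans[OF nn_integral_mono H(2)]) (auto simp: modular_def indicator_def)
    ultimately show "H \<in> LLspace (3/2) (3/2) UNIV"
      by (simp add: LLspace_def eLLnorm_same_exponent epowr_less_top_iff)
    show "AE t in lborel. t \<in> window \<longrightarrow>
        ((\<lambda>\<epsilon>. eLnorm (3/2) UNIV (\<lambda>x. riesz_trunc j \<epsilon> (\<lambda>y. G (y, t)) x - H (x, t))) \<longlongrightarrow> 0) (at_right 0)"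
      using H(3)
    proof eventually_elim
      case (elim t)
      show ?case
      proof
        assume "t \<in> window"
        then have "(\<lambda>y. ?G (y, t)) = (\<lambda>y. G (y, t))" by (intro ext S(3))
        with elim show "((\<lambda>\<epsilon>. eLnorm (3/2) UNIV (\<lambda>x. riesz_trunc j \<epsilon> (\<lambda>y. G (y, t)) x - H (x, t))) \<longlongrightarrow> 0) (at_right 0)"
          by (simp only: tendsto_eLnorm_iff_modular)
      qed
    qed
  qed (rule G)
  then have ex: "is_riesz j G (riesz j G)" unfolding riesz_def by (rule someI[of "is_riesz j G"])
  moreover have "AE z in lborel. snd z \<in> window \<longrightarrow> H' z = riesz j G z" if H': "is_riesz j G H'" for H'
  proof -
    \<comment> \<open>Cut off outside the window, both candidates are globally Borel, so that the
      exceptional sets can be treated by Tonelli.\<close>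
    define A B where "A = (\<lambda>z. indicator (UNIV \<times> window) z *\<^sub>R H' z)"
      and "B = (\<lambda>z. indicator (UNIV \<times> window) z *\<^sub>R riesz j G z)"
    have LH: "H' \<in> LLspace (3/2) (3/2) UNIV" "riesz j G \<in> LLspace (3/2) (3/2) UNIV"
      using H' ex by (auto simp: is_riesz_def)
    have [measurable]: "A \<in> borel_measurable (borel \<Otimes>\<^sub>M borel)" "B \<in> borel_measurable (borel \<Otimes>\<^sub>M borel)"
      unfolding A_def B_def by (rule LLspace_UNIV_slice(1)[OF LH(1)], rule LLspace_UNIV_slice(1)[OF LH(2)])
    have AB: "A (x, t) = H' (x, t)" "B (x, t) = riesz j G (x, t)" if "t \<in> window" for x t
      using that by (simp_all add: A_def B_def)
    have AB0: "A (x, t) = 0" "B (x, t) = 0" if "t \<notin> window" for x t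
      using that by (simp_all add: A_def B_def)
    have "AE t in lborel. modular (\<lambda>x. A (x, t) - B (x, t)) = 0"
      using H'[unfolded is_riesz_def, THEN conjunct2, THEN conjunct2] ex[unfolded is_riesz_def, THEN conjunct2, THEN conjunct2]
    proof eventually_elim
      case (elim t)
      show ?case
      proof (cases "t \<in> window")
        case True
        then have g: "(\<lambda>y. G (y, t)) = (\<lambda>y. ?G (y, t))" by (intro ext S(3)[symmetric])
        show ?thesis
        proof (rule riesz_limit_unique[where j = j and g = "\<lambda>y. G (y, t)"])
          show "(\<lambda>y. G (y, t)) \<in> borel_measurable borel"
            unfolding g by (rule measurable_compose[OF measurable_Pair2' S(1)]) simp
          show "((\<lambda>\<epsilon>. modular (\<lambda>x. riesz_trunc j \<epsilon> (\<lambda>y. G (y, t)) x - A (x, t))) \<longlongrightarrow> 0) (at_right 0)"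
            unfolding AB(1)[OF True] using elim(1) True by (simp only: tendsto_eLnorm_iff_modular)
          show "((\<lambda>\<epsilon>. modular (\<lambda>x. riesz_trunc j \<epsilon> (\<lambda>y. G (y, t)) x - B (x, t))) \<longlongrightarrow> 0) (at_right 0)"
            unfolding AB(2)[OF True] using elim(2) True by (simp only: tendsto_eLnorm_iff_modular)
        qed measurable
      qed (simp add: AB0 modular_def)
    qed
    moreover have "(\<lambda>t. modular (\<lambda>x. A (x, t) - B (x, t))) \<in> borel_measurable lborel"
      unfolding modular_def by measurable
    ultimately have "(\<integral>\<^sup>+t. modular (\<lambda>x. A (x, t) - B (x, t)) \<partial>lborel) = 0"
      by (simp add: nn_integral_0_iff_AE)
    then have "(\<integral>\<^sup>+z. ennreal (norm (A z - B z) powr (3/2)) \<partial>(lborel \<Otimes>\<^sub>M lborel)) = 0"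
      unfolding modular_def by (subst lborel_pair.nn_integral_snd[symmetric]) measurable
    then have "AE z in lborel \<Otimes>\<^sub>M lborel. ennreal (norm (A z - B z) powr (3/2)) = 0"
      by (subst (asm) nn_integral_0_iff_AE) measurable
    then have "AE z in lborel. ennreal (norm (A z - B z) powr (3/2)) = 0" by (simp only: lborel_prod)
    then show ?thesis
    proof eventually_elim
      case (elim z)
      then have "\<not> 0 < norm (A z - B z) powr (3/2)" by (simp add: ennreal_eq_0_iff not_less)
      then have "A z = B z" by (simp only: powr_gt_zero norm_eq_zero not_not right_minus_eq)
      then show ?case using AB[of "snd z" "fst z"] by auto
    qed
  qed
  ultimately show ?thesis by (simp add: riesz_defined_def)
qed

section \<open>Uniqueness of the weak gradient\<close>

lemma Q1_open: "open Q1"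
  unfolding Q1_def window_def by (intro open_Times) auto

lemma Q1_measurable [measurable]: "Q1 \<in> sets borel" using Q1_open by simp

lemma Q1_emeasure_finite: "emeasure lborel Q1 < \<infinity>"
  by (rule emeasure_bounded_finite) (auto simp: Q1_def window_def intro!: bounded_Times)

lemma Cc_inf_bounded:
  assumes "\<phi> \<in> Cc_inf S"
  obtains B where "\<And>x. \<bar>\<phi> x\<bar> \<le> B" "0 \<le> B"
proof -
  have "compact (\<phi> ` supp \<phi>)"
    using assms by (intro compact_continuous_image continuous_on_subset[OF Ck_0_continuous[OF assms]]) (auto simp: Cc_inf_def)
  then have "\<exists>B. \<forall>x\<in>supp \<phi>. \<bar>\<phi> x\<bar> \<le> B"
    by (auto dest!: compact_imp_bounded simp: bounded_iff)
  then obtain B where B: "\<And>x. x \<in> supp \<phi> \<Longrightarrow> \<bar>\<phi> x\<bar> \<le> B" by blast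
  have "\<bar>\<phi> x\<bar> \<le> \<bar>B\<bar>" for x
  proof (cases "\<phi> x = 0")
    case False
    then have "x \<in> supp \<phi>" unfolding supp_def by (intro closure_subset[THEN subsetD]) simp
    then show ?thesis using B[of x] by linarith
  qed simp
  then show ?thesis using that[of "\<bar>B\<bar>"] by simp
qed

lemma Lspace_2_Q1_integrable:
  fixes f :: "spacetime \<Rightarrow> real"
  assumes "f \<in> Lspace 2 Q1"
  shows "integrable lborel (\<lambda>z. indicator Q1 z * f z)"
  unfolding integrable_iff_bounded
proof
  show [measurable]: "(\<lambda>z. indicator Q1 z * f z) \<in> borel_measurable lborel"
    using assms by (simp add: Lspace_def set_borel_measurable_def)
  have "(\<integral>\<^sup>+ z. ennreal (norm (indicator Q1 z * f z)) \<partial>lborel)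
     \<le> (\<integral>\<^sup>+ z. indicator Q1 z + ennreal (norm (indicator Q1 z * f z) powr 2) \<partial>lborel)"
  proof (rule nn_integral_mono)
    fix z
    have "\<bar>f z\<bar> \<le> 1 + (f z)\<^sup>2" using zero_le_power2[of "\<bar>f z\<bar> - 1"] by (simp add: power2_diff)
    then have "ennreal \<bar>f z\<bar> \<le> ennreal (1 + (f z)\<^sup>2)" by (rule ennreal_leI)
    then show "ennreal (norm (indicator Q1 z * f z)) \<le> indicator Q1 z + ennreal (norm (indicator Q1 z * f z) powr 2)"
      by (simp add: indicator_def)
  qed
  also have "\<dots> = emeasure lborel Q1 + (\<integral>\<^sup>+ z. ennreal (norm (indicator Q1 z * f z) powr 2) \<partial>lborel)"
    by (subst nn_integral_add) auto
  also have "(\<integral>\<^sup>+ z. ennreal (norm (indicator Q1 z * f z) powr 2) \<partial>lborel) = (\<integral>\<^sup>+ z\<in>Q1. ennreal (norm (f z) powr 2) \<partial>lborel)"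
    by (intro nn_integral_cong) (auto simp: indicator_def)
  also have "emeasure lborel Q1 + \<dots> < \<infinity>" using assms Q1_emeasure_finite by (simp add: Lspace_iff)
  finally show "(\<integral>\<^sup>+ z. ennreal (norm (indicator Q1 z * f z)) \<partial>lborel) < \<infinity>" .
qed

lemma Lspace_nth:
  fixes f :: "'a::euclidean_space \<Rightarrow> 'b::{real_normed_vector, second_countable_topology}^'n::finite"
  assumes f: "f \<in> Lspace r S" and r: "0 < r"
  shows "(\<lambda>x. f x $ i) \<in> Lspace r S"
proof -
  have "(\<integral>\<^sup>+ x\<in>S. ennreal (norm (f x $ i) powr r) \<partial>lborel) \<le> (\<integral>\<^sup>+ x\<in>S. ennreal (norm (f x) powr r) \<partial>lborel)"
    by (intro nn_integral_mono mult_right_mono ennreal_leI powr_mono2 Finite_Cartesian_Product.norm_nth_le) (use r in auto)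
  moreover have "set_borel_measurable lborel S (\<lambda>x. f x $ i)"
  proof -
    have "(\<lambda>x. (indicator S x *\<^sub>R f x) $ i) \<in> borel_measurable lborel"
      by (rule vec_nth_measurable) (use f in \<open>simp add: Lspace_def set_borel_measurable_def\<close>)
    then show ?thesis by (simp add: set_borel_measurable_def)
  qed
  ultimately show ?thesis using f by (auto simp: Lspace_iff[OF r] intro: le_less_trans)
qed

text \<open>Two weak gradients pair with every test function to the same value, minus the integral
  of u_i against its j-th derivative; the fundamental lemma is applied to each of the finitely many
  components of their difference. Square integrability on the bounded set \<open>Q1\<close> gives
  the integrability it needs.\<close>

lemma wgrad_defined:
  assumes "\<exists>G. is_wgrad u G"
  shows "wgrad_defined u"
proof -
  have ex: "is_wgrad u (wgrad u)" using assms unfolding wgrad_def by (rule someI_ex)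
  moreover have "AE z in lborel. z \<in> Q1 \<longrightarrow> G z = wgrad u z" if G: "is_wgrad u G" for G
  proof -
    have comp: "AE z in lborel. z \<in> Q1 \<longrightarrow> G z $ i $ j - wgrad u z $ i $ j = 0" for i j
    proof (rule fundamental_lemma_calculus_of_variations[OF Q1_open])
      have L: "(\<lambda>z. K z $ i $ j) \<in> Lspace 2 Q1" if "is_wgrad u K" for K
        using that LLspace_eq_Lspace[of 2 "ball0 1", where 'a = "real^3^3"]
        by (intro Lspace_nth) (auto simp: is_wgrad_def Q1_def)
      have int: "integrable lborel (\<lambda>z. indicator Q1 z * K z $ i $ j)" if "is_wgrad u K" for K
        by (rule Lspace_2_Q1_integrable[OF L[OF that]])
      show "integrable lborel (\<lambda>z. indicator Q1 z * (G z $ i $ j - wgrad u z $ i $ j))"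
        using Bochner_Integration.integrable_diff[OF int[OF G] int[OF ex]] by (simp add: right_diff_distrib)
      fix \<phi> :: "spacetime \<Rightarrow> real" assume \<phi>: "\<phi> \<in> Cc_inf Q1"
      obtain B where B: "\<And>x. \<bar>\<phi> x\<bar> \<le> B" using Cc_inf_bounded[OF \<phi>] by metis
      have [measurable]: "\<phi> \<in> borel_measurable borel" by (rule borel_measurable_continuous_onI[OF Ck_0_continuous[OF \<phi>]])
      have int2: "integrable lborel (\<lambda>z. indicator Q1 z * K z $ i $ j * \<phi> z)" if K: "is_wgrad u K" for K
      proof (rule integrable_abs_boundI)
        show "integrable lborel (\<lambda>z. norm (indicator Q1 z * K z $ i $ j) * B)"
          by (intro integrable_mult_left integrable_norm int K)
        show "(\<lambda>z. indicator Q1 z * K z $ i $ j * \<phi> z) \<in> borel_measurable lborel"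
          using borel_measurable_integrable[OF int[OF K]] by measurable
        show "\<bar>indicator Q1 z * K z $ i $ j * \<phi> z\<bar> \<le> norm (indicator Q1 z * K z $ i $ j) * B" for z
          unfolding abs_mult[of _ "\<phi> z"] real_norm_def by (intro mult_left_mono B) auto
      qed
      have val: "(LINT z|lborel. indicator Q1 z * K z $ i $ j * \<phi> z) = - (LINT z:Q1|lborel. u z $ i * dx j \<phi> z)" if "is_wgrad u K" for K
        using that \<phi> by (simp add: is_wgrad_def set_lebesgue_integral_def mult.assoc)
      have "(LINT z|lborel. indicator Q1 z * (G z $ i $ j - wgrad u z $ i $ j) * \<phi> z)
         = (LINT z|lborel. indicator Q1 z * G z $ i $ j * \<phi> z - indicator Q1 z * wgrad u z $ i $ j * \<phi> z)"
        by (simp only: right_diff_distrib left_diff_distrib)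
      also have "\<dots> = 0"
        by (subst Bochner_Integration.integral_diff[OF int2[OF G] int2[OF ex]]) (simp only: val[OF G] val[OF ex] diff_self)
      finally show "(LINT z|lborel. indicator Q1 z * (G z $ i $ j - wgrad u z $ i $ j) * \<phi> z) = 0" .
    qed
    have "AE z in lborel. \<forall>i j. z \<in> Q1 \<longrightarrow> G z $ i $ j - wgrad u z $ i $ j = 0"
      unfolding AE_all_countable using comp by blast
    then show ?thesis by eventually_elim (simp add: vec_eq_iff)
  qed
  ultimately show ?thesis by (simp add: wgrad_defined_def)
qed

section \<open>Location of the leakage set\<close>

lemma dd_eq_0_on_open:
  assumes "open U" "x \<in> U" "\<And>y. y \<in> U \<Longrightarrow> f y = 0"
  shows "dd b f x = 0"
proof -
  have "(f has_derivative (\<lambda>h. 0)) (at x)"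
    by (rule has_derivative_transform_within_open[OF has_derivative_const[of 0] assms(1,2)]) (use assms(3) in simp)
  then show ?thesis by (rule dd_eqI)
qed

text \<open>All derivatives vanish on the open complement of the support, and supports are closed.
  The leakage set therefore lies in the ball of radius 3/4, and leakage is bounded by norms over the
  unit ball.\<close>

lemma A_set_subset_supp: "A_set f \<subseteq> supp f"
proof -
  have U: "open (- supp f)" unfolding supp_def by (rule open_Compl[OF closed_closure])
  have f0: "f y = 0" if "y \<in> - supp f" for y
    using that closure_subset[of "{x. f x \<noteq> 0}"] by (auto simp: supp_def)
  have d0: "dd b f y = 0" if "y \<in> - supp f" for b y by (rule dd_eq_0_on_open[OF U that f0])
  have dd0: "dd b (dd b f) y = 0" if "y \<in> - supp f" for b y by (rule dd_eq_0_on_open[OF U that d0])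
  have "{x. grad f x \<noteq> 0} \<subseteq> supp f" "{x. laplacian f x \<noteq> 0} \<subseteq> supp f"
    using d0 dd0 by (auto simp: grad_def laplacian_def intro: ccontr)
  then show ?thesis
    unfolding A_set_def supp_def[of "grad f"] supp_def[of "laplacian f"]
    by (intro Un_least closure_minimal) (auto simp: supp_def)
qed

lemma A_set_measurable [measurable]: "A_set f \<in> sets borel"
  unfolding A_set_def supp_def by (intro sets.Un borel_closed) auto

lemma LLspace_mono:
  fixes f :: "spacetime \<Rightarrow> 'b::{banach, second_countable_topology}"
  assumes "f \<in> LLspace r r T" "S \<subseteq> T" "S \<in> sets borel" "0 < r"
  shows "f \<in> LLspace r r S"
  using assms Lspace_mono[of f r "T \<times> window" "S \<times> window"] by (auto simp: LLspace_eq_Lspace)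

section \<open>The quadratic source and the active pressure\<close>

lemma norm_F_act_le:
  assumes "\<And>x. \<bar>\<eta> x\<bar> \<le> E" "0 \<le> E"
  shows "norm (F_act \<eta> u z) \<le> 3 * E * (norm (u z))\<^sup>2"
proof -
  have row: "norm (F_act \<eta> u z $ i) \<le> E * (norm (u z))\<^sup>2" for i
  proof -
    \<comment> \<open>Each row of the tensor is a scalar multiple of the velocity; summing the three
      rows gives the factor 3.\<close>
    have "F_act \<eta> u z $ i = (\<eta> (fst z) * u z $ i) *\<^sub>R u z" by (simp add: F_act_def vec_eq_iff)
    then have "norm (F_act \<eta> u z $ i) = \<bar>\<eta> (fst z)\<bar> * (\<bar>u z $ i\<bar> * norm (u z))" by (simp add: abs_mult)
    also have "\<dots> \<le> E * (norm (u z) * norm (u z))"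
      by (intro mult_mono assms component_le_norm_cart mult_nonneg_nonneg) auto
    finally show ?thesis by (simp add: power2_eq_square)
  qed
  have "norm (F_act \<eta> u z) \<le> (\<Sum>i\<in>UNIV. norm (F_act \<eta> u z $ i))"
    unfolding norm_vec_def[of "F_act \<eta> u z"] by (rule L2_set_le_sum) simp
  also have "\<dots> \<le> (\<Sum>i\<in>(UNIV :: 3 set). E * (norm (u z))\<^sup>2)" by (intro sum_mono row)
  finally show ?thesis by simp
qed

text \<open>The tensor is quadratic in u, so its power 3/2 is controlled by |u|^3; the cutoff enters
  only through its bound and its continuity.\<close>

lemma F_act_in_X_src:
  assumes \<eta>: "\<eta> \<in> Cc_inf S" and u: "u \<in> Lspace 3 Q1"
  shows "F_act \<eta> u \<in> Lspace (3/2) Q1"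
proof -
  obtain E where E: "\<And>x. \<bar>\<eta> x\<bar> \<le> E" "0 \<le> E" using Cc_inf_bounded[OF \<eta>] by metis
  let ?u = "\<lambda>z. indicator Q1 z *\<^sub>R u z"
  have [measurable]: "?u \<in> borel_measurable borel" using u by (simp add: Lspace_def set_borel_measurable_def)
  have "set_borel_measurable lborel Q1 (F_act \<eta> u)"
  proof -
    \<comment> \<open>Only the velocity cut off outside \<open>Q1\<close> is known to be Borel. The
      tensor is a continuous function of position and velocity and is composed with that; off
      \<open>Q1\<close> the zero velocity yields the zero matrix.\<close>
    have "continuous_on UNIV (\<lambda>(x, v). ((\<chi> i j. \<eta> x * v $ i * v $ j) :: real^3^3))"
      unfolding case_prod_unfold
      by (intro continuous_on_vec_lambda continuous_intros continuous_on_compose2[OF Ck_0_continuous[OF \<eta>]]) auto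
    then have "(\<lambda>(x, v). ((\<chi> i j. \<eta> x * v $ i * v $ j) :: real^3^3)) \<in> borel_measurable (borel \<Otimes>\<^sub>M borel)"
      unfolding borel_prod by (rule borel_measurable_continuous_onI)
    moreover have "(\<lambda>z. (fst z, ?u z)) \<in> borel \<rightarrow>\<^sub>M (borel \<Otimes>\<^sub>M borel)"
      by (rule measurable_Pair, intro borel_measurable_continuous_onI continuous_intros, measurable)
    ultimately have "(\<lambda>z. (case (fst z, ?u z) of (x, v) \<Rightarrow> ((\<chi> i j. \<eta> x * v $ i * v $ j) :: real^3^3))) \<in> borel_measurable borel"
      by (rule measurable_compose[rotated])
    also have "(\<lambda>z. (case (fst z, ?u z) of (x, v) \<Rightarrow> ((\<chi> i j. \<eta> x * v $ i * v $ j) :: real^3^3))) = (\<lambda>z. indicator Q1 z *\<^sub>R F_act \<eta> u z)"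
      by (auto simp: fun_eq_iff vec_eq_iff F_act_def indicator_def)
    finally show ?thesis by (simp add: set_borel_measurable_def)
  qed
  moreover have "(\<integral>\<^sup>+ z\<in>Q1. ennreal (norm (F_act \<eta> u z) powr (3/2)) \<partial>lborel) < \<infinity>"
  proof -
    have "(\<integral>\<^sup>+ z\<in>Q1. ennreal (norm (F_act \<eta> u z) powr (3/2)) \<partial>lborel)
        \<le> (\<integral>\<^sup>+ z. ennreal ((3 * E) powr (3/2)) * ennreal (norm (?u z) powr 3) \<partial>lborel)"
    proof (rule nn_integral_mono)
      fix z
      have "norm (F_act \<eta> u z) powr (3/2) \<le> (3 * E * (norm (u z))\<^sup>2) powr (3/2)"
        by (intro powr_mono2 norm_F_act_le E) auto
      also have "\<dots> = (3 * E) powr (3/2) * ((norm (u z))\<^sup>2) powr (3/2)"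
        using E by (subst powr_mult) auto
      also have "((norm (u z))\<^sup>2) powr (3/2) = norm (u z) powr 3"
      proof (cases "u z = 0")
        case False
        then have "(norm (u z))\<^sup>2 = norm (u z) powr 2" by simp
        then show ?thesis by (simp only: powr_powr) simp
      qed simp
      finally have "ennreal (norm (F_act \<eta> u z) powr (3/2)) \<le> ennreal ((3 * E) powr (3/2) * norm (u z) powr 3)"
        by (rule ennreal_leI)
      then show "ennreal (norm (F_act \<eta> u z) powr (3/2)) * indicator Q1 z \<le> ennreal ((3 * E) powr (3/2)) * ennreal (norm (?u z) powr 3)"
        by (simp add: indicator_def ennreal_mult)
    qed
    also have "\<dots> = ennreal ((3 * E) powr (3/2)) * (\<integral>\<^sup>+ z. ennreal (norm (?u z) powr 3) \<partial>lborel)"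
      by (rule nn_integral_cmult) measurable
    also have "(\<integral>\<^sup>+ z. ennreal (norm (?u z) powr 3) \<partial>lborel) = (\<integral>\<^sup>+ z\<in>Q1. ennreal (norm (u z) powr 3) \<partial>lborel)"
      by (intro nn_integral_cong) (auto simp: indicator_def)
    also have "ennreal ((3 * E) powr (3/2)) * \<dots> < \<infinity>"
      using u by (simp add: Lspace_iff ennreal_mult_less_top)
    finally show ?thesis .
  qed
  ultimately show ?thesis by (simp add: Lspace_iff)
qed

lemma zero_ext_in_LLspace:
  fixes f :: "spacetime \<Rightarrow> real"
  assumes f: "f \<in> Lspace (3/2) Q1"
  shows "zero_ext f \<in> LLspace (3/2) (3/2) UNIV"
proof -
  have eq: "indicator (UNIV \<times> window) z *\<^sub>R zero_ext f z = indicator Q1 z *\<^sub>R f z" for z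
    by (cases z) (auto simp: zero_ext_def Q1_def indicator_def)
  have "set_borel_measurable lborel (UNIV \<times> window) (zero_ext f)"
    using f unfolding set_borel_measurable_def eq by (simp add: Lspace_def set_borel_measurable_def)
  moreover have "(\<integral>\<^sup>+ z\<in>UNIV \<times> window. ennreal (norm (zero_ext f z) powr (3/2)) \<partial>lborel) = (\<integral>\<^sup>+ z\<in>Q1. ennreal (norm (f z) powr (3/2)) \<partial>lborel)"
    by (intro nn_integral_cong) (auto simp: zero_ext_def Q1_def indicator_def)
  ultimately show ?thesis using f by (simp add: LLspace_eq_Lspace Lspace_iff)
qed

lemma F_ext_in_LLspace:
  assumes "\<eta> \<in> Cc_inf S" "u \<in> Lspace 3 Q1"
  shows "F_ext \<eta> u i j \<in> LLspace (3/2) (3/2) UNIV"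
proof -
  have "(\<lambda>z. F_act \<eta> u z $ i $ j) \<in> Lspace (3/2) Q1"
    by (intro Lspace_nth F_act_in_X_src[OF assms]) auto
  from zero_ext_in_LLspace[OF this] show ?thesis
    by (simp add: F_ext_def[abs_def] zero_ext_def[abs_def] if_distrib[of "\<lambda>v. v $ _"] cong: if_cong)
qed

lemma riesz_in_LLspace: "riesz_defined j G \<Longrightarrow> riesz j G \<in> LLspace (3/2) (3/2) UNIV"
  by (simp add: riesz_defined_def is_riesz_def)

text \<open>Each Riesz transform returns to the space over all of R^3 in which it started, so it can
  be applied twice.\<close>

lemma p_act_in_LLspace:
  assumes "\<eta> \<in> Cc_inf S" "u \<in> Lspace 3 Q1"
  shows "p_act \<eta> u \<in> LLspace (3/2) (3/2) UNIV"
proof -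
  have "(\<lambda>z. \<Sum>i\<in>UNIV. \<Sum>j\<in>UNIV. riesz i (riesz j (F_ext \<eta> u i j)) z) \<in> Lspace (3/2) (UNIV \<times> window)"
    using riesz_in_LLspace[OF riesz_defined[OF riesz_in_LLspace[OF riesz_defined[OF F_ext_in_LLspace[OF assms]]]]]
    by (intro Lspace_sum) (auto simp: LLspace_eq_Lspace)
  then show ?thesis by (simp add: p_act_def[abs_def] LLspace_eq_Lspace)
qed

section \<open>Energy and trace coordinates\<close>

lemma energy_pair_finite:
  assumes u: "u \<in> Linf_L2" and w: "wgrad u \<in> Lspace 2 Q1"
  shows "fst (energy_pair u) < \<infinity>" "snd (energy_pair u) < \<infinity>"
proof -
  show "snd (energy_pair u) < \<infinity>" using w by (simp add: energy_pair_def Lspace_iff)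
  let ?u = "\<lambda>z. indicator Q1 z *\<^sub>R u z"
  have [measurable]: "?u \<in> borel_measurable (borel \<Otimes>\<^sub>M borel)"
    using u by (simp add: Linf_L2_def set_borel_measurable_def borel_prod)
  obtain C where C: "AE t in lborel. t \<in> window \<longrightarrow> eLnorm 2 (ball0 1) (\<lambda>x. u (x, t)) \<le> ennreal C"
    using u by (auto simp: Linf_L2_def)
  let ?f = "\<lambda>t. \<integral>\<^sup>+ x\<in>ball0 1. ennreal (norm (u (x, t)) ^ 2) \<partial>lborel"
  \<comment> \<open>\<open>u\<close> is measurable only on \<open>Q1\<close>; for times in the
    window its slices over the ball coincide with those of the cutoff, which is jointly
    Borel.\<close>
  have "?f \<in> borel_measurable (restrict_space lborel window)"
  proof (subst measurable_cong)
    fix t assume "t \<in> space (restrict_space lborel window)"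
    then have "t \<in> window" by (simp add: space_restrict_space)
    then show "?f t = (\<integral>\<^sup>+ x. ennreal (norm (?u (x, t)) ^ 2) \<partial>lborel)"
      by (intro nn_integral_cong) (auto simp: Q1_def indicator_def)
  next
    have "(\<lambda>t. \<integral>\<^sup>+ x. ennreal (norm (?u (x, t)) ^ 2) \<partial>lborel) \<in> borel_measurable lborel" by measurable
    then show "(\<lambda>t. \<integral>\<^sup>+ x. ennreal (norm (?u (x, t)) ^ 2) \<partial>lborel) \<in> borel_measurable (restrict_space lborel window)"
      by (rule measurable_restrict_space1)
  qed
  moreover have "AE t in restrict_space lborel window. ?f t \<le> ennreal (\<bar>C\<bar> powr 2)"
  proof -
    have "AE t in lborel. t \<in> window \<longrightarrow> ?f t \<le> ennreal (\<bar>C\<bar> powr 2)"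
      using C
    proof eventually_elim
      case (elim t)
      show ?case
      proof
        assume "t \<in> window"
        \<comment> \<open>The real \<open>C\<close> may be negative, in which case
          \<open>ennreal C\<close> is 0; passing to |C| covers both cases, and undoing the square
          root gives the bound |C|^2.\<close>
        then have le: "epowr (?f t) (1 / 2) \<le> ennreal C" using elim by (simp add: eLnorm_def)
        show "?f t \<le> ennreal (\<bar>C\<bar> powr 2)"
        proof (cases "?f t")
          case (real v)
          then have "ennreal (v powr (1/2)) \<le> ennreal \<bar>C\<bar>"
            using le order_trans[OF _ ennreal_leI[of C "\<bar>C\<bar>"]] by (auto simp: epowr_def)
          then have "v powr (1/2) \<le> \<bar>C\<bar>" by (subst (asm) ennreal_le_iff) auto
          then have "(v powr (1/2)) powr 2 \<le> \<bar>C\<bar> powr 2" by (intro powr_mono2) auto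
          then have "v \<le> \<bar>C\<bar> powr 2" using real by (simp add: powr_powr del: powr_numeral)
          then show ?thesis using real by (simp add: ennreal_leI del: powr_numeral)
        next
          case top
          then show ?thesis using le by (simp add: epowr_def top_unique)
        qed
      qed
    qed
    then show ?thesis by (subst AE_restrict_space_iff) auto
  qed
  ultimately have "esssup (restrict_space lborel window) ?f \<le> ennreal (\<bar>C\<bar> powr 2)" by (rule esssup_I)
  then show "fst (energy_pair u) < \<infinity>"
    unfolding energy_pair_def fst_conv by (rule le_less_trans) simp
qed

lemma slice_in_Lspace:
  assumes u: "u \<in> Linf_L2" and t: "t \<in> window" and fin: "eLnorm 2 (ball0 1) (\<lambda>x. u (x, t)) < \<infinity>"
  shows "(\<lambda>x. u (x, t)) \<in> Lspace 2 (ball0 1)"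
proof -
  have [measurable]: "(\<lambda>z. indicator Q1 z *\<^sub>R u z) \<in> borel_measurable (borel \<Otimes>\<^sub>M borel)"
    using u by (simp add: Linf_L2_def set_borel_measurable_def borel_prod)
  have "(\<lambda>x. indicator Q1 (x, t) *\<^sub>R u (x, t)) \<in> borel_measurable borel" by measurable
  also have "(\<lambda>x. indicator Q1 (x, t) *\<^sub>R u (x, t)) = (\<lambda>x. indicator (ball0 1) x *\<^sub>R u (x, t))"
    using t by (auto simp: fun_eq_iff Q1_def indicator_def)
  finally show ?thesis using fin by (simp add: Lspace_def set_borel_measurable_def)
qed

section \<open>Assembly of the package\<close>

lemma canonical_core_finite:
  assumes c: "cutoffs \<eta> chi" and v: "valid_rules \<Lambda>" and a: "admissible_data \<Lambda> u p"
  shows "finite_core (res_space \<Lambda>) (canonical_core \<eta> chi \<Lambda> u p)"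
proof -
  have \<eta>: "\<eta> \<in> Cc_inf (ball0 1)" and chi: "supp chi \<subseteq> ball0 (3/4)" using c by (auto simp: cutoffs_def Cc_inf_def)
  have ns: "ns_data u p" using a by (simp add: admissible_data_def)
  have u: "u \<in> Lspace 3 Q1" and p: "p \<in> Lspace (3/2) Q1" using ns by (auto simp: ns_data_def)
  have "is_wgrad u (wgrad u)" using ns wgrad_defined by (auto simp: ns_data_def wgrad_defined_def)
  then have w: "wgrad u \<in> LLspace 2 2 (ball0 1)" by (simp add: is_wgrad_def)
  have F: "F_act \<eta> u \<in> Lspace (3/2) Q1" by (rule F_act_in_X_src[OF \<eta> u])
  note pa = p_act_in_LLspace[OF \<eta> u]
  have A: "A_set chi \<subseteq> ball0 1" using A_set_subset_supp[of chi] chi by (auto dest!: subsetD)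
  have LLu: "u \<in> LLspace 3 3 (ball0 1)" and LLp: "p \<in> LLspace (3/2) (3/2) (ball0 1)"
    using u p by (simp_all add: LLspace_eq_Lspace Q1_def)
  have ph: "(\<lambda>z. p z - p_act \<eta> u z) \<in> Y_harm"
  proof -
    have "p \<in> LLspace (3/2) (3/2) (ball0 (3/4))" by (rule LLspace_mono[OF LLp]) auto
    moreover have "p_act \<eta> u \<in> LLspace (3/2) (3/2) (ball0 (3/4))" by (rule LLspace_mono[OF pa]) auto
    ultimately show ?thesis unfolding Y_harm_def by (simp add: LLspace_eq_Lspace Lspace_diff)
  qed
  have leak: "eLLnorm 2 2 (A_set chi) (wgrad u) < \<infinity>" "eLLnorm 3 3 (A_set chi) u < \<infinity>" "eLLnorm (3/2) (3/2) (A_set chi) p < \<infinity>"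
    by (rule LLspace_imp_eLLnorm_finite, rule LLspace_mono[OF w A A_set_measurable], simp)
       (rule LLspace_imp_eLLnorm_finite, rule LLspace_mono[OF LLu A A_set_measurable], simp,
        rule LLspace_imp_eLLnorm_finite, rule LLspace_mono[OF LLp A A_set_measurable], simp)
  \<comment> \<open>Flux values are extended reals; the rule bounds them by a real-valued function
    of the norms, which excludes both infinities.\<close>
  have fl: "\<bar>\<pi> u p\<bar> \<noteq> \<infinity>" if \<pi>: "\<pi> \<in> set (flux_rules \<Lambda>)" for \<pi>
  proof -
    have rule: "\<forall>\<pi>\<in>set (flux_rules \<Lambda>). \<exists>\<Psi> :: real \<Rightarrow> real \<Rightarrow> real \<Rightarrow> real. \<forall>u p. ns_data u p \<longrightarrow>
        \<bar>\<pi> u p\<bar> \<le> ereal (\<Psi> (enn2real (eLnorm 3 Q1 u)) (enn2real (eLnorm (3/2) Q1 p))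
                            (enn2real (eLLnorm 2 2 (ball0 1) (wgrad u))))"
      using v unfolding valid_rules_def by (elim conjE)
    obtain \<Psi> :: "real \<Rightarrow> real \<Rightarrow> real \<Rightarrow> real" where "\<bar>\<pi> u p\<bar> \<le> ereal (\<Psi> (enn2real (eLnorm 3 Q1 u)) (enn2real (eLnorm (3/2) Q1 p))
        (enn2real (eLLnorm 2 2 (ball0 1) (wgrad u))))"
      using bspec[OF rule \<pi>] ns by blast
    then show ?thesis by auto
  qed
  have en: "case (if with_energy \<Lambda> then Some (energy_pair u) else None) of None \<Rightarrow> True | Some (a, b) \<Rightarrow> a < \<infinity> \<and> b < \<infinity>"
  proof (cases "with_energy \<Lambda>")
    case True
    then have "u \<in> Linf_L2" using a by (simp add: admissible_data_def)
    moreover have "wgrad u \<in> Lspace 2 Q1" using w by (simp add: LLspace_eq_Lspace Q1_def)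
    ultimately show ?thesis using True energy_pair_finite[of u] by (simp add: case_prod_unfold)
  qed simp
  \<comment> \<open>Choosing a trace time puts the data into \<open>Linf_L2\<close>, and the
    validity of the rules then provides finite local energy at that time.\<close>
  have tr: "case (case trace_choice \<Lambda> of No_Trace \<Rightarrow> None | Zero_Trace \<Rightarrow> Some (\<lambda>x. 0) | Trace_At tm \<Rightarrow> Some (\<lambda>x. u (x, tm u p))) of
      None \<Rightarrow> True | Some v \<Rightarrow> v \<in> Lspace 2 (ball0 1)"
  proof (cases "trace_choice \<Lambda>")
    case (Trace_At tm)
    then have "u \<in> Linf_L2" using a by (auto simp: admissible_data_def)
    moreover from this have "tm u p \<in> window" "eLnorm 2 (ball0 1) (\<lambda>x. u (x, tm u p)) < \<infinity>"
      using v Trace_At ns unfolding valid_rules_def by blast+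
    ultimately show ?thesis using Trace_At by (simp add: slice_in_Lspace)
  qed (simp_all add: Lspace_zero)
  have X: "X_src = Lspace (3/2) Q1" by (simp add: X_src_def LLspace_eq_Lspace Q1_def)
  have "p_act \<eta> u \<in> Y_prs" unfolding Y_prs_def by (rule LLspace_mono[OF pa]) auto
  moreover have "0 \<in> res_space \<Lambda>" using v by (simp add: valid_rules_def subspace_0)
  ultimately show ?thesis
    unfolding finite_core_def canonical_core_def
    using u p F ph leak fl en tr Lspace_zero[of "3/2" Q1] by (simp add: X X_vel_def)
qed

lemma canonical_package_sharp:
  assumes "cutoffs \<eta> chi" "valid_rules \<Lambda>" "admissible_data \<Lambda> u p"
  shows "sharp_package \<Lambda> (canonical_package \<eta> chi \<Lambda> u p)"
proof -
  let ?D = "canonical_core \<eta> chi \<Lambda> u p"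
  note fc = canonical_core_finite[OF assms]
  have "0 \<le> meas \<Lambda> a ?D \<and> meas \<Lambda> a ?D < \<infinity> \<and> \<bar>thr \<Lambda> a ?D\<bar> \<noteq> \<infinity>" if "a \<in> channels \<Lambda>" for a
    using assms(2) fc that by (simp add: valid_rules_def)
  \<comment> \<open>For finite \<open>b\<close> and \<open>t\<close> all terms are real, so no
    difference of infinities arises.\<close>
  moreover have "0 \<le> pos_part (t - b) \<and> pos_part (t - b) < \<infinity> \<and> 0 \<le> pos_part (b - t) \<and> pos_part (b - t) < \<infinity>
      \<and> 0 \<le> \<bar>b + pos_part (t - b) - t\<bar> \<and> \<bar>b + pos_part (t - b) - t\<bar> < \<infinity>"
    if "0 \<le> b \<and> b < \<infinity> \<and> \<bar>t\<bar> \<noteq> \<infinity>" for b t :: ereal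
    using that by (cases b; cases t) (auto simp: pos_part_def max_def)
  ultimately show ?thesis
    using fc by (simp add: sharp_package_def canonical_package_def Let_def)
qed

theorem theoremC34:
  fixes \<eta> chi :: "point \<Rightarrow> real"
    and \<Lambda> :: "('r::real_vector, 'c) rules"
    and u :: velocity and p :: pressure
    and D :: "('r, 'c) package"
    and rest :: "('r, 'c) package \<Rightarrow> real"
  assumes "cutoffs \<eta> chi"
    and "valid_rules \<Lambda>"
    and "admissible_data \<Lambda> u p"
    and "\<forall>D. 0 \<le> rest D"
    and "D = canonical_package \<eta> chi \<Lambda> u p"
  shows
    "wgrad_defined u
     \<and> (\<forall>i j. riesz_defined j (F_ext \<eta> u i j) \<and> riesz_defined i (riesz j (F_ext \<eta> u i j)))
     \<and> sharp_package \<Lambda> D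
     \<and> src_act (core D) \<in> X_src \<and> prs_act (core D) \<in> Y_prs \<and> prs_harm (core D) \<in> Y_harm
     \<and> leak_grad (core D) < \<infinity> \<and> leak_vel (core D) < \<infinity> \<and> leak_prs (core D) < \<infinity>
     \<and> (\<forall>K us ps Du Ru Rsrc Rprs Rharm RU RR RE.
          (\<forall>k\<le>K. admissible_data \<Lambda> (us k) (ps k))
          \<and> Du = (\<lambda>k::nat. core (canonical_package \<eta> chi \<Lambda> (us k) (ps k)))
          \<and> Ru \<in> X_vel \<rightarrow> X_vel \<and> Rsrc \<in> X_src \<rightarrow> X_src \<and> Rprs \<in> Y_prs \<rightarrow> Y_prs
          \<and> Rharm \<in> Y_harm \<rightarrow> Y_harm \<and> RU \<in> X_vel \<rightarrow> X_vel
          \<and> RR \<in> res_space \<Lambda> \<rightarrow> res_space \<Lambda> \<and> RE \<in> X_src \<rightarrow> X_src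
          \<longrightarrow> (\<forall>k<K.
                (\<lambda>z. vel (Du (Suc k)) z - Ru (vel (Du k)) z) \<in> X_vel
              \<and> (\<lambda>z. src_act (Du (Suc k)) z - Rsrc (src_act (Du k)) z) \<in> X_src
              \<and> (\<lambda>z. prs_act (Du (Suc k)) z - Rprs (prs_act (Du k)) z) \<in> Y_prs
              \<and> (\<lambda>z. prs_harm (Du (Suc k)) z - Rharm (prs_harm (Du k)) z) \<in> Y_harm))
     \<and> (\<forall>M. amplitude D \<le> M \<longrightarrow> D \<in> bounded_amplitude_class \<Lambda> M)
     \<and> (\<forall>M. quad_measure rest D \<le> M \<longrightarrow> D \<in> quadratic_geometry_class \<Lambda> rest M)"
proof -
  note c = assms(1) and v = assms(2) and a = assms(3)
  have ns: "ns_data u p" using a by (simp add: admissible_data_def)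
  have \<eta>: "\<eta> \<in> Cc_inf (ball0 1)" using c by (simp add: cutoffs_def)
  have u: "u \<in> Lspace 3 Q1" using ns by (simp add: ns_data_def)
  have wg: "wgrad_defined u" using ns by (intro wgrad_defined) (simp add: ns_data_def)
  have rz: "riesz_defined j (F_ext \<eta> u i j)" for i j by (rule riesz_defined[OF F_ext_in_LLspace[OF \<eta> u]])
  have rz2: "riesz_defined i (riesz j (F_ext \<eta> u i j))" for i j by (rule riesz_defined[OF riesz_in_LLspace[OF rz]])
  have sharp: "sharp_package \<Lambda> D" unfolding assms(5) by (rule canonical_package_sharp[OF c v a])
  then have core: "finite_core (res_space \<Lambda>) (core D)" by (simp add: sharp_package_def)
  \<comment> \<open>Stated for arbitrary data: all members of a chain share the cutoffs and rules
    and are covered at once.\<close>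
  have fc: "finite_core (res_space \<Lambda>) (core (canonical_package \<eta> chi \<Lambda> u' p'))" if "admissible_data \<Lambda> u' p'" for u' p'
    using canonical_package_sharp[OF c v that] by (simp add: sharp_package_def)
  have Xd: "\<And>f g. f \<in> X_vel \<Longrightarrow> g \<in> X_vel \<Longrightarrow> (\<lambda>z. f z - g z) \<in> X_vel"
    "\<And>f g. f \<in> X_src \<Longrightarrow> g \<in> X_src \<Longrightarrow> (\<lambda>z. f z - g z) \<in> X_src"
    "\<And>f g. f \<in> Y_prs \<Longrightarrow> g \<in> Y_prs \<Longrightarrow> (\<lambda>z. f z - g z) \<in> Y_prs"
    "\<And>f g. f \<in> Y_harm \<Longrightarrow> g \<in> Y_harm \<Longrightarrow> (\<lambda>z. f z - g z) \<in> Y_harm"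
    by (simp_all add: X_vel_def X_src_def Y_prs_def Y_harm_def LLspace_eq_Lspace Lspace_diff)
  \<comment> \<open>A drift is a difference of two elements of one space: the next coordinate, and
    the image of the current one under a map of that space into itself.\<close>
  have chain: "(\<lambda>z. vel D' z - Ru (vel D'') z) \<in> X_vel
              \<and> (\<lambda>z. src_act D' z - Rsrc (src_act D'') z) \<in> X_src
              \<and> (\<lambda>z. prs_act D' z - Rprs (prs_act D'') z) \<in> Y_prs
              \<and> (\<lambda>z. prs_harm D' z - Rharm (prs_harm D'') z) \<in> Y_harm"
    if "finite_core (res_space \<Lambda>) D'" "finite_core (res_space \<Lambda>) D''"
      "Ru \<in> X_vel \<rightarrow> X_vel" "Rsrc \<in> X_src \<rightarrow> X_src" "Rprs \<in> Y_prs \<rightarrow> Y_prs" "Rharm \<in> Y_harm \<rightarrow> Y_harm"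
    for D' D'' :: "'r core" and Ru Rsrc Rprs Rharm
    by (intro conjI Xd funcset_mem[OF that(3)] funcset_mem[OF that(4)] funcset_mem[OF that(5)] funcset_mem[OF that(6)])
       (use that(1,2) in \<open>simp_all add: finite_core_def\<close>)
  have coords: "src_act (core D) \<in> X_src" "prs_act (core D) \<in> Y_prs" "prs_harm (core D) \<in> Y_harm"
    "leak_grad (core D) < \<infinity>" "leak_vel (core D) < \<infinity>" "leak_prs (core D) < \<infinity>"
    using core by (simp_all add: finite_core_def)
  show ?thesis
  proof (intro conjI allI impI coords wg rz rz2 sharp)
    fix M assume "amplitude D \<le> M"
    then show "D \<in> bounded_amplitude_class \<Lambda> M" using sharp by (simp add: bounded_amplitude_class_def)
  next
    fix M assume "quad_measure rest D \<le> M"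
    then show "D \<in> quadratic_geometry_class \<Lambda> rest M" using sharp by (simp add: quadratic_geometry_class_def)
  next
    fix K :: nat and us ps Du Ru Rsrc Rprs Rharm RU k
    fix RR :: "'r \<Rightarrow> 'r" and RE
    assume A: "(\<forall>k\<le>K. admissible_data \<Lambda> (us k) (ps k))
          \<and> Du = (\<lambda>k::nat. core (canonical_package \<eta> chi \<Lambda> (us k) (ps k)))
          \<and> Ru \<in> X_vel \<rightarrow> X_vel \<and> Rsrc \<in> X_src \<rightarrow> X_src \<and> Rprs \<in> Y_prs \<rightarrow> Y_prs
          \<and> Rharm \<in> Y_harm \<rightarrow> Y_harm \<and> RU \<in> X_vel \<rightarrow> X_vel
          \<and> RR \<in> res_space \<Lambda> \<rightarrow> res_space \<Lambda> \<and> RE \<in> X_src \<rightarrow> X_src"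
    assume "k < K"
    then have "finite_core (res_space \<Lambda>) (Du (Suc k))" "finite_core (res_space \<Lambda>) (Du k)"
      using A fc by auto
    moreover have "Ru \<in> X_vel \<rightarrow> X_vel" "Rsrc \<in> X_src \<rightarrow> X_src" "Rprs \<in> Y_prs \<rightarrow> Y_prs" "Rharm \<in> Y_harm \<rightarrow> Y_harm"
      using A by - (elim conjE, assumption)+
    ultimately have drift: "(\<lambda>z. vel (Du (Suc k)) z - Ru (vel (Du k)) z) \<in> X_vel
              \<and> (\<lambda>z. src_act (Du (Suc k)) z - Rsrc (src_act (Du k)) z) \<in> X_src
              \<and> (\<lambda>z. prs_act (Du (Suc k)) z - Rprs (prs_act (Du k)) z) \<in> Y_prs
              \<and> (\<lambda>z. prs_harm (Du (Suc k)) z - Rharm (prs_harm (Du k)) z) \<in> Y_harm"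
      by (rule chain)
    show "(\<lambda>z. vel (Du (Suc k)) z - Ru (vel (Du k)) z) \<in> X_vel"
      "(\<lambda>z. src_act (Du (Suc k)) z - Rsrc (src_act (Du k)) z) \<in> X_src"
      "(\<lambda>z. prs_act (Du (Suc k)) z - Rprs (prs_act (Du k)) z) \<in> Y_prs"
      "(\<lambda>z. prs_harm (Du (Suc k)) z - Rharm (prs_harm (Du k)) z) \<in> Y_harm"
      using drift by - (elim conjE, assumption)+
  qed
qed

end
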